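(* As representations of $\mathfrak{sl}(4,\mathbb C)=\mathfrak{sl}(2,\mathbb H_{\mathbb C})\subset\mathfrak{gl}(2,\mathbb H_{\mathbb C})$ (via $\pi_l^0$), $\mathcal D^-\simeq\mathcal H^-$ and $\mathcal D^+\simeq\mathcal H^+$. Moreover, $\mathcal D^-$ and $\mathcal D^+$ are irreducible representations of $\mathfrak{sl}(4,\mathbb C)$ with highest (or lowest, depending on the choice of positive roots) weight vectors $t^{-\frac12}_{\frac12\,\underline{\frac12}}(Z)=\frac1{z_{11}}$ and $t^{-\frac12}_{-\frac12\,\underline{-\frac12}}(Z)=\frac1{z_{22}}$ respectively.
   Context: $\mathbb H_{\mathbb C}$ is the algebra of complex $2\times2$ matrices $Z=(z_{ij})$, $N(Z)=\det Z$; $GL(2,\mathbb H_{\mathbb C})=GL(4,\mathbb C)$ consists of $2\times2$ block matrices with blocks in $\mathbb H_{\mathbb C}$. It acts on (meromorphic) functions on $\mathbb H_{\mathbb C}$ by $$(\pi_l^0(h)\phi)(Z)=\frac1{N(cZ+d)}\,\phi\bigl((aZ+b)(cZ+d)^{-1}\bigr),\qquad h^{-1}=\begin{pmatrix}a&b\\c&d\end{pmatrix};$$ differentiating gives the action $\pi_l^0$ of $\mathfrak{gl}(2,\mathbb H_{\mathbb C})=\mathfrak{gl}(4,\mathbb C)$ and of its subalgebra $\mathfrak{sl}(4,\mathbb C)$. For $l\in\{-\frac12,-1,-\frac32,\dots\}$, $m,n\in\mathbb Z+l$ with $m,n\ge-l$ or $m,n\le l$, the function $$t^l_{n\,\underline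 m}(Z)=\frac1{2\pi i}\oint_{|s|=1}(sz_{11}+z_{21})^{l-m}(sz_{12}+z_{22})^{l+m}s^{-l+n}\frac{ds}s$$ (defined by this integral for $Z$ with $z_{22}=\overline{z_{11}}$, $z_{21}=\overline{z_{12}}$, $\det Z>0$; the exponents are integers) is a rational function of the $z_{ij}$ and is regarded as a meromorphic function on $\mathbb H_{\mathbb C}$. $\mathcal D^-$ (resp. $\mathcal D^+$) is the $\mathbb C$-span of the functions $t^l_{n\,\underline m}(Z)$ and $N(Z)^{-2l-1}t^l_{n\,\underline m}(Z)$ with $l\in\{-\frac12,-1,-\frac32,\dots\}$, $m,n\in\mathbb Z+l$ and $m,n\ge-l$ (resp. $m,n\le l$). $\mathcal H^+$ is the space of polynomials $\phi\in\mathbb C[z_{11},z_{12},z_{21},z_{22}]$ with $(\partial_{11}\partial_{22}-\partial_{12}\partial_{21})\phi=0$, where $\partial_{ij}=\partial/\partial z_{ij}$; $\mathcal H^-=\{N(Z)^{-1}\phi(Z^{-1}):\phi\in\mathcal H^+\}$; both carry the action $\pi_l^0$ of $\mathfrak{sl}(4,\mathbb C)$.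
   Formalization: The isomorphisms D^- ≃ H^- and D^+ ≃ H^+ are proved after twisting the action on H^± by one common inner automorphism of sl(4,C); untwisted they fail, since ∂/∂z22 is locally nilpotent on H^+ but not on 1/z22 in D^+, and similarly for D^-. *)

theory Defs
  imports
    "HOL-Complex_Analysis.Complex_Analysis"
    "HOL-Library.Function_Algebras"
begin

section \<open>Complexified quaternions and functions on them\<close>

type_synonym HC = "complex^2^2"

text \<open>
  Two-by-two block matrices with blocks in \<^typ>\<open>HC\<close>: the index type is a disjoint sum, the
  summands labelling the two block rows (columns).
\<close>
type_synonym gl4 = "complex^(2 + 2)^(2 + 2)"

definition N :: "HC \<Rightarrow> complex" where
  "N Z = det Z"

definition cscale :: "complex \<Rightarrow> (HC \<Rightarrow> complex) \<Rightarrow> (HC \<Rightarrow> complex)" where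
  "cscale c f = (\<lambda>Z. c * f Z)"

interpretation cfun: vector_space cscale
  by unfold_locales (auto simp: cscale_def fun_eq_iff algebra_simps)

text \<open>
  All meromorphic functions considered here are rational with poles contained in
  \<open>z\<^sub>1\<^sub>1 z\<^sub>2\<^sub>2 N(Z) = 0\<close>.  The complement \<open>regular_set\<close> of this hypersurface is open, dense and connected,
  so such a function is determined by its restriction to \<open>regular_set\<close>.  We represent it by this
  restriction, extended by 0; equality of representatives is then equality of meromorphic
  functions, and sums and scalar multiples are pointwise.
\<close>
definition regular_set :: "HC set" where
  "regular_set = {Z. Z $ 1 $ 1 \<noteq> 0 \<and> Z $ 2 $ 2 \<noteq> 0 \<and> N Z \<noteq> 0}"

definition mero :: "(HC \<Rightarrow> complex) \<Rightarrow> (HC \<Rightarrow> complex)" where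
  "mero f = (\<lambda>Z. if Z \<in> regular_set then f Z else 0)"

definition polynomials :: "(HC \<Rightarrow> complex) set" where
  "polynomials = cfun.span
     {\<lambda>Z. (Z $ 1 $ 1) ^ i * (Z $ 1 $ 2) ^ j * (Z $ 2 $ 1) ^ k * (Z $ 2 $ 2) ^ n | i j k n. True}"

definition rationals :: "(HC \<Rightarrow> complex) set" where
  "rationals = {mero (\<lambda>Z. p Z / q Z) | p q.
     p \<in> polynomials \<and> q \<in> polynomials \<and> (\<forall>Z \<in> regular_set. q Z \<noteq> 0)}"


section \<open>The action of the group and of its Lie algebra\<close>

definition block_a :: "gl4 \<Rightarrow> HC" where "block_a g = (\<chi> i j. g $ Inl i $ Inl j)"
definition block_b :: "gl4 \<Rightarrow> HC" where "block_b g = (\<chi> i j. g $ Inl i $ Inr j)"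
definition block_c :: "gl4 \<Rightarrow> HC" where "block_c g = (\<chi> i j. g $ Inr i $ Inl j)"
definition block_d :: "gl4 \<Rightarrow> HC" where "block_d g = (\<chi> i j. g $ Inr i $ Inr j)"

definition group_act :: "gl4 \<Rightarrow> (HC \<Rightarrow> complex) \<Rightarrow> (HC \<Rightarrow> complex)" where
  "group_act h \<phi> = (\<lambda>Z.
     let g = matrix_inv h; W = block_c g ** Z + block_d g
     in 1 / N W * \<phi> ((block_a g ** Z + block_b g) ** matrix_inv W))"

text \<open>
  The differential at the identity of \<^term>\<open>\<lambda>h. group_act h \<phi> Z\<close>, in the direction of the tangent
  vector \<open>X\<close>.  For \<open>Z\<close> in the open set \<open>regular_set\<close> only values of \<open>\<phi>\<close> near \<open>Z\<close> enter, so it does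
  not matter that the group itself moves \<open>regular_set\<close>.
\<close>
definition lie_act :: "gl4 \<Rightarrow> (HC \<Rightarrow> complex) \<Rightarrow> (HC \<Rightarrow> complex)" where
  "lie_act X \<phi> = mero (\<lambda>Z. frechet_derivative (\<lambda>h. group_act h \<phi> Z) (at (mat 1)) X)"

definition sl4 :: "gl4 set" where
  "sl4 = {X. trace X = 0}"


section \<open>Representations on spaces of functions\<close>

definition linear_between ::
    "(HC \<Rightarrow> complex) set \<Rightarrow> ((HC \<Rightarrow> complex) \<Rightarrow> (HC \<Rightarrow> complex)) \<Rightarrow> (HC \<Rightarrow> complex) set \<Rightarrow> bool" where
  "linear_between V T W \<longleftrightarrow> T ` V \<subseteq> W \<and>
     (\<forall>f\<in>V. \<forall>g\<in>V. T (f + g) = T f + T g) \<and>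
     (\<forall>c. \<forall>f\<in>V. T (cscale c f) = cscale c (T f))"

definition sl4_rep :: "(gl4 \<Rightarrow> (HC \<Rightarrow> complex) \<Rightarrow> (HC \<Rightarrow> complex)) \<Rightarrow> (HC \<Rightarrow> complex) set \<Rightarrow> bool" where
  "sl4_rep \<rho> V \<longleftrightarrow> cfun.subspace V \<and>
     (\<forall>X\<in>sl4. linear_between V (\<rho> X) V) \<and>
     (\<forall>X\<in>sl4. \<forall>Y\<in>sl4. \<forall>f\<in>V. \<rho> (X + Y) f = \<rho> X f + \<rho> Y f) \<and>
     (\<forall>c. \<forall>X\<in>sl4. \<forall>f\<in>V. \<rho> (mat c ** X) f = cscale c (\<rho> X f)) \<and>
     (\<forall>X\<in>sl4. \<forall>Y\<in>sl4. \<forall>f\<in>V. \<rho> (X ** Y - Y ** X) f = \<rho> X (\<rho> Y f) - \<rho> Y (\<rho> X f))"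

definition sl4_rep_iso ::
    "(gl4 \<Rightarrow> (HC \<Rightarrow> complex) \<Rightarrow> (HC \<Rightarrow> complex)) \<Rightarrow> (HC \<Rightarrow> complex) set \<Rightarrow>
     (gl4 \<Rightarrow> (HC \<Rightarrow> complex) \<Rightarrow> (HC \<Rightarrow> complex)) \<Rightarrow> (HC \<Rightarrow> complex) set \<Rightarrow> bool" where
  "sl4_rep_iso \<rho> V \<sigma> W \<longleftrightarrow> sl4_rep \<rho> V \<and> sl4_rep \<sigma> W \<and>
     (\<exists>T. linear_between V T W \<and> bij_betw T V W \<and>
          (\<forall>X\<in>sl4. \<forall>f\<in>V. T (\<rho> X f) = \<sigma> X (T f)))"

definition sl4_irreducible ::
    "(gl4 \<Rightarrow> (HC \<Rightarrow> complex) \<Rightarrow> (HC \<Rightarrow> complex)) \<Rightarrow> (HC \<Rightarrow> complex) set \<Rightarrow> bool" where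
  "sl4_irreducible \<rho> V \<longleftrightarrow> sl4_rep \<rho> V \<and> V \<noteq> {0} \<and>
     (\<forall>W. cfun.subspace W \<and> W \<subseteq> V \<and> (\<forall>X\<in>sl4. \<rho> X ` W \<subseteq> W) \<longrightarrow> W = {0} \<or> W = V)"

text \<open>
  Precomposition with the inner automorphism \<open>X \<mapsto> \<gamma>\<inverse> X \<gamma>\<close> of \<open>sl4\<close>.  It is needed to compare the spaces
  \<open>D_plus\<close>, \<open>D_minus\<close> below with \<open>H_plus\<close>, \<open>H_minus\<close>: the infinitesimal translations, acting by
  \<open>- \<partial>\<^sub>i\<^sub>j\<close>, are locally nilpotent on \<open>H_plus\<close> but not on \<open>D_plus\<close>, which contains \<open>1 / z\<^sub>2\<^sub>2\<close>, so that these
  two are isomorphic only up to such an automorphism (and likewise for \<open>D_minus\<close>, \<open>H_minus\<close>).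
\<close>
definition twist ::
    "gl4 \<Rightarrow> (gl4 \<Rightarrow> (HC \<Rightarrow> complex) \<Rightarrow> (HC \<Rightarrow> complex)) \<Rightarrow> gl4 \<Rightarrow> (HC \<Rightarrow> complex) \<Rightarrow> (HC \<Rightarrow> complex)" where
  "twist \<gamma> \<rho> X = \<rho> (matrix_inv \<gamma> ** X ** \<gamma>)"

definition cartan :: "gl4 set" where
  "cartan = {H \<in> sl4. \<forall>i j. i \<noteq> j \<longrightarrow> H $ i $ j = 0}"

text \<open>
  The pair \<open>(i, j)\<close> with \<open>i \<noteq> j\<close> stands for the root \<open>\<epsilon>\<^sub>i - \<epsilon>\<^sub>j\<close> with respect to \<open>cartan\<close>; the sum
  of the roots \<open>(i, j)\<close> and \<open>(k, l)\<close> is a root only if \<open>j = k\<close> and \<open>i \<noteq> l\<close> or vice versa, so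
  transitivity is closure under addition of roots.
\<close>
definition positive_roots :: "((2 + 2) \<times> (2 + 2)) set \<Rightarrow> bool" where
  "positive_roots P \<longleftrightarrow> P \<union> P\<inverse> = {(i, j). i \<noteq> j} \<and> P \<inter> P\<inverse> = {} \<and> trans P"

definition root_vector :: "2 + 2 \<Rightarrow> 2 + 2 \<Rightarrow> gl4" where
  "root_vector i j = (\<chi> k l. if k = i \<and> l = j then 1 else 0)"

definition highest_weight_vector ::
    "((2 + 2) \<times> (2 + 2)) set \<Rightarrow> (gl4 \<Rightarrow> (HC \<Rightarrow> complex) \<Rightarrow> (HC \<Rightarrow> complex)) \<Rightarrow>
     (HC \<Rightarrow> complex) set \<Rightarrow> (HC \<Rightarrow> complex) \<Rightarrow> bool" where
  "highest_weight_vector P \<rho> V v \<longleftrightarrow> v \<in> V \<and> v \<noteq> 0 \<and>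
     (\<forall>H\<in>cartan. \<exists>c. \<rho> H v = cscale c v) \<and>
     (\<forall>(i, j)\<in>P. \<rho> (root_vector i j) v = 0)"

definition lowest_weight_vector ::
    "((2 + 2) \<times> (2 + 2)) set \<Rightarrow> (gl4 \<Rightarrow> (HC \<Rightarrow> complex) \<Rightarrow> (HC \<Rightarrow> complex)) \<Rightarrow>
     (HC \<Rightarrow> complex) set \<Rightarrow> (HC \<Rightarrow> complex) \<Rightarrow> bool" where
  "lowest_weight_vector P \<rho> V v \<longleftrightarrow> highest_weight_vector (P\<inverse>) \<rho> V v"


section \<open>The matrix coefficients and the spaces spanned by them\<close>

definition real_cone :: "HC set" where
  "real_cone = {Z. Z $ 2 $ 2 = cnj (Z $ 1 $ 1) \<and> Z $ 2 $ 1 = cnj (Z $ 1 $ 2) \<and>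
     Re (det Z) > 0}"

text \<open>
  The parameters \<open>l, m, n\<close> are half-integers; for the admissible ones all exponents below are
  integers, and \<open>\<lfloor>_\<rfloor>\<close> only changes their type.
\<close>
definition t_integral :: "real \<Rightarrow> real \<Rightarrow> real \<Rightarrow> HC \<Rightarrow> complex" where
  "t_integral l n m Z = 1 / (2 * of_real pi * \<i>) *
     contour_integral (circlepath 0 1)
       (\<lambda>s. (s * Z $ 1 $ 1 + Z $ 2 $ 1) powi \<lfloor>l - m\<rfloor> * (s * Z $ 1 $ 2 + Z $ 2 $ 2) powi \<lfloor>l + m\<rfloor> *
            s powi \<lfloor>- l + n\<rfloor> / s)"

text \<open>
  A rational function is determined by its values on \<open>real_cone\<close>, which is open in a totally real
  subspace of maximal dimension (and contained in \<open>regular_set\<close>).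
\<close>
definition t :: "real \<Rightarrow> real \<Rightarrow> real \<Rightarrow> HC \<Rightarrow> complex" where
  "t l n m = (THE f. f \<in> rationals \<and> (\<forall>Z\<in>real_cone. f Z = t_integral l n m Z))"

definition neg_half_integers :: "real set" where
  "neg_half_integers = {- real k / 2 | k. k \<ge> 1}"

definition D_minus :: "(HC \<Rightarrow> complex) set" where
  "D_minus = cfun.span (\<Union>l\<in>neg_half_integers.
     \<Union>(m, n)\<in>{(m, n). m - l \<in> \<int> \<and> n - l \<in> \<int> \<and> m \<ge> - l \<and> n \<ge> - l}.
       {t l n m, \<lambda>Z. N Z powi \<lfloor>- 2 * l - 1\<rfloor> * t l n m Z})"

definition D_plus :: "(HC \<Rightarrow> complex) set" where
  "D_plus = cfun.span (\<Union>l\<in>neg_half_integers.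
     \<Union>(m, n)\<in>{(m, n). m - l \<in> \<int> \<and> n - l \<in> \<int> \<and> m \<le> l \<and> n \<le> l}.
       {t l n m, \<lambda>Z. N Z powi \<lfloor>- 2 * l - 1\<rfloor> * t l n m Z})"


section \<open>Harmonic polynomials\<close>

definition partial :: "2 \<Rightarrow> 2 \<Rightarrow> (HC \<Rightarrow> complex) \<Rightarrow> HC \<Rightarrow> complex" where
  "partial i j f Z = deriv (\<lambda>w. f (\<chi> k l. if k = i \<and> l = j then w else Z $ k $ l)) (Z $ i $ j)"

definition harmonic_polynomials :: "(HC \<Rightarrow> complex) set" where
  "harmonic_polynomials = {\<phi> \<in> polynomials.
     \<forall>Z. partial 1 1 (partial 2 2 \<phi>) Z - partial 1 2 (partial 2 1 \<phi>) Z = 0}"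

definition H_plus :: "(HC \<Rightarrow> complex) set" where
  "H_plus = mero ` harmonic_polynomials"

definition H_minus :: "(HC \<Rightarrow> complex) set" where
  "H_minus = {mero (\<lambda>Z. 1 / N Z * \<phi> (matrix_inv Z)) | \<phi>. \<phi> \<in> harmonic_polynomials}"

end

theory Submission
  imports Defs
begin

text \<open>
  The matrix \<open>half_inversion\<close>, which exchanges the second and the fourth basis vector of
  \<open>\<complex>\<^sup>4\<close>, acts on functions by
  \<open>(T f) Z = 1 / z\<^sub>2\<^sub>2 * f (N Z / z\<^sub>2\<^sub>2, z\<^sub>1\<^sub>2 / z\<^sub>2\<^sub>2; - z\<^sub>2\<^sub>1 / z\<^sub>2\<^sub>2, 1 / z\<^sub>2\<^sub>2)\<close>.  The whole theorem follows from the
  fact that \<open>T\<close> maps \<open>H_plus\<close> onto \<open>D_plus\<close> and \<open>H_minus\<close> onto \<open>D_minus\<close>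
  (\<open>D_plus_eq\<close>, \<open>D_minus_eq\<close>).  Since \<open>T\<close> is the action of a group element \<open>\<gamma>\<close>, it carries the
  representation \<open>lie_act\<close> into \<open>twist \<gamma> lie_act\<close> (\<open>lie_act_group_act\<close>), and \<open>T\<close> is an involution on
  functions supported in \<open>regular_set\<close>; so it is the required isomorphism.  In the same way
  \<open>H_minus\<close> is the image of \<open>H_plus\<close> under the matrix inversion \<open>Z \<mapsto> Z\<inverse>\<close>.  Hence only one
  representation, the one on harmonic polynomials, has to be studied.

  On polynomials the action is given by first order differential operators.  They satisfy the
  commutation relations of \<open>gl(4)\<close> because second partial derivatives commute
  (\<open>inf_act_bracket\<close>).  Infinitesimal translations act by \<open>- \<partial>\<^sub>i\<^sub>j\<close>, so every nonzero invariant
  subspace contains the constants.  Conversely the constant 1 generates everything: if \<open>U\<^sub>i\<^sub>j\<close> is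
  the operator \<open>raise i j\<close> belonging to the opposite root and \<open>E\<close> is the Euler operator, then
  \<open>E (E \<phi>) = \<Sum> U\<^sub>i\<^sub>j (\<partial>\<^sub>i\<^sub>j \<phi>)\<close> for harmonic \<open>\<phi>\<close>, which expresses a harmonic polynomial of degree \<open>n\<close>
  through harmonic polynomials of degree \<open>n - 1\<close> (\<open>harmonic_subset_raise_invariant\<close>).  The same
  induction shows that harmonic polynomials are spanned by the powers \<open>(u\<^sup>T Z v)\<^sup>n\<close>, whose span is
  invariant by inspection; so the harmonic polynomials form a representation.

  Taking coefficients of these powers in \<open>u\<close> and \<open>v\<close> gives a basis \<open>harm_basis\<close> of weight vectors.
  Cauchy's formula evaluates the integrals defining the matrix coefficients; the result \<open>t_coeff\<close>
  and its multiple by \<open>N ^ \<kappa>\<close> are, up to nonzero factors, exactly the \<open>T\<close>-images of this basis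
  (\<open>t_coeff_eq_harm_basis\<close>, \<open>N_power_t_coeff_eq_harm_basis\<close>).  This proves \<open>D_plus_eq\<close>.  The
  substitution \<open>s \<mapsto> 1 / s\<close> exchanges \<open>D_plus\<close> and \<open>D_minus\<close> at the price of the reflection
  \<open>flip\<close>, which reverses the order of rows and columns, and \<open>D_minus_eq\<close> follows from the relation
  between the three involutions in \<open>half_inversion_reflect\<close>.
\<close>

text \<open>The infix \<open>$\<close> is reserved for matrix entries; its other reading, coefficients of formal
  power series, would make every entry ambiguous.\<close>
no_notation fps_nth (infixl \<open>$\<close> 75)

section \<open>Derivatives of matrix functions\<close>

lemma matrix_inv_mult:
  fixes A :: "complex^'n^'n"
  assumes "invertible A"
  shows "A ** matrix_inv A = mat 1" "matrix_inv A ** A = mat 1"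
  using assms unfolding invertible_def matrix_inv_def by (metis (mono_tags, lifting) someI_ex)+

lemma matrix_inv_eqI:
  fixes A B :: "complex^'n^'n"
  assumes "A ** B = mat 1"
  shows "matrix_inv A = B"
proof -
  have BA: "B ** A = mat 1"
    using assms matrix_left_right_inverse by blast
  hence inv: "invertible A"
    using assms invertible_def by blast
  have "matrix_inv A = (B ** A) ** matrix_inv A"
    by (simp add: BA)
  also have "\<dots> = B"
    by (simp add: matrix_inv_mult[OF inv] flip: matrix_mul_assoc)
  finally show ?thesis .
qed

lemma has_derivative_vec_nth [derivative_intros]:
  assumes "(f has_derivative f') F"
  shows "((\<lambda>x. f x $ i) has_derivative (\<lambda>h. f' h $ i)) F"
  using bounded_linear.has_derivative[OF bounded_linear_vec_nth assms] .

text \<open>Derivatives of matrix functions are computed entry by entry; the basis of \<open>'b^'n\<close> as a Euclidean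
  space would split complex entries into real and imaginary parts.\<close>
lemma has_derivative_vecI:
  fixes f :: "'a::real_normed_vector \<Rightarrow> 'b::real_normed_vector^'n"
  assumes "\<And>i. ((\<lambda>x. f x $ i) has_derivative (\<lambda>h. f' h $ i)) F"
  shows "(f has_derivative f') F"
proof -
  have ax: "bounded_linear (axis i :: 'b \<Rightarrow> 'b^'n)" for i
    by (rule bounded_linear_intro[where K = 1]) 
       (auto simp: axis_def vec_eq_iff norm_vec_def L2_set_def if_distrib[of norm] if_distrib[of "\<lambda>a. a\<^sup>2"] cong: if_cong)
  have sum_axis: "(\<Sum>i\<in>UNIV. axis i (v $ i)) = v" for v :: "'b^'n"
    by (simp add: vec_eq_iff axis_def if_distrib[of "\<lambda>a. a $ _"] sum.delta cong: if_cong)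
  have "((\<lambda>x. \<Sum>i\<in>UNIV. axis i (f x $ i)) has_derivative (\<lambda>h. \<Sum>i\<in>UNIV. axis i (f' h $ i))) F"
    by (intro has_derivative_sum bounded_linear.has_derivative[OF ax] assms)
  thus ?thesis
    by (simp add: sum_axis)
qed

lemma has_derivative_matrix_mult [derivative_intros]:
  fixes f :: "'a::real_normed_vector \<Rightarrow> complex^'n^'m" and g :: "'a \<Rightarrow> complex^'k^'n"
  assumes "(f has_derivative f') (at x within S)" "(g has_derivative g') (at x within S)"
  shows "((\<lambda>x. f x ** g x) has_derivative (\<lambda>h. f x ** g' h + f' h ** g x)) (at x within S)"
  unfolding matrix_matrix_mult_def
  by (intro has_derivative_vecI)
     (auto intro!: derivative_eq_intros assms simp: sum.distrib)

lemma differentiable_det: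
  fixes f :: "'a::real_normed_vector \<Rightarrow> complex^'n^'n"
  assumes "\<And>i j. (\<lambda>x. f x $ i $ j) differentiable (at x)"
  shows "(\<lambda>x. det (f x)) differentiable (at x)"
proof -
  obtain D where D: "\<And>i j. ((\<lambda>x. f x $ i $ j) has_derivative D i j) (at x)"
    using assms unfolding differentiable_def by metis
  show ?thesis
    unfolding det_def
    by (intro differentiable_sum differentiable_mult differentiable_const ballI)
       (auto simp: differentiable_def intro!: has_derivative_prod exI D finite_permutations)
qed

lemma isCont_det:
  fixes f :: "'a::real_normed_vector \<Rightarrow> complex^'n^'n"
  assumes "isCont f x"
  shows "isCont (\<lambda>x. det (f x)) x"
  unfolding det_def by (intro continuous_intros assms)

text \<open>Differentiating \<open>A A\<inverse> = 1\<close> gives the derivative of inversion, once the inverse is known to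
  be differentiable; the latter is Cramer's rule.\<close>
lemma matrix_inv_has_derivative:
  "(matrix_inv has_derivative (\<lambda>X. - X)) (at (mat 1 :: complex^'n^'n))"
proof -
  let ?I = "mat 1 :: complex^'n^'n"
  define C where "C = (\<lambda>A :: complex^'n^'n. \<chi> k l. det (\<chi> i j. if j = k then axis l 1 $ i else A $ i $ j) / det A)"
  have inv_eq: "matrix_inv A = C A" if "det A \<noteq> 0" for A
  proof -
    have "A *v (\<chi> k. C A $ k $ l) = axis l 1" for l
      unfolding cramer[OF that] by (simp add: C_def vec_eq_iff)
    hence "A ** C A = mat 1"
      by (simp add: vec_eq_iff matrix_matrix_mult_def matrix_vector_mult_def mat_def axis_def)
    thus ?thesis
      by (rule matrix_inv_eqI)
  qed
  have ev: "\<forall>\<^sub>F A in at ?I. det A \<noteq> 0"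
  proof -
    have "isCont (\<lambda>A. det A) ?I"
      by (intro isCont_det continuous_ident)
    hence "((\<lambda>A. det A) \<longlongrightarrow> 1) (at ?I)"
      by (simp add: isCont_def)
    thus ?thesis
      by (rule tendsto_imp_eventually_ne) simp
  qed
  have coord: "(\<lambda>A :: complex^'n^'n. A $ i $ j) differentiable (at ?I)" for i j
    unfolding differentiable_def by (auto intro!: exI derivative_eq_intros)
  have "(\<lambda>A. C A $ k $ l) differentiable (at ?I)" for k l
  proof -
    have "(\<lambda>A. (\<chi> i j. if j = k then axis l 1 $ i else A $ i $ j) $ i $ j) differentiable (at ?I)" for i j
      by (cases "j = k") (auto simp: coord)
    from differentiable_det[OF this] differentiable_det[OF coord]
    show ?thesis
      unfolding C_def by (simp add: differentiable_divide)
  qed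
  then obtain D where D: "\<And>k l. ((\<lambda>A. C A $ k $ l) has_derivative D k l) (at ?I)"
    unfolding differentiable_def by metis
  define E where "E = (\<lambda>X. \<chi> k l. D k l X)"
  have CE: "(C has_derivative E) (at ?I)"
    by (intro has_derivative_vecI) (simp add: E_def D)
  have "((\<lambda>A. A ** C A) has_derivative (\<lambda>X. ?I ** E X + X ** C ?I)) (at ?I)"
    by (rule has_derivative_matrix_mult[OF has_derivative_ident CE])
  moreover have "((\<lambda>A. A ** C A) has_derivative (\<lambda>X. 0)) (at ?I)"
  proof (rule has_derivative_transform_eventually[OF has_derivative_const])
    show "\<forall>\<^sub>F A in at ?I. mat 1 = A ** C A"
      using ev by eventually_elim (metis inv_eq invertible_det_nz matrix_inv_mult(1))
    show "mat 1 = ?I ** C ?I"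
      by (metis inv_eq invertible_det_nz matrix_inv_mult(1) det_I zero_neq_one)
  qed simp
  ultimately have "(\<lambda>X. ?I ** E X + X ** C ?I) = (\<lambda>X. 0)"
    by (rule has_derivative_unique)
  moreover have C1: "C ?I = ?I"
    by (metis inv_eq matrix_inv_eqI det_I zero_neq_one matrix_mul_lid)
  ultimately have "E X = - X" for X
    by (metis add_eq_0_iff2 matrix_mul_lid matrix_mul_rid)
  hence "(C has_derivative (\<lambda>X. - X)) (at ?I)"
    using CE by (metis ext)
  thus ?thesis
    by (rule has_derivative_transform_eventually)
       (use ev C1 inv_eq in \<open>auto elim!: eventually_mono\<close>)
qed

section \<open>The infinitesimal action\<close>

lemma sum_UNIV_Plus: "(\<Sum>i\<in>(UNIV :: ('a::finite + 'b::finite) set). f i) = (\<Sum>i\<in>UNIV. f (Inl i)) + (\<Sum>i\<in>UNIV. f (Inr i))"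
  using sum.Plus[of "UNIV :: 'a set" "UNIV :: 'b set" f] by (simp add: UNIV_Plus_UNIV)

lemmas block_defs = block_a_def block_b_def block_c_def block_d_def

lemma block_mult:
  "block_a (g ** h) = block_a g ** block_a h + block_b g ** block_c h"
  "block_b (g ** h) = block_a g ** block_b h + block_b g ** block_d h"
  "block_c (g ** h) = block_c g ** block_a h + block_d g ** block_c h"
  "block_d (g ** h) = block_c g ** block_b h + block_d g ** block_d h"
  by (simp_all add: vec_eq_iff block_defs matrix_matrix_mult_def sum_UNIV_Plus)

lemma block_mat_1 [simp]:
  "block_a (mat 1) = mat 1" "block_b (mat 1) = 0" "block_c (mat 1) = 0" "block_d (mat 1) = mat 1"
  by (simp_all add: vec_eq_iff block_defs mat_def)

lemma block_minus [simp]: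
  "block_a (- X) = - block_a X" "block_b (- X) = - block_b X"
  "block_c (- X) = - block_c X" "block_d (- X) = - block_d X"
  by (simp_all add: vec_eq_iff block_defs)

lemma block_add:
  "block_a (X + Y) = block_a X + block_a Y" "block_b (X + Y) = block_b X + block_b Y"
  "block_c (X + Y) = block_c X + block_c Y" "block_d (X + Y) = block_d X + block_d Y"
  by (simp_all add: vec_eq_iff block_defs)

lemma block_diff:
  "block_a (X - Y) = block_a X - block_a Y" "block_b (X - Y) = block_b X - block_b Y"
  "block_c (X - Y) = block_c X - block_c Y" "block_d (X - Y) = block_d X - block_d Y"
  by (simp_all add: vec_eq_iff block_defs)

lemma has_derivative_block [derivative_intros]:
  assumes "(f has_derivative f') F"
  shows "((\<lambda>x. block_a (f x)) has_derivative (\<lambda>h. block_a (f' h))) F"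
    "((\<lambda>x. block_b (f x)) has_derivative (\<lambda>h. block_b (f' h))) F"
    "((\<lambda>x. block_c (f x)) has_derivative (\<lambda>h. block_c (f' h))) F"
    "((\<lambda>x. block_d (f x)) has_derivative (\<lambda>h. block_d (f' h))) F"
  unfolding block_defs
  by (intro has_derivative_vecI; simp; intro has_derivative_vec_nth assms)+

definition num :: "gl4 \<Rightarrow> HC \<Rightarrow> HC" where "num g Z = block_a g ** Z + block_b g"
definition den :: "gl4 \<Rightarrow> HC \<Rightarrow> HC" where "den g Z = block_c g ** Z + block_d g"
definition frac_lin :: "gl4 \<Rightarrow> HC \<Rightarrow> HC" where "frac_lin g Z = num g Z ** matrix_inv (den g Z)"

lemma group_act_eq:
  "group_act h \<phi> Z = 1 / N (den (matrix_inv h) Z) * \<phi> (frac_lin (matrix_inv h) Z)"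
  by (simp add: group_act_def Let_def den_def num_def frac_lin_def)

lemma matrix_inv_mat_1 [simp]: "matrix_inv (mat 1 :: complex^'n^'n) = mat 1"
  by (rule matrix_inv_eqI) simp

lemma num_mat_1 [simp]: "num (mat 1) Z = Z" and den_mat_1 [simp]: "den (mat 1) Z = mat 1"
  and frac_lin_mat_1 [simp]: "frac_lin (mat 1) Z = Z"
  by (simp_all add: num_def den_def frac_lin_def)

text \<open>Minus the velocity at \<open>Z\<close> of the curve \<open>h\<inverse> \<cdot> Z\<close> when \<open>h\<close> leaves the identity in the direction
  \<open>X\<close>; \<open>mult_factor X Z\<close> is minus the corresponding derivative of \<open>N (cZ + d)\<close>.\<close>
definition vfield :: "gl4 \<Rightarrow> HC \<Rightarrow> HC" where
  "vfield X Z = block_a X ** Z + block_b X - Z ** (block_c X ** Z + block_d X)"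

definition mult_factor :: "gl4 \<Rightarrow> HC \<Rightarrow> complex" where
  "mult_factor X Z = trace (block_c X ** Z + block_d X)"

lemma has_derivative_const_mult_right:
  fixes f :: "'a::real_normed_vector \<Rightarrow> complex^'n^'m" and Z :: "complex^'k^'n"
  assumes "(f has_derivative f') (at x)"
  shows "((\<lambda>x. f x ** Z) has_derivative (\<lambda>h. f' h ** Z)) (at x)"
  using has_derivative_matrix_mult[OF assms has_derivative_const, of Z] by simp

lemma matrix_minus_mult:
  fixes A :: "complex^'n^'m" and B :: "complex^'k^'n"
  shows "(- A) ** B = - (A ** B)" "A ** (- B) = - (A ** B)"
  by (simp_all add: vec_eq_iff matrix_matrix_mult_def sum_negf)

lemma matrix_add_rdistrib':
  fixes A B :: "complex^'n^'m" and C :: "complex^'k^'n"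
  shows "(A + B) ** C = A ** C + B ** C"
  by (simp add: vec_eq_iff matrix_matrix_mult_def sum.distrib algebra_simps)

lemma matrix_diff_distrib:
  fixes A B :: "complex^'n^'m" and C D :: "complex^'k^'n"
  shows "(A - B) ** C = A ** C - B ** C" "A ** (C - D) = A ** C - A ** D"
  by (simp_all add: vec_eq_iff matrix_matrix_mult_def sum_subtractf algebra_simps)

lemma num_inv_has_derivative:
  "((\<lambda>h. num (matrix_inv h) Z) has_derivative (\<lambda>X. - (block_a X ** Z + block_b X))) (at (mat 1))"
  unfolding num_def
  by (rule has_derivative_eq_rhs[OF has_derivative_add[OF has_derivative_const_mult_right]])
     (rule has_derivative_block matrix_inv_has_derivative | simp add: matrix_minus_mult)+

lemma den_inv_has_derivative:
  "((\<lambda>h. den (matrix_inv h) Z) has_derivative (\<lambda>X. - (block_c X ** Z + block_d X))) (at (mat 1))"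
  unfolding den_def
  by (rule has_derivative_eq_rhs[OF has_derivative_add[OF has_derivative_const_mult_right]])
     (rule has_derivative_block matrix_inv_has_derivative | simp add: matrix_minus_mult)+

lemma frac_lin_inv_has_derivative:
  "((\<lambda>h. frac_lin (matrix_inv h) Z) has_derivative (\<lambda>X. - vfield X Z)) (at (mat 1))"
proof -
  have "(matrix_inv has_derivative uminus) (at (den (matrix_inv (mat 1)) Z))"
    by (simp add: matrix_inv_has_derivative)
  from has_derivative_compose[OF den_inv_has_derivative this]
  have "((\<lambda>h. matrix_inv (den (matrix_inv h) Z)) has_derivative (\<lambda>X. block_c X ** Z + block_d X)) (at (mat 1))"
    by (simp only: minus_minus)
  from has_derivative_matrix_mult[OF num_inv_has_derivative this]
  show ?thesis
    by (simp add: frac_lin_def vfield_def algebra_simps)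
qed

text \<open>At the identity the action has the logarithmic derivative of the automorphy factor as its
  zeroth order part and (minus) the Lie derivative along \<open>vfield X\<close> as its first order part.\<close>
lemma group_act_has_derivative:
  assumes "(\<phi> has_derivative \<phi>') (at Z)"
  shows "((\<lambda>h. group_act h \<phi> Z) has_derivative (\<lambda>X. mult_factor X Z * \<phi> Z - \<phi>' (vfield X Z))) (at (mat 1))"
proof -
  have "(\<phi> has_derivative \<phi>') (at (frac_lin (matrix_inv (mat 1)) Z))"
    using assms by simp
  from has_derivative_compose[OF frac_lin_inv_has_derivative this]
  have 1: "((\<lambda>h. \<phi> (frac_lin (matrix_inv h) Z)) has_derivative (\<lambda>X. \<phi>' (- vfield X Z))) (at (mat 1))" .
  have 2: "((\<lambda>h. N (den (matrix_inv h) Z)) has_derivative (\<lambda>X. - mult_factor X Z)) (at (mat 1))"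
    unfolding N_def det_2
    by (rule has_derivative_eq_rhs, (rule derivative_intros den_inv_has_derivative)+)
       (simp only: matrix_inv_mat_1 den_mat_1, simp add: mat_def mult_factor_def trace_def sum_2 fun_eq_iff)
  have "N (den (matrix_inv (mat 1)) Z) \<noteq> 0"
    by (simp add: N_def)
  from has_derivative_mult[OF has_derivative_divide[OF has_derivative_const 2 this, of 1] 1]
  show ?thesis
    unfolding group_act_eq
    by (rule has_derivative_eq_rhs)
       (use linear_neg[OF has_derivative_linear[OF assms]] in \<open>simp add: N_def fun_eq_iff\<close>)
qed

lemma mero_cong: "(\<And>Z. Z \<in> regular_set \<Longrightarrow> f Z = g Z) \<Longrightarrow> mero f = mero g"
  by (auto simp: mero_def)

lemma mero_apply [simp]: "Z \<in> regular_set \<Longrightarrow> mero f Z = f Z"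
  by (simp add: mero_def)

lemma mero_mero [simp]: "mero (mero f) = mero f"
  by (auto simp: mero_def)

lemma open_regular_set: "open regular_set"
proof -
  have "regular_set = (\<lambda>Z. Z $ 1 $ 1 * Z $ 2 $ 2 * N Z) -` (- {0})"
    by (auto simp: regular_set_def)
  also have "open \<dots>"
    unfolding N_def det_2 by (intro open_vimage continuous_intros open_Compl)
  finally show ?thesis .
qed

text \<open>Cutting off outside an open set does not affect derivatives inside, so \<^const>\<open>mero\<close> may be
  dropped or inserted freely when differentiating.\<close>
lemma has_derivative_mero:
  assumes "Z \<in> regular_set"
  shows "(mero f has_derivative f') (at Z) \<longleftrightarrow> (f has_derivative f') (at Z)"
proof -
  have "\<forall>\<^sub>F W in at Z. mero f W = f W"
    using eventually_at_in_open'[OF open_regular_set assms] by eventually_elim simp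
  thus ?thesis
    using has_derivative_transform_eventually[of _ f' Z UNIV] assms
    by (auto elim!: has_derivative_transform_eventually eventually_mono)
qed

lemma lie_act_eq:
  assumes "(\<phi> has_derivative \<phi>') (at Z)" "Z \<in> regular_set"
  shows "lie_act X \<phi> Z = mult_factor X Z * \<phi> Z - \<phi>' (vfield X Z)"
  using frechet_derivative_at[OF group_act_has_derivative[OF assms(1)]] assms(2)
  by (metis (no_types, lifting) lie_act_def mero_apply)

text \<open>The block column \<open>(num h Z, den h Z)\<close> is \<open>h\<close> times the column \<open>(Z, 1)\<close>, and equals the column
  \<open>(h \<cdot> Z, 1)\<close> times \<open>den h Z\<close>; apply \<open>g\<close> to both descriptions.\<close>
lemma num_den_mult:
  assumes "N (den h Z) \<noteq> 0"
  shows "num (g ** h) Z = num g (frac_lin h Z) ** den h Z"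
    and "den (g ** h) Z = den g (frac_lin h Z) ** den h Z"
proof -
  have "invertible (den h Z)"
    using assms by (simp add: N_def invertible_det_nz)
  hence "frac_lin h Z ** den h Z = num h Z"
    by (simp add: frac_lin_def matrix_inv_mult flip: matrix_mul_assoc)
  hence eq: "block_a h ** Z + block_b h = frac_lin h Z ** den h Z"
    by (simp add: num_def)
  have "num (g ** h) Z = block_a g ** (block_a h ** Z + block_b h) + block_b g ** den h Z"
    "den (g ** h) Z = block_c g ** (block_a h ** Z + block_b h) + block_d g ** den h Z"
    by (simp_all add: num_def den_def block_mult matrix_add_rdistrib' matrix_add_ldistrib matrix_mul_assoc)
  thus "num (g ** h) Z = num g (frac_lin h Z) ** den h Z"
    "den (g ** h) Z = den g (frac_lin h Z) ** den h Z"
    unfolding eq by (simp_all add: num_def den_def[of g] matrix_add_rdistrib' matrix_mul_assoc)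
qed

lemma N_mult: "N (A ** B) = N A * N B"
  by (simp add: N_def det_mul)

lemma matrix_inv_mult_rev:
  fixes A B :: "complex^'n^'n"
  assumes "invertible A" "invertible B"
  shows "matrix_inv (A ** B) = matrix_inv B ** matrix_inv A"
proof (rule matrix_inv_eqI)
  have "A ** B ** (matrix_inv B ** matrix_inv A) = A ** (B ** matrix_inv B) ** matrix_inv A"
    by (simp add: matrix_mul_assoc)
  thus "A ** B ** (matrix_inv B ** matrix_inv A) = mat 1"
    by (simp add: matrix_inv_mult assms)
qed

text \<open>The cocycle identity.  If \<^term>\<open>den (matrix_inv h) (frac_lin (matrix_inv g) Z)\<close> is singular,
  both sides vanish because \<open>1 / 0 = 0\<close>.\<close>
lemma group_act_mult:
  assumes g: "invertible g" and h: "invertible h" and nz: "N (den (matrix_inv g) Z) \<noteq> 0"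
  shows "group_act (g ** h) \<phi> Z = group_act g (group_act h \<phi>) Z"
proof -
  let ?g = "matrix_inv g" and ?h = "matrix_inv h"
  let ?W = "frac_lin ?g Z"
  have den: "den (matrix_inv (g ** h)) Z = den ?h ?W ** den ?g Z"
    and num: "num (matrix_inv (g ** h)) Z = num ?h ?W ** den ?g Z"
    using num_den_mult[OF nz] by (simp_all add: matrix_inv_mult_rev g h)
  have inv: "invertible (den ?g Z)"
    using nz by (simp add: N_def invertible_det_nz)
  show ?thesis
  proof (cases "N (den ?h ?W) = 0")
    case True
    thus ?thesis by (simp add: group_act_eq den N_mult)
  next
    case False
    hence inv': "invertible (den ?h ?W)"
      by (simp add: N_def invertible_det_nz)
    have "frac_lin (matrix_inv (g ** h)) Z
        = num ?h ?W ** (den ?g Z ** matrix_inv (den ?g Z)) ** matrix_inv (den ?h ?W)"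
      unfolding frac_lin_def[of "matrix_inv (g ** h)"] den num matrix_inv_mult_rev[OF inv' inv]
      by (simp only: matrix_mul_assoc)
    hence "frac_lin (matrix_inv (g ** h)) Z = frac_lin ?h ?W"
      by (simp add: matrix_inv_mult inv frac_lin_def[of ?h])
    thus ?thesis
      by (simp add: group_act_eq den N_mult)
  qed
qed

lemma eventually_near_identity:
  assumes Z: "Z \<in> regular_set"
  shows "\<forall>\<^sub>F h in at (mat 1). invertible h \<and> N (den (matrix_inv h) Z) \<noteq> 0 \<and> frac_lin (matrix_inv h) Z \<in> regular_set"
proof -
  have 1: "\<forall>\<^sub>F h in at (mat 1 :: gl4). det h \<noteq> 0"
    using isCont_det[where f = "\<lambda>h :: gl4. h" and x = "mat 1"]
    by (intro tendsto_imp_eventually_ne[of _ 1]) (simp_all add: isCont_def)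
  have "isCont (\<lambda>h. den (matrix_inv h) Z) (mat 1)"
    by (rule has_derivative_continuous[OF den_inv_has_derivative])
  from isCont_det[OF this] have 2: "\<forall>\<^sub>F h in at (mat 1). N (den (matrix_inv h) Z) \<noteq> 0"
    by (intro tendsto_imp_eventually_ne[of _ 1]) (simp_all add: isCont_def N_def)
  have "((\<lambda>h. frac_lin (matrix_inv h) Z) \<longlongrightarrow> Z) (at (mat 1))"
    using has_derivative_continuous[OF frac_lin_inv_has_derivative[of Z]] by (simp add: isCont_def)
  from topological_tendstoD[OF this open_regular_set Z] 1 2
  show ?thesis
    by eventually_elim (simp add: invertible_det_nz)
qed

text \<open>Equivariance: for \<open>h\<close> near the identity \<open>\<pi>(h) \<pi>(g) = \<pi>(g) \<pi>(g\<inverse> h g)\<close>; differentiate in \<open>h\<close>.\<close>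
lemma lie_act_group_act:
  assumes g: "invertible g"
    and reg: "\<And>Z. Z \<in> regular_set \<Longrightarrow> N (den (matrix_inv g) Z) \<noteq> 0 \<and> frac_lin (matrix_inv g) Z \<in> regular_set"
    and diff: "\<And>Z. Z \<in> regular_set \<Longrightarrow> \<phi> differentiable (at Z)"
  shows "lie_act X (mero (group_act g \<phi>)) = mero (group_act g (twist g lie_act X \<phi>))"
proof -
  have "lie_act X (mero (group_act g \<phi>)) Z = group_act g (twist g lie_act X \<phi>) Z" if Z: "Z \<in> regular_set" for Z
  proof -
    let ?W = "frac_lin (matrix_inv g) Z" and ?c = "1 / N (den (matrix_inv g) Z)"
    \<comment> \<open>Conjugation by \<open>g\<close> is linear and fixes the identity, so it is its own derivative there.\<close>
    let ?conj = "\<lambda>h. matrix_inv g ** h ** g"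
    have W: "?W \<in> regular_set" and nz: "N (den (matrix_inv g) Z) \<noteq> 0"
      using reg[OF Z] by auto
    obtain \<phi>' where \<phi>': "(\<phi> has_derivative \<phi>') (at ?W)"
      using diff[OF W] by (auto simp: differentiable_def)
    let ?D = "\<lambda>X. mult_factor X ?W * \<phi> ?W - \<phi>' (vfield X ?W)"
    have conj: "(?conj has_derivative ?conj) (at (mat 1))"
      using has_derivative_const_mult_right[OF has_derivative_matrix_mult[OF has_derivative_const has_derivative_ident]]
      by simp
    have conj1: "?conj (mat 1) = mat 1"
      by (simp add: matrix_inv_mult g)
    have "((\<lambda>h. group_act h \<phi> ?W) has_derivative ?D) (at (?conj (mat 1)))"
      unfolding conj1 by (rule group_act_has_derivative[OF \<phi>'])
    from has_derivative_compose[OF conj this]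
    have deriv: "((\<lambda>h. ?c * group_act (?conj h) \<phi> ?W) has_derivative (\<lambda>X. ?c * ?D (?conj X))) (at (mat 1))"
      by (rule has_derivative_mult_right)
    have eq: "?c * group_act (?conj h) \<phi> ?W = group_act h (mero (group_act g \<phi>)) Z"
      if h: "invertible h" "N (den (matrix_inv h) Z) \<noteq> 0" "frac_lin (matrix_inv h) Z \<in> regular_set" for h
    proof -
      have inv: "invertible (?conj h)"
        using g h by (metis invertible_mult invertible_def matrix_inv_mult)
      have "?c * group_act (?conj h) \<phi> ?W = group_act g (group_act (?conj h) \<phi>) Z"
        by (simp add: group_act_eq[of g])
      also have "\<dots> = group_act (g ** ?conj h) \<phi> Z"
        using group_act_mult[OF g inv nz] by simp
      also have "g ** ?conj h = h ** g"
        by (simp add: matrix_mul_assoc matrix_inv_mult g)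
      also have "group_act (h ** g) \<phi> Z = group_act h (group_act g \<phi>) Z"
        by (rule group_act_mult[OF h(1) g h(2)])
      also have "\<dots> = group_act h (mero (group_act g \<phi>)) Z"
        using h(3) by (simp add: group_act_eq[of h])
      finally show ?thesis .
    qed
    have "((\<lambda>h. group_act h (mero (group_act g \<phi>)) Z) has_derivative (\<lambda>X. ?c * ?D (?conj X))) (at (mat 1))"
    proof (rule has_derivative_transform_eventually[OF deriv])
      show "\<forall>\<^sub>F h in at (mat 1). ?c * group_act (?conj h) \<phi> ?W = group_act h (mero (group_act g \<phi>)) Z"
        using eventually_near_identity[OF Z] by eventually_elim (use eq in blast)
      show "?c * group_act (?conj (mat 1)) \<phi> ?W = group_act (mat 1) (mero (group_act g \<phi>)) Z"
        by (rule eq) (use Z in \<open>simp_all add: N_def invertible_det_nz\<close>)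
    qed simp
    from frechet_derivative_at[OF this, symmetric] Z
    have "lie_act X (mero (group_act g \<phi>)) Z = ?c * ?D (?conj X)"
      by (simp add: lie_act_def)
    also have "\<dots> = group_act g (twist g lie_act X \<phi>) Z"
      by (simp add: group_act_eq[of g] twist_def lie_act_eq[OF \<phi>' W])
    finally show ?thesis .
  qed
  thus ?thesis
    by (auto simp: mero_def lie_act_def)
qed

section \<open>The algebra of polynomials\<close>

lemma subspace_polynomials: "cfun.subspace polynomials"
  by (simp add: polynomials_def)

text \<open>Closure properties of subspaces of functions for explicit abstractions, which is the form in
  which polynomials are written below.\<close>
lemma subspace_fun_add: "cfun.subspace W \<Longrightarrow> f \<in> W \<Longrightarrow> g \<in> W \<Longrightarrow> (\<lambda>Z. f Z + g Z) \<in> W"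
  using cfun.subspace_add[of W f g] by (simp add: plus_fun_def)

lemma subspace_fun_diff: "cfun.subspace W \<Longrightarrow> f \<in> W \<Longrightarrow> g \<in> W \<Longrightarrow> (\<lambda>Z. f Z - g Z) \<in> W"
  using cfun.subspace_diff[of W f g] by (simp add: fun_diff_def)

lemma subspace_fun_scale: "cfun.subspace W \<Longrightarrow> f \<in> W \<Longrightarrow> (\<lambda>Z. c * f Z) \<in> W"
  using cfun.subspace_scale[of W f c] by (simp add: cscale_def)

lemma subspace_fun_0: "cfun.subspace W \<Longrightarrow> (\<lambda>Z. 0) \<in> W"
  using cfun.subspace_0[of W] by (simp add: zero_fun_def)

lemma subspace_fun_sum:
  assumes "cfun.subspace W" "\<And>i. i \<in> I \<Longrightarrow> f i \<in> W"
  shows "(\<lambda>Z. \<Sum>i\<in>I. f i Z) \<in> W"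
  using assms(2) by (induction I rule: infinite_finite_induct)
    (auto intro: subspace_fun_0[OF assms(1)] subspace_fun_add[OF assms(1)])

lemmas subspace_fun_intros = subspace_fun_add subspace_fun_diff subspace_fun_scale subspace_fun_0

lemma subspace_funI:
  assumes "(\<lambda>Z. 0) \<in> W" "\<And>f g. f \<in> W \<Longrightarrow> g \<in> W \<Longrightarrow> (\<lambda>Z. f Z + g Z) \<in> W"
    "\<And>c f. f \<in> W \<Longrightarrow> (\<lambda>Z. c * f Z) \<in> W"
  shows "cfun.subspace W"
  using assms by (auto simp: cfun.subspace_def zero_fun_def plus_fun_def cscale_def)

lemma polynomials_const [simp]: "(\<lambda>Z. c) \<in> polynomials"
proof -
  have "(\<lambda>Z. (Z $ 1 $ 1) ^ 0 * (Z $ 1 $ 2) ^ 0 * (Z $ 2 $ 1) ^ 0 * (Z $ 2 $ 2) ^ 0) \<in> polynomials"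
    unfolding polynomials_def by (rule cfun.span_base) blast
  from subspace_fun_scale[OF subspace_polynomials this, of c] show ?thesis
    by simp
qed

lemma polynomials_add [simp]:
  "f \<in> polynomials \<Longrightarrow> g \<in> polynomials \<Longrightarrow> (\<lambda>Z. f Z + g Z) \<in> polynomials"
  by (rule subspace_fun_add[OF subspace_polynomials])

lemma polynomials_diff [simp]:
  "f \<in> polynomials \<Longrightarrow> g \<in> polynomials \<Longrightarrow> (\<lambda>Z. f Z - g Z) \<in> polynomials"
  by (rule subspace_fun_diff[OF subspace_polynomials])

lemma polynomials_mult [simp]:
  assumes "f \<in> polynomials" "g \<in> polynomials"
  shows "(\<lambda>Z. f Z * g Z) \<in> polynomials"
proof -
  let ?M = "{\<lambda>Z :: HC. (Z $ 1 $ 1) ^ i * (Z $ 1 $ 2) ^ j * (Z $ 2 $ 1) ^ k * (Z $ 2 $ 2) ^ n | i j k n. True}"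
  have mono: "(\<lambda>Z. f Z * g Z) \<in> polynomials" if "f \<in> ?M" "g \<in> ?M" for f g
  proof -
    from that obtain i j k n i' j' k' n' where
      "f = (\<lambda>Z :: HC. (Z $ 1 $ 1) ^ i * (Z $ 1 $ 2) ^ j * (Z $ 2 $ 1) ^ k * (Z $ 2 $ 2) ^ n)"
      "g = (\<lambda>Z :: HC. (Z $ 1 $ 1) ^ i' * (Z $ 1 $ 2) ^ j' * (Z $ 2 $ 1) ^ k' * (Z $ 2 $ 2) ^ n')"
      by blast
    hence "(\<lambda>Z. f Z * g Z) = (\<lambda>Z :: HC. (Z $ 1 $ 1) ^ (i + i') * (Z $ 1 $ 2) ^ (j + j') *
        (Z $ 2 $ 1) ^ (k + k') * (Z $ 2 $ 2) ^ (n + n'))"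
      by (simp add: power_add mult_ac)
    thus ?thesis
      unfolding polynomials_def by (intro cfun.span_base) blast
  qed
  have left: "(\<lambda>Z. f Z * g Z) \<in> polynomials" if "f \<in> polynomials" "g \<in> ?M" for f g
  proof -
    have "cfun.subspace {f. (\<lambda>Z. f Z * g Z) \<in> polynomials}"
      by (rule subspace_funI) (auto simp: distrib_right mult.assoc intro: subspace_fun_scale[OF subspace_polynomials])
    thus ?thesis
      using cfun.span_induct[of f ?M "\<lambda>f. (\<lambda>Z. f Z * g Z) \<in> polynomials"] that mono
      by (simp add: polynomials_def)
  qed
  have "cfun.subspace {g. (\<lambda>Z. f Z * g Z) \<in> polynomials}"
    by (rule subspace_funI) (auto simp: distrib_left mult.left_commute intro: subspace_fun_scale[OF subspace_polynomials])
  thus ?thesis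
    using cfun.span_induct[of g ?M "\<lambda>g. (\<lambda>Z. f Z * g Z) \<in> polynomials"] left assms
    by (simp add: polynomials_def)
qed

lemma polynomials_power [simp]: "f \<in> polynomials \<Longrightarrow> (\<lambda>Z. f Z ^ n) \<in> polynomials"
  by (induction n) auto

lemma polynomials_sum [simp]:
  "(\<And>i. i \<in> I \<Longrightarrow> f i \<in> polynomials) \<Longrightarrow> (\<lambda>Z. \<Sum>i\<in>I. f i Z) \<in> polynomials"
  by (rule subspace_fun_sum[OF subspace_polynomials])

lemma polynomials_coord [simp]: "(\<lambda>Z. Z $ i $ j) \<in> polynomials"
proof -
  have mono: "(\<lambda>Z. (Z $ 1 $ 1) ^ a * (Z $ 1 $ 2) ^ b * (Z $ 2 $ 1) ^ c * (Z $ 2 $ 2) ^ d) \<in> polynomials" for a b c d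
    unfolding polynomials_def by (rule cfun.span_base) blast
  show ?thesis
    using exhaust_2[of i] exhaust_2[of j] mono[of 1 0 0 0] mono[of 0 1 0 0] mono[of 0 0 1 0] mono[of 0 0 0 1]
    by auto
qed

text \<open>The span of the monomials is the algebra generated by constants and coordinates; the induction
  rule makes the derivation rules below provable without reference to monomials.\<close>
lemma polynomials_induct [consumes 1, case_names const coord add mult]:
  assumes "f \<in> polynomials"
    and const: "\<And>c. P (\<lambda>Z. c)" and coord: "\<And>i j. P (\<lambda>Z. Z $ i $ j)"
    and add: "\<And>f g. f \<in> polynomials \<Longrightarrow> g \<in> polynomials \<Longrightarrow> P f \<Longrightarrow> P g \<Longrightarrow> P (\<lambda>Z. f Z + g Z)"
    and mult: "\<And>f g. f \<in> polynomials \<Longrightarrow> g \<in> polynomials \<Longrightarrow> P f \<Longrightarrow> P g \<Longrightarrow> P (\<lambda>Z. f Z * g Z)"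
  shows "P f"
proof -
  have pow: "P (\<lambda>Z. (Z $ i $ j) ^ n)" for i j n
    by (induction n) (auto intro: const mult coord)
  have mono: "P (\<lambda>Z. (Z $ 1 $ 1) ^ i * (Z $ 1 $ 2) ^ j * (Z $ 2 $ 1) ^ k * (Z $ 2 $ 2) ^ n)" for i j k n
    by (intro mult pow) auto
  have "cfun.subspace {f \<in> polynomials. P f}"
    by (rule subspace_funI) (auto intro: const add mult)
  moreover have "{\<lambda>Z. (Z $ 1 $ 1) ^ i * (Z $ 1 $ 2) ^ j * (Z $ 2 $ 1) ^ k * (Z $ 2 $ 2) ^ n | i j k n. True}
      \<subseteq> {f \<in> polynomials. P f}"
    by (auto intro: mono)
  ultimately have "polynomials \<subseteq> {f \<in> polynomials. P f}"
    unfolding polynomials_def by (metis (no_types, lifting) cfun.span_minimal)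
  thus ?thesis
    using assms(1) by auto
qed

section \<open>Partial derivatives of polynomials\<close>

text \<open>Partial derivatives are read off from a complex linear total derivative.  Total derivatives are
  what the chain rule for the group action needs; partial derivatives define harmonicity.\<close>
lemma partial_eqI:
  assumes "(f has_derivative (\<lambda>H. \<Sum>i\<in>UNIV. \<Sum>j\<in>UNIV. d i j * H $ i $ j)) (at Z)"
  shows "partial i j f Z = d i j"
proof -
  let ?u = "\<lambda>w. (\<chi> k l. if k = i \<and> l = j then w else Z $ k $ l) :: HC"
  let ?d = "\<lambda>H :: HC. \<Sum>i\<in>UNIV. \<Sum>j\<in>UNIV. d i j * H $ i $ j"
  have uZ: "?u (Z $ i $ j) = Z"
    by (simp add: vec_eq_iff)
  have u: "(?u has_derivative (\<lambda>w. (\<chi> k l. if k = i \<and> l = j then w else 0))) (at (Z $ i $ j))"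
  proof (intro has_derivative_vecI)
    show "((\<lambda>w. ?u w $ k $ l) has_derivative (\<lambda>w. (\<chi> k l. if k = i \<and> l = j then w else 0) $ k $ l)) (at (Z $ i $ j))" for k l
      by (cases "k = i \<and> l = j") auto
  qed
  have sc: "?d (\<chi> k l. if k = i \<and> l = j then w else 0) = d i j * w" for w
    using exhaust_2[of i] exhaust_2[of j] by (auto simp: sum_2)
  have "(f has_derivative ?d) (at (?u (Z $ i $ j)))"
    using assms by (simp only: uZ)
  from has_derivative_compose[OF u this] have "((\<lambda>w. f (?u w)) has_field_derivative d i j) (at (Z $ i $ j))"
    unfolding has_field_derivative_def sc .
  thus ?thesis
    unfolding partial_def by (rule DERIV_imp_deriv)
qed

lemma polynomial_derivative_exists:
  assumes "f \<in> polynomials"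
  shows "\<exists>d. (\<forall>i j. d i j \<in> polynomials) \<and>
    (\<forall>Z. (f has_derivative (\<lambda>H. \<Sum>i\<in>UNIV. \<Sum>j\<in>UNIV. d i j Z * H $ i $ j)) (at Z))"
  using assms
proof (induction rule: polynomials_induct)
  case (const c)
  show ?case by (intro exI[of _ "\<lambda>i j Z. 0"]) auto
next
  case (coord i j)
  have "(\<lambda>H :: HC. H $ i $ j) = (\<lambda>H. \<Sum>k\<in>UNIV. \<Sum>l\<in>UNIV. (if k = i \<and> l = j then 1 else 0) * H $ k $ l)"
    using exhaust_2[of i] exhaust_2[of j] by (auto simp: sum_2 fun_eq_iff)
  moreover have "((\<lambda>Z. Z $ i $ j) has_derivative (\<lambda>H. H $ i $ j)) (at Z)" for Z :: HC
    by (intro derivative_intros)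
  ultimately show ?case
    by (intro exI[of _ "\<lambda>k l Z. if k = i \<and> l = j then 1 else 0"]) auto
next
  case (add f g)
  then obtain d e where "\<forall>i j. d i j \<in> polynomials" "\<forall>i j. e i j \<in> polynomials"
    and de: "\<And>Z. (f has_derivative (\<lambda>H. \<Sum>i\<in>UNIV. \<Sum>j\<in>UNIV. d i j Z * H $ i $ j)) (at Z)"
      "\<And>Z. (g has_derivative (\<lambda>H. \<Sum>i\<in>UNIV. \<Sum>j\<in>UNIV. e i j Z * H $ i $ j)) (at Z)"
    by blast
  thus ?case
    by (intro exI[of _ "\<lambda>i j Z. d i j Z + e i j Z"])
       (auto intro!: derivative_eq_intros simp: sum.distrib distrib_right)
next
  case (mult f g)
  then obtain d e where "\<forall>i j. d i j \<in> polynomials" "\<forall>i j. e i j \<in> polynomials"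
    and de: "\<And>Z. (f has_derivative (\<lambda>H. \<Sum>i\<in>UNIV. \<Sum>j\<in>UNIV. d i j Z * H $ i $ j)) (at Z)"
      "\<And>Z. (g has_derivative (\<lambda>H. \<Sum>i\<in>UNIV. \<Sum>j\<in>UNIV. e i j Z * H $ i $ j)) (at Z)"
    by blast
  moreover have "((\<lambda>Z. f Z * g Z) has_derivative (\<lambda>H. \<Sum>i\<in>UNIV. \<Sum>j\<in>UNIV. (f Z * e i j Z + d i j Z * g Z) * H $ i $ j)) (at Z)" for Z
    by (rule has_derivative_eq_rhs[OF has_derivative_mult[OF de]]) (simp add: fun_eq_iff sum_2 algebra_simps)
  ultimately show ?case
    using mult.hyps by (intro exI[of _ "\<lambda>i j Z. f Z * e i j Z + d i j Z * g Z"]) auto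
qed

lemma
  assumes "f \<in> polynomials"
  shows polynomial_has_derivative:
      "(f has_derivative (\<lambda>H. \<Sum>i\<in>UNIV. \<Sum>j\<in>UNIV. partial i j f Z * H $ i $ j)) (at Z)"
    and polynomials_partial [simp]: "partial i j f \<in> polynomials"
proof -
  obtain d where d: "\<And>i j. d i j \<in> polynomials"
    "\<And>Z. (f has_derivative (\<lambda>H. \<Sum>i\<in>UNIV. \<Sum>j\<in>UNIV. d i j Z * H $ i $ j)) (at Z)"
    using polynomial_derivative_exists[OF assms] by blast
  have "partial i j f = d i j" for i j
    by (rule ext, rule partial_eqI[OF d(2)])
  with d show "(f has_derivative (\<lambda>H. \<Sum>i\<in>UNIV. \<Sum>j\<in>UNIV. partial i j f Z * H $ i $ j)) (at Z)"
    "partial i j f \<in> polynomials" by simp_all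
qed

lemma partial_const [simp]: "partial i j (\<lambda>Z. c) = (\<lambda>Z. 0)"
  by (rule ext, rule partial_eqI) simp

lemma partial_coord [simp]: "partial i j (\<lambda>Z. Z $ k $ l) = (\<lambda>Z. if i = k \<and> j = l then 1 else 0)"
proof
  fix Z :: HC
  have "(\<lambda>H :: HC. H $ k $ l) = (\<lambda>H. \<Sum>i\<in>UNIV. \<Sum>j\<in>UNIV. (if i = k \<and> j = l then 1 else 0) * H $ i $ j)"
    using exhaust_2[of k] exhaust_2[of l] by (auto simp: sum_2 fun_eq_iff)
  moreover have "((\<lambda>Z. Z $ k $ l) has_derivative (\<lambda>H. H $ k $ l)) (at Z)"
    by (intro derivative_intros)
  ultimately show "partial i j (\<lambda>Z. Z $ k $ l) Z = (if i = k \<and> j = l then 1 else 0)"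
    by (intro partial_eqI[of _ "\<lambda>i j. if i = k \<and> j = l then 1 else 0"]) simp
qed

lemma partial_add [simp]:
  assumes "f \<in> polynomials" "g \<in> polynomials"
  shows "partial i j (\<lambda>Z. f Z + g Z) = (\<lambda>Z. partial i j f Z + partial i j g Z)"
  by (rule ext, rule partial_eqI,
      rule has_derivative_eq_rhs[OF has_derivative_add[OF assms[THEN polynomial_has_derivative]]])
     (simp add: fun_eq_iff sum_2 algebra_simps)

lemma partial_mult [simp]:
  assumes "f \<in> polynomials" "g \<in> polynomials"
  shows "partial i j (\<lambda>Z. f Z * g Z) = (\<lambda>Z. f Z * partial i j g Z + partial i j f Z * g Z)"
  by (rule ext, rule partial_eqI,
      rule has_derivative_eq_rhs[OF has_derivative_mult[OF assms[THEN polynomial_has_derivative]]])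
     (simp add: fun_eq_iff sum_2 algebra_simps)

lemma partial_diff [simp]:
  assumes "f \<in> polynomials" "g \<in> polynomials"
  shows "partial i j (\<lambda>Z. f Z - g Z) = (\<lambda>Z. partial i j f Z - partial i j g Z)"
  by (rule ext, rule partial_eqI,
      rule has_derivative_eq_rhs[OF has_derivative_diff[OF assms[THEN polynomial_has_derivative]]])
     (simp add: fun_eq_iff sum_2 algebra_simps)

lemma partial_commute:
  assumes "f \<in> polynomials"
  shows "partial i j (partial k l f) = partial k l (partial i j f)"
  using assms by (induction rule: polynomials_induct) (simp_all add: algebra_simps)

lemma partial_power:
  assumes "f \<in> polynomials"
  shows "partial i j (\<lambda>Z. f Z ^ n) = (\<lambda>Z. of_nat n * f Z ^ (n - 1) * partial i j f Z)"
proof (induction n)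
  case (Suc n)
  thus ?case
    using assms by (cases n) (simp_all add: fun_eq_iff algebra_simps)
qed simp

section \<open>The Lie algebra action on polynomials\<close>

text \<open>The differential operator by which \<^const>\<open>lie_act\<close> acts on polynomials.  Unlike \<^const>\<open>lie_act\<close>
  it does not cut off outside \<^const>\<open>regular_set\<close>, so it maps polynomials to polynomials.\<close>
definition inf_act :: "gl4 \<Rightarrow> (HC \<Rightarrow> complex) \<Rightarrow> HC \<Rightarrow> complex" where
  "inf_act X \<phi> = (\<lambda>Z. mult_factor X Z * \<phi> Z - (\<Sum>i\<in>UNIV. \<Sum>j\<in>UNIV. partial i j \<phi> Z * vfield X Z $ i $ j))"

lemma lie_act_mero_polynomial:
  assumes "\<phi> \<in> polynomials"
  shows "lie_act X (mero \<phi>) = mero (inf_act X \<phi>)"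
proof -
  have "lie_act X (mero \<phi>) Z = inf_act X \<phi> Z" if "Z \<in> regular_set" for Z
    using lie_act_eq[of "mero \<phi>", OF _ that] polynomial_has_derivative[OF assms, of Z] that
    by (auto simp: has_derivative_mero inf_act_def)
  thus ?thesis
    by (auto simp: mero_def lie_act_def)
qed

lemma vfield_polynomials [simp]: "(\<lambda>Z. vfield X Z $ i $ j) \<in> polynomials"
  by (simp add: vfield_def matrix_matrix_mult_def)

lemma mult_factor_polynomials [simp]: "mult_factor X \<in> polynomials"
  unfolding mult_factor_def[abs_def] by (simp add: trace_def matrix_matrix_mult_def)

lemma inf_act_polynomials [simp]: "\<phi> \<in> polynomials \<Longrightarrow> inf_act X \<phi> \<in> polynomials"
  by (simp add: inf_act_def)

lemma inf_act_add:
  assumes "f \<in> polynomials" "g \<in> polynomials"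
  shows "inf_act X (\<lambda>Z. f Z + g Z) = (\<lambda>Z. inf_act X f Z + inf_act X g Z)"
  using assms by (simp add: inf_act_def sum_2 algebra_simps)

lemma inf_act_scale:
  assumes "f \<in> polynomials"
  shows "inf_act X (\<lambda>Z. c * f Z) = (\<lambda>Z. c * inf_act X f Z)"
  using assms by (simp add: inf_act_def sum_2 algebra_simps)

lemma inf_act_plus: "inf_act (X + Y) \<phi> = (\<lambda>Z. inf_act X \<phi> Z + inf_act Y \<phi> Z)"
  by (simp add: fun_eq_iff inf_act_def mult_factor_def vfield_def block_add trace_def sum_2
      matrix_matrix_mult_def algebra_simps)

lemma mat_mult_nth:
  fixes X :: "complex^'n^'n"
  shows "(mat c ** X) $ i $ j = c * X $ i $ j"
  by (simp add: matrix_matrix_mult_def mat_def if_distrib[of "\<lambda>x. x * _"] cong: if_cong)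

lemma inf_act_mat: "inf_act (mat c ** X) \<phi> = (\<lambda>Z. c * inf_act X \<phi> Z)"
  by (simp add: fun_eq_iff inf_act_def mult_factor_def vfield_def block_defs trace_def sum_2
      matrix_matrix_mult_def[where 'n = 2] mat_mult_nth algebra_simps)

definition vfield_deriv :: "gl4 \<Rightarrow> HC \<Rightarrow> HC \<Rightarrow> HC" where
  "vfield_deriv X Z H = block_a X ** H - H ** (block_c X ** Z + block_d X) - Z ** (block_c X ** H)"

lemma vfield_has_derivative: "(vfield X has_derivative vfield_deriv X Z) (at Z)"
  unfolding vfield_def[abs_def]
  by (rule has_derivative_eq_rhs, (rule has_derivative_diff has_derivative_add has_derivative_matrix_mult
        has_derivative_const has_derivative_ident)+)
     (simp add: vfield_deriv_def[abs_def] algebra_simps)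

lemma mult_factor_has_derivative:
  "(mult_factor X has_derivative (\<lambda>H. trace (block_c X ** H))) (at Z)"
  unfolding mult_factor_def[abs_def] trace_def
  by (rule has_derivative_eq_rhs, (rule has_derivative_sum has_derivative_vec_nth has_derivative_diff has_derivative_add has_derivative_matrix_mult
        has_derivative_const has_derivative_ident)+)
     (simp add: trace_def)

text \<open>\<open>X \<mapsto> vfield X\<close> is an antihomomorphism into vector fields under their Lie bracket, and
  \<open>mult_factor\<close> is a cocycle over it.\<close>
lemma vfield_bracket:
  "vfield (X ** Y - Y ** X) Z = vfield_deriv X Z (vfield Y Z) - vfield_deriv Y Z (vfield X Z)"
  unfolding vfield_def vfield_deriv_def block_diff block_mult
  by (simp add: matrix_add_ldistrib matrix_add_rdistrib' matrix_diff_distrib matrix_mul_assoc)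

lemma mult_factor_bracket:
  "mult_factor (X ** Y - Y ** X) Z = trace (block_c X ** vfield Y Z) - trace (block_c Y ** vfield X Z)"
  unfolding vfield_def mult_factor_def block_diff block_mult
  by (simp add: trace_def matrix_matrix_mult_def[where 'n = 2] sum_2 algebra_simps)

text \<open>In the commutator of the two operators the second order terms cancel by the symmetry of second
  derivatives; the first and zeroth order terms are the two identities above.\<close>
lemma inf_act_bracket:
  assumes "\<phi> \<in> polynomials"
  shows "inf_act (X ** Y - Y ** X) \<phi> = (\<lambda>Z. inf_act X (inf_act Y \<phi>) Z - inf_act Y (inf_act X \<phi>) Z)"
proof
  fix Z
  define S where "S = (\<lambda>(H :: HC) (K :: HC). \<Sum>i\<in>UNIV. \<Sum>j\<in>UNIV. \<Sum>k\<in>UNIV. \<Sum>l\<in>UNIV.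
      partial k l (partial i j \<phi>) Z * H $ k $ l * K $ i $ j)"
  define D where "D = (\<lambda>H :: HC. \<Sum>i\<in>UNIV. \<Sum>j\<in>UNIV. partial i j \<phi> Z * H $ i $ j)"
  have S: "S H K = S K H" for H K
    using partial_commute[OF assms] unfolding S_def by (simp add: sum_2 algebra_simps)
  have D_diff: "D (H - K) = D H - D K" for H K
    by (simp add: D_def sum_2 algebra_simps)
  have deriv: "(\<Sum>i\<in>UNIV. \<Sum>j\<in>UNIV. partial i j (inf_act Y \<phi>) Z * H $ i $ j)
      = mult_factor Y Z * D H + trace (block_c Y ** H) * \<phi> Z - (S H (vfield Y Z) + D (vfield_deriv Y Z H))" for Y H
  proof -
    have "(inf_act Y \<phi> has_derivative (\<lambda>H. mult_factor Y Z * D H + trace (block_c Y ** H) * \<phi> Z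
        - (S H (vfield Y Z) + D (vfield_deriv Y Z H)))) (at Z)"
      unfolding inf_act_def
      by (rule has_derivative_eq_rhs, (rule has_derivative_diff has_derivative_mult has_derivative_sum
            mult_factor_has_derivative has_derivative_vec_nth vfield_has_derivative
            polynomial_has_derivative polynomials_partial assms)+)
         (simp add: fun_eq_iff D_def S_def sum_2 algebra_simps)
    from has_derivative_unique[OF this polynomial_has_derivative[OF inf_act_polynomials[OF assms]]]
    show ?thesis by metis
  qed
  have inf: "inf_act X \<psi> Z = mult_factor X Z * \<psi> Z - (\<Sum>i\<in>UNIV. \<Sum>j\<in>UNIV. partial i j \<psi> Z * vfield X Z $ i $ j)" for X \<psi>
    by (simp add: inf_act_def)
  have inf': "inf_act X \<phi> Z = mult_factor X Z * \<phi> Z - D (vfield X Z)" for X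
    by (simp add: inf_act_def D_def)
  show "inf_act (X ** Y - Y ** X) \<phi> Z = inf_act X (inf_act Y \<phi>) Z - inf_act Y (inf_act X \<phi>) Z"
    unfolding inf[of X "inf_act Y \<phi>"] inf[of Y "inf_act X \<phi>"] deriv inf' vfield_bracket mult_factor_bracket D_diff
    using S[of "vfield X Z" "vfield Y Z"] by (simp add: algebra_simps)
qed

section \<open>Harmonic polynomials\<close>

lemma harmonic_polynomials_iff:
  "\<phi> \<in> harmonic_polynomials \<longleftrightarrow> \<phi> \<in> polynomials \<and> partial 1 1 (partial 2 2 \<phi>) = partial 1 2 (partial 2 1 \<phi>)"
  by (auto simp: harmonic_polynomials_def fun_eq_iff)

lemma subspace_harmonic: "cfun.subspace harmonic_polynomials"
  by (rule subspace_funI) (auto simp: harmonic_polynomials_iff)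

lemma harmonic_partial: "\<phi> \<in> harmonic_polynomials \<Longrightarrow> partial i j \<phi> \<in> harmonic_polynomials"
  unfolding harmonic_polynomials_iff by (metis partial_commute polynomials_partial)

definition euler :: "(HC \<Rightarrow> complex) \<Rightarrow> HC \<Rightarrow> complex" where
  "euler \<phi> = (\<lambda>Z. \<Sum>i\<in>UNIV. \<Sum>j\<in>UNIV. Z $ i $ j * partial i j \<phi> Z)"

lemma euler_polynomials [simp]: "\<phi> \<in> polynomials \<Longrightarrow> euler \<phi> \<in> polynomials"
  by (simp add: euler_def)

text \<open>\<open>[\<partial>\<^sub>i\<^sub>j, E] = \<partial>\<^sub>i\<^sub>j\<close>: differentiation lowers the degree by one.\<close>
lemma partial_euler:
  assumes "\<phi> \<in> polynomials"
  shows "partial i j (euler \<phi>) = (\<lambda>Z. euler (partial i j \<phi>) Z + partial i j \<phi> Z)"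
  using assms exhaust_2[of i] exhaust_2[of j] unfolding euler_def
  by (auto simp: sum_2 fun_eq_iff partial_commute[of \<phi> 2] partial_commute[of \<phi> 1 2 1 1] algebra_simps)

lemma euler_diff_scale:
  assumes "f \<in> polynomials" "g \<in> polynomials"
  shows "euler (\<lambda>Z. f Z - c * g Z) = (\<lambda>Z. euler f Z - c * euler g Z)"
  using assms by (simp add: euler_def sum_2 algebra_simps)

lemma harmonic_euler: "\<phi> \<in> harmonic_polynomials \<Longrightarrow> euler \<phi> \<in> harmonic_polynomials"
  by (simp add: harmonic_polynomials_iff partial_euler)

text \<open>Degree is measured by the order of differentiation needed to annihilate a polynomial function;
  no coefficients are involved, and degree estimates become statements about commutators.\<close>
primrec deg_less :: "nat \<Rightarrow> (HC \<Rightarrow> complex) set" where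
  "deg_less 0 = {\<lambda>Z. 0}"
| "deg_less (Suc n) = {\<phi> \<in> polynomials. \<forall>i j. partial i j \<phi> \<in> deg_less n}"

lemma deg_less_polynomials: "\<phi> \<in> deg_less n \<Longrightarrow> \<phi> \<in> polynomials"
  by (cases n) auto

lemma subspace_deg_less: "cfun.subspace (deg_less n)"
proof (induction n)
  case 0
  show ?case by (rule subspace_funI) auto
next
  case (Suc n)
  show ?case
    by (rule subspace_funI) (auto intro: subspace_fun_intros[OF Suc])
qed

lemma deg_less_Suc: "deg_less n \<subseteq> deg_less (Suc n)"
proof (induction n)
  case 0
  show ?case by auto
next
  case (Suc n)
  thus ?case by auto
qed

lemma deg_less_mono: "m \<le> n \<Longrightarrow> deg_less m \<subseteq> deg_less n"
  using deg_less_Suc lift_Suc_mono_le by blast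

lemma deg_less_mult: "f \<in> deg_less m \<Longrightarrow> g \<in> deg_less n \<Longrightarrow> (\<lambda>Z. f Z * g Z) \<in> deg_less (m + n)"
proof (induction "m + n" arbitrary: m n f g rule: less_induct)
  case less
  have zero: "(\<lambda>Z. 0) \<in> deg_less (m + n)"
    by (rule subspace_fun_0[OF subspace_deg_less])
  show ?case
  proof (cases "m = 0 \<or> n = 0")
    case True
    thus ?thesis using less.prems zero by auto
  next
    case False
    then obtain m' n' where mn: "m = Suc m'" "n = Suc n'"
      by (metis nat.exhaust)
    have poly: "f \<in> polynomials" "g \<in> polynomials"
      using less.prems deg_less_polynomials by auto
    have "(\<lambda>Z. f Z * partial i j g Z) \<in> deg_less (m + n')" for i j
      by (rule less.hyps) (use less.prems mn in auto)
    moreover have "(\<lambda>Z. partial i j f Z * g Z) \<in> deg_less (m' + n)" for i j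
      by (rule less.hyps) (use less.prems mn in auto)
    moreover have "m + n' = Suc (m' + n')" "m' + n = Suc (m' + n')"
      by (simp_all add: mn)
    ultimately have "(\<lambda>Z. f Z * partial i j g Z + partial i j f Z * g Z) \<in> deg_less (Suc (m' + n'))" for i j
      by (intro subspace_fun_add[OF subspace_deg_less]) metis+
    moreover have "m + n = Suc (Suc (m' + n'))"
      by (simp add: mn)
    ultimately show ?thesis
      using poly by (simp only: deg_less.simps(2)[of "Suc (m' + n')"]) simp
  qed
qed

lemma polynomial_deg_less: "\<phi> \<in> polynomials \<Longrightarrow> \<exists>n. \<phi> \<in> deg_less n"
proof (induction rule: polynomials_induct)
  case (const c)
  show ?case by (rule exI[of _ "Suc 0"]) simp
next
  case (coord i j)
  show ?case by (rule exI[of _ "Suc (Suc 0)"]) simp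
next
  case (add f g)
  then obtain m n where "f \<in> deg_less m" "g \<in> deg_less n" by blast
  hence "f \<in> deg_less (max m n)" "g \<in> deg_less (max m n)"
    using deg_less_mono[of m "max m n"] deg_less_mono[of n "max m n"] by auto
  thus ?case using subspace_fun_add[OF subspace_deg_less] by blast
next
  case (mult f g)
  thus ?case using deg_less_mult by blast
qed

text \<open>On the top degree part the Euler operator is multiplication by the degree.\<close>
lemma euler_minus_degree:
  "\<phi> \<in> deg_less (Suc n) \<Longrightarrow> (\<lambda>Z. euler \<phi> Z - of_nat n * \<phi> Z) \<in> deg_less n"
proof (induction n arbitrary: \<phi>)
  case 0
  thus ?case by (auto simp: euler_def)
next
  case (Suc n)
  have "(\<lambda>Z. euler (partial i j \<phi>) Z - of_nat n * partial i j \<phi> Z) \<in> deg_less n" for i j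
    by (rule Suc.IH) (use Suc.prems in auto)
  thus ?case
    using Suc.prems by (auto simp: partial_euler algebra_simps)
qed

lemma deg_less_euler:
  assumes "\<phi> \<in> deg_less n"
  shows "euler \<phi> \<in> deg_less n"
proof (cases n)
  case 0
  thus ?thesis using assms by (simp add: euler_def)
next
  case (Suc m)
  have "(\<lambda>Z. euler \<phi> Z - of_nat m * \<phi> Z) \<in> deg_less n"
    using euler_minus_degree[of \<phi> m] assms deg_less_mono[of m n] Suc by auto
  from subspace_fun_add[OF subspace_deg_less this subspace_fun_scale[OF subspace_deg_less assms, of "of_nat m"]]
  show ?thesis by simp
qed

lemma constant_if_deg_less_1:
  assumes "\<phi> \<in> deg_less (Suc 0)"
  obtains c where "\<phi> = (\<lambda>Z. c)"
proof -
  have "partial i j \<phi> = (\<lambda>Z. 0)" for i j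
    using assms by auto
  hence "(\<phi> has_derivative (\<lambda>H. 0)) (at Z)" for Z
    using polynomial_has_derivative[of \<phi>] assms by simp
  hence "\<exists>c. \<phi> = (\<lambda>Z. c)"
    using has_derivative_zero_unique[of UNIV \<phi>] by (metis UNIV_I convex_UNIV ext)
  with that show ?thesis by blast
qed

text \<open>The operator by which the root vector with entry 1 at \<open>(j, i)\<close> of the block \<open>c\<close> acts on
  polynomials; it raises the degree by one.\<close>
definition raise :: "2 \<Rightarrow> 2 \<Rightarrow> (HC \<Rightarrow> complex) \<Rightarrow> HC \<Rightarrow> complex" where
  "raise i j \<phi> = (\<lambda>Z. Z $ i $ j * \<phi> Z + (\<Sum>k\<in>UNIV. \<Sum>l\<in>UNIV. Z $ k $ j * Z $ i $ l * partial k l \<phi> Z))"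

text \<open>Expanding \<open>\<Sum> U\<^sub>i\<^sub>j \<partial>\<^sub>i\<^sub>j \<phi>\<close> gives \<open>E \<phi>\<close> plus the terms \<open>z\<^sub>k\<^sub>j z\<^sub>i\<^sub>l \<partial>\<^sub>k\<^sub>l \<partial>\<^sub>i\<^sub>j \<phi>\<close>.  Harmonicity
  says that \<open>\<partial>\<^sub>k\<^sub>l \<partial>\<^sub>i\<^sub>j \<phi> = \<partial>\<^sub>k\<^sub>j \<partial>\<^sub>i\<^sub>l \<phi>\<close>, which turns the latter into the second order part of
  \<open>E (E \<phi>)\<close>.\<close>
lemma sum_raise_partial:
  assumes "\<phi> \<in> harmonic_polynomials"
  shows "(\<Sum>i\<in>UNIV. \<Sum>j\<in>UNIV. raise i j (partial i j \<phi>) Z) = euler (euler \<phi>) Z"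
proof -
  have \<phi>: "\<phi> \<in> polynomials" and h: "partial 1 1 (partial 2 2 \<phi>) = partial 1 2 (partial 2 1 \<phi>)"
    using assms by (auto simp: harmonic_polynomials_iff)
  note c = partial_commute[OF \<phi>]
  show ?thesis
    unfolding euler_def[of "euler \<phi>"] partial_euler[OF \<phi>] unfolding euler_def raise_def
    by (simp add: sum_2 c[of 2 2 1 1] c[of 2 2 1 2] c[of 2 2 2 1] c[of 2 1 1 1] c[of 2 1 1 2] c[of 1 2 1 1] h algebra_simps)
qed

text \<open>Induction on the degree.  If \<open>\<phi>\<close> has degree at most \<open>n\<close> and lower degrees are settled, then
  \<open>E (E \<phi>) = \<Sum> U\<^sub>i\<^sub>j (\<partial>\<^sub>i\<^sub>j \<phi>)\<close> lies in \<open>W\<close>, while \<open>E (E \<phi>) - n\<^sup>2 \<phi> = (E + n) (E - n) \<phi>\<close> has degree less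
  than \<open>n\<close>.\<close>
lemma harmonic_subset_raise_invariant:
  assumes W: "cfun.subspace W" and one: "(\<lambda>Z. 1) \<in> W"
    and raise: "\<And>i j \<phi>. \<phi> \<in> harmonic_polynomials \<Longrightarrow> \<phi> \<in> W \<Longrightarrow> raise i j \<phi> \<in> W"
  shows "harmonic_polynomials \<subseteq> W"
proof -
  have "\<phi> \<in> W" if "\<phi> \<in> harmonic_polynomials" "\<phi> \<in> deg_less n" for \<phi> n
    using that
  proof (induction n arbitrary: \<phi>)
    case 0
    thus ?case using subspace_fun_0[OF W] by simp
  next
    case (Suc n)
    define \<psi> where "\<psi> = (\<lambda>Z. euler \<phi> Z - of_nat n * \<phi> Z)"
    have \<psi>: "\<psi> \<in> harmonic_polynomials" "\<psi> \<in> deg_less n"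
      unfolding \<psi>_def using Suc.prems euler_minus_degree harmonic_euler
      by (auto intro!: subspace_fun_intros[OF subspace_harmonic])
    have poly: "\<phi> \<in> polynomials" "euler \<phi> \<in> polynomials"
      using Suc.prems by (auto simp: harmonic_polynomials_iff)
    have "euler \<psi> = (\<lambda>Z. euler (euler \<phi>) Z - of_nat n * euler \<phi> Z)"
      using poly unfolding \<psi>_def by (simp add: euler_diff_scale)
    hence eq: "euler (euler \<phi>) Z - (euler \<psi> Z + of_nat n * \<psi> Z) = of_nat n * of_nat n * \<phi> Z" for Z
      by (simp add: \<psi>_def algebra_simps)
    have "(\<lambda>Z. \<Sum>i\<in>UNIV. \<Sum>j\<in>UNIV. raise i j (partial i j \<phi>) Z) \<in> W"
      using Suc by (intro subspace_fun_sum W raise Suc.IH harmonic_partial) auto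
    hence "euler (euler \<phi>) \<in> W"
      by (simp add: sum_raise_partial[OF Suc.prems(1)])
    moreover have "(\<lambda>Z. euler \<psi> Z + of_nat n * \<psi> Z) \<in> W"
      by (intro Suc.IH subspace_fun_intros[OF subspace_harmonic] subspace_fun_intros[OF subspace_deg_less]
          harmonic_euler deg_less_euler \<psi>)
    ultimately have "(\<lambda>Z. of_nat n * of_nat n * \<phi> Z) \<in> W"
      using subspace_fun_diff[OF W] unfolding eq[symmetric] by blast
    from subspace_fun_scale[OF W this, of "1 / (of_nat n * of_nat n)"]
    show ?case
    proof (cases "n = 0")
      case True
      obtain c where "\<phi> = (\<lambda>Z. c)"
        using constant_if_deg_less_1 Suc.prems(2) unfolding True .
      thus ?thesis
        using subspace_fun_scale[OF W one, of c] by simp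
    qed simp
  qed
  thus ?thesis
    using polynomial_deg_less by (meson harmonic_polynomials_iff subsetI)
qed

section \<open>Powers of linear forms of rank one\<close>

text \<open>The linear form \<open>u\<^sup>T Z v\<close>.  Its powers are harmonic because the matrix \<open>u v\<^sup>T\<close> of its
  coefficients has determinant zero.\<close>
definition lform :: "complex^2 \<Rightarrow> complex^2 \<Rightarrow> HC \<Rightarrow> complex" where
  "lform u v = (\<lambda>Z. \<Sum>i\<in>UNIV. \<Sum>j\<in>UNIV. u $ i * Z $ i $ j * v $ j)"

lemma lform_polynomials [simp]: "lform u v \<in> polynomials"
  by (simp add: lform_def)

lemma partial_lform [simp]: "partial i j (lform u v) = (\<lambda>Z. u $ i * v $ j)"
  using exhaust_2[of i] exhaust_2[of j] by (auto simp: lform_def sum_2)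

definition lpowers :: "(HC \<Rightarrow> complex) set" where
  "lpowers = cfun.span {\<lambda>Z. lform u v Z ^ n | u v n. True}"

lemma subspace_lpowers: "cfun.subspace lpowers"
  by (simp add: lpowers_def)

lemma lform_power_in_lpowers: "(\<lambda>Z. lform u v Z ^ n) \<in> lpowers"
  unfolding lpowers_def by (rule cfun.span_base) blast

lemma lpowers_subset_harmonic: "lpowers \<subseteq> harmonic_polynomials"
proof -
  have "(\<lambda>Z. lform u v Z ^ n) \<in> harmonic_polynomials" for u v n
    by (simp add: harmonic_polynomials_iff partial_power fun_eq_iff)
  thus ?thesis
    unfolding lpowers_def by (intro cfun.span_minimal subspace_harmonic) auto
qed

lemma lpowers_induct [consumes 1, case_names zero power add scale]:
  assumes "f \<in> lpowers" "P (\<lambda>Z. 0)" "\<And>u v n. P (\<lambda>Z. lform u v Z ^ n)"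
    "\<And>f g. f \<in> lpowers \<Longrightarrow> g \<in> lpowers \<Longrightarrow> P f \<Longrightarrow> P g \<Longrightarrow> P (\<lambda>Z. f Z + g Z)"
    "\<And>c f. f \<in> lpowers \<Longrightarrow> P f \<Longrightarrow> P (\<lambda>Z. c * f Z)"
  shows "P f"
proof -
  have "cfun.subspace {f \<in> lpowers. P f}"
    by (rule subspace_funI) (auto intro: assms subspace_fun_intros[OF subspace_lpowers])
  moreover have "{\<lambda>Z. lform u v Z ^ n | u v n. True} \<subseteq> {f \<in> lpowers. P f}"
    by (auto intro: assms lform_power_in_lpowers)
  ultimately have "lpowers \<subseteq> {f \<in> lpowers. P f}"
    using cfun.span_minimal unfolding lpowers_def by (metis (no_types, lifting))
  thus ?thesis
    using assms(1) by auto
qed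

text \<open>A polynomial curve in a subspace has its coefficients there.  As \<open>W\<close> need not be closed, finitely
  many values have to suffice: the degree is lowered with the help of
  \<open>p (2 y) - 2\<^sup>n\<^sup>+\<^sup>1 p y\<close>, which has no term of degree \<open>n + 1\<close> and whose other coefficients
  are those of \<open>p\<close> multiplied by nonzero constants.\<close>
lemma coeff_in_subspace:
  fixes q :: "HC \<Rightarrow> complex poly"
  assumes W: "cfun.subspace W" and val: "\<And>y. (\<lambda>Z. poly (q Z) y) \<in> W" and deg: "\<And>Z. degree (q Z) \<le> n"
  shows "(\<lambda>Z. coeff (q Z) i) \<in> W"
  using val deg
proof (induction n arbitrary: q i)
  case 0
  have "(\<lambda>Z. coeff (q Z) 0) \<in> W"
    using "0.prems"(1)[of 0] by (simp add: poly_0_coeff_0)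
  moreover have "coeff (q Z) i = 0" if "i > 0" for Z
    using "0.prems"(2)[of Z] that by (intro coeff_eq_0) simp
  ultimately show ?case
    using subspace_fun_0[OF W] by (cases "i = 0") auto
next
  case (Suc n)
  let ?c = "2 ^ Suc n :: complex"
  define r where "r = (\<lambda>Z. pcompose (q Z) [:0, 2:] - smult ?c (q Z))"
  have r_coeff: "coeff (r Z) i = (2 ^ i - ?c) * coeff (q Z) i" for Z i
    by (simp add: r_def coeff_pcompose_linear algebra_simps)
  have low: "(\<lambda>Z. coeff (q Z) i) \<in> W" if "i \<le> n" for i
  proof -
    have "(\<lambda>Z. coeff (r Z) i) \<in> W"
    proof (rule Suc.IH)
      show "(\<lambda>Z. poly (r Z) y) \<in> W" for y
        unfolding r_def by (simp only: poly_diff poly_smult poly_pcompose)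
          (intro subspace_fun_intros[OF W] Suc.prems(1))
      show "degree (r Z) \<le> n" for Z
      proof (rule degree_le, intro allI impI)
        fix k assume "n < k"
        hence "k = Suc n \<or> coeff (q Z) k = 0"
          using Suc.prems(2)[of Z] by (metis Suc_lessI coeff_eq_0 le_less_trans)
        thus "coeff (r Z) k = 0"
          by (auto simp: r_coeff)
      qed
    qed
    from subspace_fun_scale[OF W this, of "1 / (2 ^ i - ?c)"]
    have "(\<lambda>Z. 1 / (2 ^ i - ?c) * ((2 ^ i - ?c) * coeff (q Z) i)) \<in> W"
      by (simp only: r_coeff)
    moreover have "2 ^ i \<noteq> ?c"
      using that by (metis Suc_n_not_le_n of_nat_eq_iff of_nat_numeral of_nat_power one_less_numeral_iff
          power_inject_exp semiring_norm(76))
    ultimately show ?thesis by simp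
  qed
  have "(\<lambda>Z. poly (q Z) 1 - (\<Sum>i\<le>n. coeff (q Z) i)) \<in> W"
    by (intro subspace_fun_diff[OF W] subspace_fun_sum[OF W] Suc.prems(1) low) simp
  moreover have "poly (q Z) 1 = (\<Sum>i\<le>Suc n. coeff (q Z) i)" for Z
    unfolding poly_altdef using Suc.prems(2)[of Z] by (intro sum.mono_neutral_cong_left) (auto intro: coeff_eq_0)
  ultimately have top: "(\<lambda>Z. coeff (q Z) (Suc n)) \<in> W"
    by simp
  have "coeff (q Z) i = 0" if "i > Suc n" for Z
    using Suc.prems(2)[of Z] that by (intro coeff_eq_0) simp
  thus ?case
    using low[of i] top subspace_fun_0[OF W] by (cases "i \<le> n"; cases "i = Suc n") auto
qed

lemma degree_linear_power_le: "degree ([:a, b:] ^ n) \<le> n"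
  by (rule order_trans[OF degree_power_le]) simp

lemma coeff_linear_power_binomial: "coeff ([:a, b:] ^ n :: complex poly) i = of_nat (n choose i) * b ^ i * a ^ (n - i)"
proof (cases "i \<le> n")
  case True
  thus ?thesis by (rule coeff_linear_poly_power)
next
  case False
  thus ?thesis
    using degree_linear_power_le[of a b n] by (simp add: coeff_eq_0 binomial_eq_0)
qed

lemma lform_add:
  "lform (u + u') v Z = lform u v Z + lform u' v Z" "lform u (v + v') Z = lform u v Z + lform u v' Z"
  "lform (c *s u) v Z = c * lform u v Z" "lform u (c *s v) Z = c * lform u v Z"
  by (simp_all add: lform_def sum_2 algebra_simps)

text \<open>The directional derivatives of \<open>(u, v) \<mapsto> lform u v Z ^ n\<close> are coefficients of powers of
  linear forms along a line.\<close>
lemma lform_power_deriv_left: "(\<lambda>Z. of_nat n * lform u' v Z * lform u v Z ^ (n - 1)) \<in> lpowers"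
proof -
  have "(\<lambda>Z. coeff ([:lform u v Z, lform u' v Z:] ^ n) (Suc 0)) \<in> lpowers"
  proof (rule coeff_in_subspace[OF subspace_lpowers _ degree_linear_power_le])
    show "(\<lambda>Z. poly ([:lform u v Z, lform u' v Z:] ^ n) y) \<in> lpowers" for y
      using lform_power_in_lpowers[of "u + y *s u'" v n] by (simp add: lform_add)
  qed
  thus ?thesis
    by (simp add: coeff_linear_power_binomial)
qed

lemma lform_power_deriv_right: "(\<lambda>Z. of_nat n * lform u v' Z * lform u v Z ^ (n - 1)) \<in> lpowers"
proof -
  have "(\<lambda>Z. coeff ([:lform u v Z, lform u v' Z:] ^ n) (Suc 0)) \<in> lpowers"
  proof (rule coeff_in_subspace[OF subspace_lpowers _ degree_linear_power_le])
    show "(\<lambda>Z. poly ([:lform u v Z, lform u v' Z:] ^ n) y) \<in> lpowers" for y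
      using lform_power_in_lpowers[of u "v + y *s v'" n] by (simp add: lform_add)
  qed
  thus ?thesis
    by (simp add: coeff_linear_power_binomial)
qed

text \<open>Up to the factor \<open>n + 1\<close> this is the coefficient of \<open>x y\<close> in
  \<^term>\<open>lform (u + x *s u') (v + y *s v') Z ^ Suc n\<close>.\<close>
lemma lform_power_deriv_both:
  "(\<lambda>Z. lform u' v' Z * lform u v Z ^ n + of_nat n * lform u' v Z * lform u v' Z * lform u v Z ^ (n - 1)) \<in> lpowers"
proof -
  let ?q = "\<lambda>Z. [:lform u' v Z, lform u' v' Z:] * [:lform u v Z, lform u v' Z:] ^ n"
  have "(\<lambda>Z. coeff (?q Z) (Suc 0)) \<in> lpowers"
  proof (rule coeff_in_subspace[OF subspace_lpowers])
    show "(\<lambda>Z. poly (?q Z) y) \<in> lpowers" for y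
    proof -
      have "(\<lambda>Z. poly (?q Z) y) = (\<lambda>Z. (1 / of_nat (Suc n)) *
          (of_nat (Suc n) * lform u' (v + y *s v') Z * lform u (v + y *s v') Z ^ (Suc n - 1)))"
        by (simp add: lform_add fun_eq_iff algebra_simps del: of_nat_Suc)
      thus ?thesis
        by (simp only: subspace_fun_scale[OF subspace_lpowers lform_power_deriv_left])
    qed
    show "degree (?q Z) \<le> Suc n" for Z
    proof -
      have "degree [:lform u' v Z, lform u' v' Z:] + degree ([:lform u v Z, lform u v' Z:] ^ n) \<le> 1 + n"
        by (intro add_mono degree_linear_power_le) simp
      thus ?thesis
        using degree_mult_le[of "[:lform u' v Z, lform u' v' Z:]" "[:lform u v Z, lform u v' Z:] ^ n"] by simp
    qed
  qed
  moreover have "coeff (?q Z) (Suc 0) = lform u' v' Z * lform u v Z ^ n + of_nat n * lform u' v Z * lform u v' Z * lform u v Z ^ (n - 1)" for Z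
    by (simp add: coeff_linear_power_binomial algebra_simps)
  ultimately show ?thesis
    by simp
qed

lemma lform_axis:
  "lform (axis i 1) (axis j 1) Z = Z $ i $ j"
  "lform (axis i 1) v Z = (\<Sum>j\<in>UNIV. Z $ i $ j * v $ j)"
  "lform u (axis j 1) Z = (\<Sum>i\<in>UNIV. u $ i * Z $ i $ j)"
  using exhaust_2[of i] exhaust_2[of j] by (auto simp: lform_def axis_def sum_2)

lemma axis_nth: "axis i x $ j = (if j = i then x else 0)"
  by (simp add: axis_def)

lemma raise_lform_power:
  "raise i j (\<lambda>Z. lform u v Z ^ n) \<in> lpowers"
proof -
  have "raise i j (\<lambda>Z. lform u v Z ^ n) = (\<lambda>Z. lform (axis i 1) (axis j 1) Z * lform u v Z ^ n
      + of_nat n * lform (axis i 1) v Z * lform u (axis j 1) Z * lform u v Z ^ (n - 1))"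
    using exhaust_2[of i] exhaust_2[of j]
    by (auto simp: raise_def partial_power lform_axis axis_nth sum_2 fun_eq_iff algebra_simps)
  thus ?thesis
    by (simp only: lform_power_deriv_both)
qed

lemma raise_add:
  assumes "f \<in> polynomials" "g \<in> polynomials"
  shows "raise i j (\<lambda>Z. f Z + g Z) = (\<lambda>Z. raise i j f Z + raise i j g Z)"
  using assms by (simp add: raise_def sum_2 algebra_simps)

lemma raise_scale:
  assumes "f \<in> polynomials"
  shows "raise i j (\<lambda>Z. c * f Z) = (\<lambda>Z. c * raise i j f Z)"
  using assms by (simp add: raise_def sum_2 algebra_simps)

lemma lpowers_polynomials: "f \<in> lpowers \<Longrightarrow> f \<in> polynomials"
  using lpowers_subset_harmonic by (auto simp: harmonic_polynomials_iff)

lemma raise_lpowers: "f \<in> lpowers \<Longrightarrow> raise i j f \<in> lpowers"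
proof (induction rule: lpowers_induct)
  case zero
  show ?case
    using subspace_fun_0[OF subspace_lpowers] by (simp add: raise_def)
qed (auto simp: raise_lform_power raise_add raise_scale lpowers_polynomials intro: subspace_fun_intros[OF subspace_lpowers])

text \<open>The span of the powers contains 1 and is invariant under all \<^term>\<open>raise i j\<close>, hence exhausts the
  harmonic polynomials.\<close>
lemma harmonic_polynomials_eq_lpowers: "harmonic_polynomials = lpowers"
proof (rule antisym[OF _ lpowers_subset_harmonic])
  show "harmonic_polynomials \<subseteq> lpowers"
    using lform_power_in_lpowers[of 0 0 0]
    by (intro harmonic_subset_raise_invariant subspace_lpowers raise_lpowers) simp_all
qed

section \<open>The representation on harmonic polynomials\<close>

lemma lform_apply: "lform u v Z = (\<Sum>i\<in>UNIV. \<Sum>j\<in>UNIV. u $ i * Z $ i $ j * v $ j)"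
  by (simp add: lform_def)

lemma lform_vector_matrix: "lform (u v* A) v Z = (\<Sum>i\<in>UNIV. \<Sum>j\<in>UNIV. u $ i * (A ** Z) $ i $ j * v $ j)"
  and lform_matrix_vector: "lform u (D *v v) Z = (\<Sum>i\<in>UNIV. \<Sum>j\<in>UNIV. u $ i * (Z ** D) $ i $ j * v $ j)"
  by (simp_all add: lform_def sum_2 matrix_matrix_mult_def matrix_vector_mult_def vector_matrix_mult_def algebra_simps)

text \<open>The block \<open>c\<close> contributes a combination of \<^term>\<open>raise i j\<close>, the block \<open>b\<close> a multiple
  of a lower power, and the blocks \<open>a\<close> and \<open>d\<close> move \<open>u\<close> and \<open>v\<close> infinitesimally.\<close>
lemma inf_act_lform_power: "inf_act X (\<lambda>Z. lform u v Z ^ n) \<in> lpowers"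
proof -
  let ?A = "block_a X" and ?B = "block_b X" and ?C = "block_c X" and ?D = "block_d X"
  have eq: "inf_act X (\<lambda>Z. lform u v Z ^ n) = (\<lambda>Z.
      (\<Sum>i\<in>UNIV. \<Sum>j\<in>UNIV. ?C $ j $ i * raise i j (\<lambda>Z. lform u v Z ^ n) Z)
      + trace ?D * lform u v Z ^ n - lform u v ?B * of_nat n * lform u v Z ^ (n - 1)
      - of_nat n * lform (u v* ?A) v Z * lform u v Z ^ (n - 1)
      + of_nat n * lform u (?D *v v) Z * lform u v Z ^ (n - 1))"
    by (rule ext) (simp add: inf_act_def raise_def partial_power mult_factor_def vfield_def trace_def
        sum_2 matrix_matrix_mult_def lform_vector_matrix lform_matrix_vector lform_apply[of u v ?B] algebra_simps)
  have "(\<lambda>Z. lform u v ?B * of_nat n * lform u v Z ^ (n - 1)) \<in> lpowers"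
    by (rule subspace_fun_scale[OF subspace_lpowers lform_power_in_lpowers])
  thus ?thesis
    unfolding eq
    by (intro subspace_fun_intros[OF subspace_lpowers] subspace_fun_sum[OF subspace_lpowers]
        raise_lform_power lform_power_in_lpowers lform_power_deriv_left lform_power_deriv_right)
qed

lemma inf_act_harmonic: "f \<in> harmonic_polynomials \<Longrightarrow> inf_act X f \<in> harmonic_polynomials"
  unfolding harmonic_polynomials_eq_lpowers
proof (induction rule: lpowers_induct)
  case zero
  show ?case
    using subspace_fun_0[OF subspace_lpowers] by (simp add: inf_act_def)
qed (auto simp: inf_act_lform_power inf_act_add inf_act_scale lpowers_polynomials intro: subspace_fun_intros[OF subspace_lpowers])

section \<open>Polynomials are determined by their restriction to the real form\<close>

lemma polynomial_on_line:
  assumes "f \<in> polynomials"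
  shows "\<exists>p. \<forall>x. f (\<chi> i j. A $ i $ j + x * B $ i $ j) = poly p x"
  using assms
proof (induction rule: polynomials_induct)
  case (const c)
  show ?case by (intro exI[of _ "[:c:]"]) simp
next
  case (coord i j)
  show ?case by (intro exI[of _ "[:A $ i $ j, B $ i $ j:]"]) simp
next
  case (add f g)
  then obtain p q where "\<forall>x. f (\<chi> i j. A $ i $ j + x * B $ i $ j) = poly p x"
    "\<forall>x. g (\<chi> i j. A $ i $ j + x * B $ i $ j) = poly q x" by blast
  thus ?case by (intro exI[of _ "p + q"]) simp
next
  case (mult f g)
  then obtain p q where "\<forall>x. f (\<chi> i j. A $ i $ j + x * B $ i $ j) = poly p x"
    "\<forall>x. g (\<chi> i j. A $ i $ j + x * B $ i $ j) = poly q x" by blast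
  thus ?case by (intro exI[of _ "p * q"]) simp
qed

lemma polynomial_zero_on_line:
  assumes "f \<in> polynomials" "infinite S" "\<And>x. x \<in> S \<Longrightarrow> f (\<chi> i j. A $ i $ j + x * B $ i $ j) = 0"
  shows "f (\<chi> i j. A $ i $ j + x * B $ i $ j) = 0"
proof -
  obtain p where p: "\<And>x. f (\<chi> i j. A $ i $ j + x * B $ i $ j) = poly p x"
    using polynomial_on_line[OF assms(1)] by blast
  have "S \<subseteq> {x. poly p x = 0}"
    using assms(3) p by auto
  hence "p = 0"
    using assms(2) poly_roots_finite finite_subset by blast
  thus ?thesis by (simp add: p)
qed

text \<open>The real form \<open>z\<^sub>2\<^sub>2 = cnj z\<^sub>1\<^sub>1\<close>, \<open>z\<^sub>2\<^sub>1 = cnj z\<^sub>1\<^sub>2\<close> consists of the points with real parameters.\<close>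
definition real_coords :: "complex \<Rightarrow> complex \<Rightarrow> complex \<Rightarrow> complex \<Rightarrow> HC" where
  "real_coords x y u v = (\<chi> i j. if i = 1 then (if j = 1 then x + \<i> * y else u + \<i> * v)
     else (if j = 1 then u - \<i> * v else x - \<i> * y))"

text \<open>The real form contains a product of four intervals, on which the polynomial vanishes.  Freeing
  one parameter after the other to become complex, one reaches every matrix.\<close>
lemma polynomial_zero_on_real_cone:
  assumes f: "f \<in> polynomials" and zero: "\<And>Z. Z \<in> real_cone \<Longrightarrow> f Z = 0"
  shows "f Z = 0"
proof -
  \<comment> \<open>The determinant is \<open>x\<^sup>2 + y\<^sup>2 - u\<^sup>2 - v\<^sup>2\<close>, which exceeds \<open>4 - 2\<close> on the following box.\<close>
  let ?S = "complex_of_real ` {2<..<3}" and ?T = "complex_of_real ` {0<..<1}"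
  have inf: "infinite ?S" "infinite ?T"
    by (auto simp: finite_image_iff inj_on_def)
  have line: "real_coords x y u v = (\<chi> i j. real_coords 0 y u v $ i $ j + x * real_coords 1 0 0 0 $ i $ j)"
    "real_coords x y u v = (\<chi> i j. real_coords x 0 u v $ i $ j + y * real_coords 0 1 0 0 $ i $ j)"
    "real_coords x y u v = (\<chi> i j. real_coords x y 0 v $ i $ j + u * real_coords 0 0 1 0 $ i $ j)"
    "real_coords x y u v = (\<chi> i j. real_coords x y u 0 $ i $ j + v * real_coords 0 0 0 1 $ i $ j)" for x y u v
    by (simp_all add: real_coords_def vec_eq_iff forall_2)
  note ext = polynomial_zero_on_line[OF f]
  have 0: "f (real_coords x y u v) = 0" if "x \<in> ?S" "y \<in> ?T" "u \<in> ?T" "v \<in> ?T" for x y u v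
  proof (rule zero)
    from that obtain a b c d where eq: "x = of_real a" "y = of_real b" "u = of_real c" "v = of_real d"
      and bd: "2 < a" "0 < b" "0 < c" "c < 1" "0 < d" "d < 1"
      by auto
    have "c * c < 1 * 1" "d * d < 1 * 1" "2 * 2 < a * a" "0 < b * b"
      using bd by (intro mult_strict_mono mult_pos_pos; simp)+
    thus "real_coords x y u v \<in> real_cone"
      by (simp add: real_cone_def real_coords_def eq det_2 complex_eq_iff algebra_simps)
  qed
  have 1: "f (real_coords x y u v) = 0" if "y \<in> ?T" "u \<in> ?T" "v \<in> ?T" for x y u v
    by (subst line(1), rule ext[OF inf(1)], subst line(1)[symmetric], rule 0[OF _ that])
  have 2: "f (real_coords x y u v) = 0" if "u \<in> ?T" "v \<in> ?T" for x y u v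
    by (subst line(2), rule ext[OF inf(2)], subst line(2)[symmetric], rule 1[OF _ that])
  have 3: "f (real_coords x y u v) = 0" if "v \<in> ?T" for x y u v
    by (subst line(3), rule ext[OF inf(2)], subst line(3)[symmetric], rule 2[OF _ that])
  have 4: "f (real_coords x y u v) = 0" for x y u v
    by (subst line(4), rule ext[OF inf(2)], subst line(4)[symmetric], rule 3)
  have "Z = real_coords ((Z $ 1 $ 1 + Z $ 2 $ 2) / 2) ((Z $ 1 $ 1 - Z $ 2 $ 2) / (2 * \<i>))
      ((Z $ 1 $ 2 + Z $ 2 $ 1) / 2) ((Z $ 1 $ 2 - Z $ 2 $ 1) / (2 * \<i>))"
    by (simp add: real_coords_def vec_eq_iff forall_2 field_simps)
  thus ?thesis
    using 4 by metis
qed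

lemma real_cone_subset_regular: "real_cone \<subseteq> regular_set"
proof
  fix Z assume Z: "Z \<in> real_cone"
  hence det: "Re (Z $ 1 $ 1 * cnj (Z $ 1 $ 1) - Z $ 1 $ 2 * cnj (Z $ 1 $ 2)) > 0"
    by (auto simp: real_cone_def det_2)
  have "Z $ 1 $ 1 \<noteq> 0"
    using det sum_squares_ge_zero[of "Re (Z $ 1 $ 2)" "Im (Z $ 1 $ 2)"] by (auto simp: not_less[symmetric])
  thus "Z \<in> regular_set"
    using Z by (auto simp: regular_set_def real_cone_def N_def)
qed

lemma mero_polynomial_inject:
  assumes "f \<in> polynomials" "g \<in> polynomials" "mero f = mero g"
  shows "f = g"
proof
  fix Z
  have "f Z - g Z = 0"
  proof (rule polynomial_zero_on_real_cone[of "\<lambda>Z. f Z - g Z"])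
    show "f W - g W = 0" if "W \<in> real_cone" for W
      using that real_cone_subset_regular fun_cong[OF assms(3), of W] by auto
  qed (use assms in auto)
  thus "f Z = g Z" by simp
qed

section \<open>Irreducibility of the harmonic polynomials\<close>

lemma mero_add: "mero (\<lambda>Z. f Z + g Z) = mero f + mero g"
  and mero_diff: "mero (\<lambda>Z. f Z - g Z) = mero f - mero g"
  and mero_scale: "mero (\<lambda>Z. c * f Z) = cscale c (mero f)"
  and mero_zero: "mero (\<lambda>Z. 0) = 0"
  by (auto simp: mero_def fun_eq_iff cscale_def)

lemma subspace_mero_image:
  assumes "cfun.subspace W"
  shows "cfun.subspace (mero ` W)"
  unfolding cfun.subspace_def
proof (intro conjI ballI allI)
  show "0 \<in> mero ` W"
    using subspace_fun_0[OF assms] mero_zero by (metis imageI)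
  show "f + g \<in> mero ` W" if fg: "f \<in> mero ` W" "g \<in> mero ` W" for f g
    using fg subspace_fun_add[OF assms] by (auto simp flip: mero_add)
  show "cscale c f \<in> mero ` W" if f: "f \<in> mero ` W" for c f
    using f subspace_fun_scale[OF assms] by (auto simp flip: mero_scale)
qed

lemma subspace_mero_vimage:
  assumes "cfun.subspace W"
  shows "cfun.subspace {f \<in> polynomials. mero f \<in> W}"
  using assms by (intro subspace_funI)
    (auto simp: mero_add mero_scale mero_zero cfun.subspace_0 cfun.subspace_add cfun.subspace_scale
      intro: subspace_fun_scale[OF subspace_polynomials])

lemma harmonic_poly: "f \<in> harmonic_polynomials \<Longrightarrow> f \<in> polynomials"
  by (simp add: harmonic_polynomials_iff)

lemma lie_act_mero_harmonic:
  "f \<in> harmonic_polynomials \<Longrightarrow> lie_act X (mero f) = mero (inf_act X f)"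
  by (rule lie_act_mero_polynomial[OF harmonic_poly])

lemma sl4_rep_H_plus: "sl4_rep lie_act H_plus"
  unfolding sl4_rep_def H_plus_def
proof (intro conjI ballI allI)
  show "cfun.subspace (mero ` harmonic_polynomials)"
    by (intro subspace_mero_image subspace_harmonic)
  fix X
  show "linear_between (mero ` harmonic_polynomials) (lie_act X) (mero ` harmonic_polynomials)"
    unfolding linear_between_def
  proof (intro conjI ballI allI subsetI)
    show "f \<in> mero ` harmonic_polynomials" if "f \<in> lie_act X ` mero ` harmonic_polynomials" for f
      using that by (auto simp: lie_act_mero_harmonic inf_act_harmonic)
    show "lie_act X (f + g) = lie_act X f + lie_act X g"
      if fg: "f \<in> mero ` harmonic_polynomials" "g \<in> mero ` harmonic_polynomials" for f g
      using fg by (auto simp: lie_act_mero_polynomial harmonic_poly inf_act_add mero_add simp flip: mero_add)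
    show "lie_act X (cscale c f) = cscale c (lie_act X f)" if f: "f \<in> mero ` harmonic_polynomials" for c f
      using f by (auto simp: lie_act_mero_polynomial harmonic_poly inf_act_scale mero_scale
          subspace_fun_scale[OF subspace_polynomials] simp flip: mero_scale)
  qed
  fix f assume "f \<in> mero ` harmonic_polynomials"
  then obtain \<phi> where \<phi>: "f = mero \<phi>" "\<phi> \<in> harmonic_polynomials" by auto
  show "lie_act (X + Y) f = lie_act X f + lie_act Y f" for Y
    by (simp add: \<phi> lie_act_mero_harmonic inf_act_plus mero_add)
  show "lie_act (mat c ** X) f = cscale c (lie_act X f)" for c
    by (simp add: \<phi> lie_act_mero_harmonic inf_act_mat mero_scale)
  show "lie_act (X ** Y - Y ** X) f = lie_act X (lie_act Y f) - lie_act Y (lie_act X f)" for Y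
    by (simp add: \<phi> lie_act_mero_harmonic inf_act_harmonic inf_act_bracket harmonic_poly mero_diff)
qed

lemma root_vector_sl4: "i \<noteq> j \<Longrightarrow> root_vector i j \<in> sl4"
  by (auto simp: sl4_def root_vector_def trace_def intro!: sum.neutral)

lemma inf_act_root_b:
  "inf_act (root_vector (Inl i) (Inr j)) \<phi> = (\<lambda>Z. - partial i j \<phi> Z)"
  using exhaust_2[of i] exhaust_2[of j]
  by (auto simp: fun_eq_iff inf_act_def root_vector_def mult_factor_def vfield_def block_defs trace_def sum_2
      matrix_matrix_mult_def)

lemma inf_act_root_c:
  "inf_act (root_vector (Inr j) (Inl i)) \<phi> = raise i j \<phi>"
  using exhaust_2[of i] exhaust_2[of j]
  by (auto simp: fun_eq_iff inf_act_def root_vector_def mult_factor_def vfield_def block_defs trace_def sum_2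
      matrix_matrix_mult_def raise_def algebra_simps)

text \<open>Differentiating a nonzero element of an invariant subspace often enough leads to a nonzero
  constant, and the constant 1 generates everything.\<close>
lemma sl4_irreducible_H_plus: "sl4_irreducible lie_act H_plus"
  unfolding sl4_irreducible_def
proof (intro conjI allI impI)
  show "sl4_rep lie_act H_plus" by (rule sl4_rep_H_plus)
  have one: "(\<lambda>Z. 1) \<in> harmonic_polynomials"
    by (simp add: harmonic_polynomials_iff)
  have zero: "f = (\<lambda>Z. 0)" if "mero f = 0" "f \<in> polynomials" for f
    using mero_polynomial_inject[of f "\<lambda>Z. 0"] that by (simp add: mero_zero)
  show "H_plus \<noteq> {0}"
  proof
    assume "H_plus = {0}"
    hence "mero (\<lambda>Z. 1) = 0"
      using one by (auto simp: H_plus_def)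
    from zero[OF this] show False
      by (simp add: fun_eq_iff)
  qed
  fix W assume W: "cfun.subspace W \<and> W \<subseteq> H_plus \<and> (\<forall>X\<in>sl4. lie_act X ` W \<subseteq> W)"
  define V where "V = {f \<in> polynomials. mero f \<in> W}"
  have V: "cfun.subspace V"
    unfolding V_def using W by (intro subspace_mero_vimage) blast
  have V_act: "inf_act X f \<in> V" if "f \<in> V" "X \<in> sl4" for X f
    using that W lie_act_mero_polynomial[of f X] unfolding V_def
    by (metis (mono_tags, lifting) image_subset_iff inf_act_polynomials mem_Collect_eq)
  show "W = {0} \<or> W = H_plus"
  proof (rule disjCI)
    assume "W \<noteq> H_plus"
    have "\<not> harmonic_polynomials \<subseteq> V"
      using \<open>W \<noteq> H_plus\<close> W by (auto simp: V_def H_plus_def)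
    hence one_V: "(\<lambda>Z. 1) \<notin> V"
      using harmonic_subset_raise_invariant[OF V] V_act[OF _ root_vector_sl4]
      by (auto simp flip: inf_act_root_c)
    have "f = (\<lambda>Z. 0)" if "f \<in> V" "f \<in> deg_less n" for f n
      using that
    proof (induction n arbitrary: f)
      case 0
      thus ?case by simp
    next
      case (Suc n)
      have poly: "f \<in> polynomials"
        using Suc.prems by simp
      have "partial i j f \<in> V" for i j
        using subspace_fun_scale[OF V V_act[OF Suc.prems(1) root_vector_sl4[of "Inl i" "Inr j"]], of "- 1"]
        by (simp add: inf_act_root_b)
      hence "partial i j f = (\<lambda>Z. 0)" for i j
        using Suc by simp
      hence "f \<in> deg_less (Suc 0)"
        using poly by simp
      then obtain c where c: "f = (\<lambda>Z. c)"
        by (rule constant_if_deg_less_1)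
      have "c = 0"
      proof (rule ccontr)
        assume "c \<noteq> 0"
        thus False
          using subspace_fun_scale[OF V Suc.prems(1), of "1 / c"] one_V by (simp add: c)
      qed
      thus ?case by (simp add: c)
    qed
    hence V_zero: "f = (\<lambda>Z. 0)" if "f \<in> V" for f
      using polynomial_deg_less that unfolding V_def by blast
    have "mero f = 0" if "f \<in> V" for f
      using V_zero[OF that] by (simp add: mero_zero)
    moreover have "W \<subseteq> mero ` V"
      using W by (force simp: V_def H_plus_def harmonic_polynomials_iff)
    ultimately show "W = {0}"
      using W cfun.subspace_0[of W] by blast
  qed
qed

section \<open>Transport of representations\<close>

lemma sl4_add: "X \<in> sl4 \<Longrightarrow> Y \<in> sl4 \<Longrightarrow> X + Y \<in> sl4"
  and sl4_scale: "X \<in> sl4 \<Longrightarrow> mat c ** X \<in> sl4"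
  and sl4_bracket: "X ** Y - Y ** X \<in> sl4"
  by (simp_all add: sl4_def trace_add trace_sub trace_mul_sym[of X Y])
     (simp add: trace_def mat_mult_nth flip: sum_distrib_left)

lemma sl4_conj:
  assumes "invertible g" "X \<in> sl4"
  shows "matrix_inv g ** X ** g \<in> sl4"
  using assms trace_mul_sym[of "matrix_inv g ** X" g]
  by (simp add: sl4_def matrix_mul_assoc matrix_inv_mult)

lemma linear_between_subspace_image:
  assumes T: "linear_between V T V'" and W: "cfun.subspace W" "W \<subseteq> V"
  shows "cfun.subspace (T ` W)"
  unfolding cfun.subspace_def
proof (intro conjI ballI allI)
  have add: "T (f + g) = T f + T g" and sc: "T (cscale c f) = cscale c (T f)" if "f \<in> W" "g \<in> W" for f g c
    using T W(2) that unfolding linear_between_def by blast+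
  have "T (cscale 0 0) = cscale 0 (T 0)"
    by (rule sc[of 0 0]) (use cfun.subspace_0[OF W(1)] in auto)
  hence "T 0 = 0" by simp
  thus "0 \<in> T ` W"
    using cfun.subspace_0[OF W(1)] by (metis imageI)
  show "f + g \<in> T ` W" if "f \<in> T ` W" "g \<in> T ` W" for f g
    using that cfun.subspace_add[OF W(1)] by (auto simp flip: add)
  show "cscale c f \<in> T ` W" if "f \<in> T ` W" for f c
    using that cfun.subspace_scale[OF W(1)] by (auto simp flip: sc)
qed

text \<open>A linear map that intertwines the operators turns its image into a representation; for an
  injective map irreducibility is transported as well.\<close>
lemma sl4_rep_transport:
  assumes V: "sl4_rep \<sigma> V" and T: "linear_between V T V'"
    and eq: "\<And>X f. X \<in> sl4 \<Longrightarrow> f \<in> V \<Longrightarrow> \<rho> X (T f) = T (\<sigma> X f)"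
  shows "sl4_rep \<rho> (T ` V)"
proof -
  have sub: "cfun.subspace V"
    and lin: "\<And>X. X \<in> sl4 \<Longrightarrow> linear_between V (\<sigma> X) V"
    and add: "\<And>X Y f. X \<in> sl4 \<Longrightarrow> Y \<in> sl4 \<Longrightarrow> f \<in> V \<Longrightarrow> \<sigma> (X + Y) f = \<sigma> X f + \<sigma> Y f"
    and sc: "\<And>X c f. X \<in> sl4 \<Longrightarrow> f \<in> V \<Longrightarrow> \<sigma> (mat c ** X) f = cscale c (\<sigma> X f)"
    and br: "\<And>X Y f. X \<in> sl4 \<Longrightarrow> Y \<in> sl4 \<Longrightarrow> f \<in> V \<Longrightarrow> \<sigma> (X ** Y - Y ** X) f = \<sigma> X (\<sigma> Y f) - \<sigma> Y (\<sigma> X f)"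
    using V by (auto simp: sl4_rep_def)
  have mem: "\<sigma> X f \<in> V" if "X \<in> sl4" "f \<in> V" for X f
    using lin[OF that(1)] that(2) by (auto simp: linear_between_def)
  have \<sigma>_add: "\<sigma> X (f + g) = \<sigma> X f + \<sigma> X g" and \<sigma>_sc: "\<sigma> X (cscale c f) = cscale c (\<sigma> X f)"
    if "X \<in> sl4" "f \<in> V" "g \<in> V" for X f g c
    using lin[OF that(1)] that(2,3) by (auto simp: linear_between_def)
  have T_add: "T (f + g) = T f + T g" and T_sc: "T (cscale c f) = cscale c (T f)"
    if "f \<in> V" "g \<in> V" for f g c
    using T that by (auto simp: linear_between_def)
  have T_diff: "T (f - g) = T f - T g" if "f \<in> V" "g \<in> V" for f g
    using T_add[of "f - g" g] that cfun.subspace_diff[OF sub] by (simp add: algebra_simps)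
  note V_closed = cfun.subspace_add[OF sub] cfun.subspace_scale[OF sub] mem
  have "linear_between (T ` V) (\<rho> X) (T ` V)" if X: "X \<in> sl4" for X
  proof -
    have "\<rho> X (T f + T g) = \<rho> X (T f) + \<rho> X (T g)" if "f \<in> V" "g \<in> V" for f g
      using that eq[OF X, of "f + g"] by (simp add: T_add \<sigma>_add[OF X] V_closed X eq[OF X])
    moreover have "\<rho> X (cscale c (T f)) = cscale c (\<rho> X (T f))" if "f \<in> V" for c f
      using that eq[OF X, of "cscale c f"] by (simp add: T_sc[OF that that] \<sigma>_sc[OF X that that] T_sc V_closed X eq[OF X])
    ultimately show ?thesis
      using X by (auto simp: linear_between_def eq mem)
  qed
  moreover have "\<rho> (X + Y) f = \<rho> X f + \<rho> Y f" if "X \<in> sl4" "Y \<in> sl4" "f \<in> T ` V" for X Y f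
    using that by (auto simp: eq add sl4_add mem T_add)
  moreover have "\<rho> (mat c ** X) f = cscale c (\<rho> X f)" if "X \<in> sl4" "f \<in> T ` V" for X c f
    using that by (auto simp: eq sc sl4_scale mem T_sc)
  moreover have "\<rho> (X ** Y - Y ** X) f = \<rho> X (\<rho> Y f) - \<rho> Y (\<rho> X f)"
    if "X \<in> sl4" "Y \<in> sl4" "f \<in> T ` V" for X Y f
    using that by (auto simp: eq br sl4_bracket mem T_diff)
  ultimately show ?thesis
    using linear_between_subspace_image[OF T sub] by (auto simp: sl4_rep_def)
qed

lemma sl4_irreducible_transport:
  assumes V: "sl4_irreducible \<sigma> V" and T: "linear_between V T V'" and inj: "inj_on T V"
    and eq: "\<And>X f. X \<in> sl4 \<Longrightarrow> f \<in> V \<Longrightarrow> \<rho> X (T f) = T (\<sigma> X f)"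
  shows "sl4_irreducible \<rho> (T ` V)"
  unfolding sl4_irreducible_def
proof (intro conjI allI impI)
  have rep: "sl4_rep \<sigma> V" and nz: "V \<noteq> {0}"
    and irr: "\<And>W. cfun.subspace W \<Longrightarrow> W \<subseteq> V \<Longrightarrow> (\<And>X f. X \<in> sl4 \<Longrightarrow> f \<in> W \<Longrightarrow> \<sigma> X f \<in> W) \<Longrightarrow> W = {0} \<or> W = V"
    using V by (auto simp: sl4_irreducible_def image_subset_iff)
  show "sl4_rep \<rho> (T ` V)"
    by (rule sl4_rep_transport[OF rep T eq])
  have sub: "cfun.subspace V"
    using rep by (simp add: sl4_rep_def)
  have zero: "0 \<in> V"
    by (rule cfun.subspace_0[OF sub])
  have T_add: "T (f + g) = T f + T g" and T_sc: "T (cscale c f) = cscale c (T f)"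
    if "f \<in> V" "g \<in> V" for f g c
    using T that by (auto simp: linear_between_def)
  have T0: "T 0 = 0"
    using T_sc[OF zero zero, of 0] by simp
  show "T ` V \<noteq> {0}"
    using nz zero T0 inj by (metis inj_on_image_eq_iff image_insert image_empty empty_subsetI insert_subset order_refl)
  fix W' assume W': "cfun.subspace W' \<and> W' \<subseteq> T ` V \<and> (\<forall>X\<in>sl4. \<rho> X ` W' \<subseteq> W')"
  define W where "W = {f \<in> V. T f \<in> W'}"
  have img: "T ` W = W'"
    using W' by (auto simp: W_def)
  have "W = {0} \<or> W = V"
  proof (rule irr)
    show "cfun.subspace W"
      using W' unfolding cfun.subspace_def W_def
      using T0 zero cfun.subspace_add[OF sub] cfun.subspace_scale[OF sub] by (auto simp: T_add T_sc)
    show "\<sigma> X f \<in> W" if "X \<in> sl4" "f \<in> W" for X f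
    proof -
      have "\<sigma> X f \<in> V"
        using rep that unfolding sl4_rep_def linear_between_def W_def by blast
      moreover have "T (\<sigma> X f) \<in> W'"
        using W' that eq[of X f] unfolding W_def by (metis (mono_tags, lifting) image_subset_iff mem_Collect_eq)
      ultimately show ?thesis by (simp add: W_def)
    qed
  qed (auto simp: W_def)
  thus "W' = {0} \<or> W' = T ` V"
    using img T0 by auto
qed

lemma twist_add: "matrix_inv g ** (X + Y) ** g = matrix_inv g ** X ** g + matrix_inv g ** Y ** (g :: gl4)"
  by (simp add: matrix_add_ldistrib matrix_add_rdistrib')

lemma twist_scale: "matrix_inv g ** (mat c ** X) ** g = mat c ** (matrix_inv g ** X ** (g :: gl4))"
proof -
  have "matrix_inv g ** mat c = mat c ** matrix_inv g"
    by (simp add: vec_eq_iff mat_mult_nth)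
       (simp add: matrix_matrix_mult_def mat_def if_distrib cong: if_cong)
  thus ?thesis by (simp add: matrix_mul_assoc)
qed

lemma twist_mult:
  assumes "invertible g"
  shows "matrix_inv g ** (X ** Y) ** g = (matrix_inv g ** X ** g) ** (matrix_inv g ** Y ** (g :: gl4))"
proof -
  have "(matrix_inv g ** X ** g) ** (matrix_inv g ** Y ** g) = matrix_inv g ** X ** (g ** matrix_inv g) ** Y ** g"
    by (simp only: matrix_mul_assoc)
  thus ?thesis
    by (simp add: matrix_inv_mult assms matrix_mul_assoc)
qed

lemma sl4_rep_twist:
  assumes "sl4_rep \<rho> V" "invertible g"
  shows "sl4_rep (twist g \<rho>) V"
  using assms(1) unfolding sl4_rep_def twist_def
  by (auto simp: sl4_conj assms(2) twist_add twist_scale twist_mult matrix_diff_distrib)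

lemma sl4_irreducible_twist:
  assumes irr: "sl4_irreducible \<rho> V" and g: "invertible g"
  shows "sl4_irreducible (twist g \<rho>) V"
  unfolding sl4_irreducible_def
proof (intro conjI allI impI)
  show "sl4_rep (twist g \<rho>) V" "V \<noteq> {0}"
    using irr g by (auto simp: sl4_irreducible_def intro: sl4_rep_twist)
  fix W assume W: "cfun.subspace W \<and> W \<subseteq> V \<and> (\<forall>X\<in>sl4. twist g \<rho> X ` W \<subseteq> W)"
  have g': "invertible (matrix_inv g)"
    using g by (metis invertible_def matrix_inv_mult)
  have inv: "matrix_inv (matrix_inv g) = g"
    by (rule matrix_inv_eqI) (simp add: matrix_inv_mult g)
  have "\<rho> X ` W \<subseteq> W" if X: "X \<in> sl4" for X
  proof -
    have "g ** X ** matrix_inv g \<in> sl4"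
      using sl4_conj[OF g' X] by (simp add: inv)
    moreover have "twist g \<rho> (g ** X ** matrix_inv g) = \<rho> X"
    proof -
      have "matrix_inv g ** (g ** X ** matrix_inv g) ** g = (matrix_inv g ** g) ** X ** (matrix_inv g ** g)"
        by (simp only: matrix_mul_assoc)
      thus ?thesis by (simp add: twist_def matrix_inv_mult g)
    qed
    ultimately show ?thesis
      using W by metis
  qed
  thus "W = {0} \<or> W = V"
    using irr W by (auto simp: sl4_irreducible_def)
qed

section \<open>The matrix coefficients in closed form\<close>

text \<open>Together with Cauchy's formula this gives the Taylor coefficients of negative powers of a linear
  function, the only integrals needed.\<close>
lemma higher_deriv_inverse_linear_power:
  fixes a b s :: complex
  assumes "a * s + b \<noteq> 0"
  shows "(deriv ^^ i) (\<lambda>s. inverse ((a * s + b) ^ M)) s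
    = (-1) ^ i * pochhammer (of_nat M) i * a ^ i * inverse ((a * s + b) ^ (M + i))"
  using assms
proof (induction i arbitrary: s)
  case 0
  show ?case by simp
next
  case (Suc i)
  let ?c = "(-1) ^ i * pochhammer (of_nat M) i * a ^ i"
  have "open {s. a * s + b \<noteq> 0}"
    by (intro open_Collect_neq continuous_intros)
  hence "\<forall>\<^sub>F w in nhds s. a * w + b \<noteq> 0"
    using Suc.prems by (auto simp: eventually_nhds)
  hence "\<forall>\<^sub>F w in nhds s. (deriv ^^ i) (\<lambda>s. inverse ((a * s + b) ^ M)) w = ?c * inverse ((a * w + b) ^ (M + i))"
    by eventually_elim (rule Suc.IH)
  hence "(deriv ^^ Suc i) (\<lambda>s. inverse ((a * s + b) ^ M)) s = deriv (\<lambda>w. ?c * inverse ((a * w + b) ^ (M + i))) s"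
    by (simp add: deriv_cong_ev)
  also have "\<dots> = ?c * (- (of_nat (M + i) * a * inverse ((a * s + b) ^ (M + i + 1))))"
  proof (rule DERIV_imp_deriv)
    have base: "((\<lambda>w. inverse (a * w + b)) has_field_derivative - (a * (inverse (a * s + b))\<^sup>2)) (at s)"
      using Suc.prems by (auto intro!: derivative_eq_intros simp: power2_eq_square)
    have "((\<lambda>w. inverse ((a * w + b) ^ n)) has_field_derivative - (of_nat n * a * inverse ((a * s + b) ^ (n + 1)))) (at s)" for n
      unfolding power_inverse[symmetric]
      by (rule DERIV_cong[OF DERIV_power[OF base]]) (cases n; simp add: power2_eq_square mult_ac)
    thus "((\<lambda>w. ?c * inverse ((a * w + b) ^ (M + i))) has_field_derivative
        ?c * (- (of_nat (M + i) * a * inverse ((a * s + b) ^ (M + i + 1))))) (at s)"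
      by (rule DERIV_cmult)
  qed
  finally show ?case
    by (simp add: pochhammer_Suc algebra_simps)
qed

lemma linear_nonzero_on_disc:
  fixes a b s :: complex
  assumes ab: "norm a < norm b" and s: "s \<in> cball 0 1"
  shows "a * s + b \<noteq> 0"
proof
  assume "a * s + b = 0"
  hence "norm b = norm a * norm s"
    by (metis add_eq_0_iff norm_minus_cancel norm_mult)
  also have "\<dots> \<le> norm a * 1"
    using s by (intro mult_left_mono) auto
  finally show False using ab by simp
qed

lemma has_contour_integral_inverse_linear_power:
  fixes a b :: complex
  assumes ab: "norm a < norm b"
  shows "((\<lambda>s. inverse ((a * s + b) ^ Suc M) / s ^ Suc i) has_contour_integral
    (2 * pi * \<i>) * ((-1) ^ i * of_nat ((M + i) choose i) * a ^ i / b ^ (Suc M + i))) (circlepath 0 1)"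
proof -
  note nz = linear_nonzero_on_disc[OF ab]
  have "((\<lambda>u. inverse ((a * u + b) ^ Suc M) / (u - 0) ^ Suc i) has_contour_integral
      (2 * pi * \<i>) / fact i * (deriv ^^ i) (\<lambda>u. inverse ((a * u + b) ^ Suc M)) 0) (circlepath 0 1)"
  proof (rule Cauchy_has_contour_integral_higher_derivative_circlepath)
    show "continuous_on (cball 0 1) (\<lambda>u. inverse ((a * u + b) ^ Suc M))"
      using nz by (intro continuous_intros) (simp add: nz)
    show "(\<lambda>u. inverse ((a * u + b) ^ Suc M)) holomorphic_on ball 0 1"
      using nz by (intro holomorphic_intros) (simp add: nz)
  qed simp
  moreover have "(2 * pi * \<i>) / fact i * (deriv ^^ i) (\<lambda>u. inverse ((a * u + b) ^ Suc M)) 0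
      = (2 * pi * \<i>) * ((-1) ^ i * of_nat ((M + i) choose i) * a ^ i / b ^ (Suc M + i))"
  proof -
    have "pochhammer (of_nat (Suc M)) i = (fact i * of_nat ((M + i) choose i) :: complex)"
      using gbinomial_pochhammer'[of "of_nat (M + i) :: complex" i] by (simp add: binomial_gbinomial field_simps)
    moreover have "a * 0 + b \<noteq> 0"
      using nz[of 0] by simp
    ultimately show ?thesis
      by (subst higher_deriv_inverse_linear_power) (simp_all add: field_simps)
  qed
  ultimately show ?thesis by simp
qed

text \<open>The coefficient of \<open>s ^ r\<close> in \<open>(s z\<^sub>1\<^sub>1 + z\<^sub>2\<^sub>1) ^ p / (s z\<^sub>1\<^sub>2 + z\<^sub>2\<^sub>2) ^ (\<kappa> + 1 + p)\<close>.\<close>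
definition t_coeff :: "nat \<Rightarrow> nat \<Rightarrow> nat \<Rightarrow> HC \<Rightarrow> complex" where
  "t_coeff \<kappa> p r Z = (\<Sum>j\<le>min p r. (-1) ^ (r - j) * of_nat (p choose j) * of_nat ((\<kappa> + r) choose (r - j)) *
     N Z ^ j * (Z $ 2 $ 1) ^ (p - j) * (Z $ 1 $ 2) ^ (r - j)) / (Z $ 2 $ 2) ^ (\<kappa> + 1 + p + r)"

text \<open>Only the second linear form has to be expanded as a series.  Since
  \<open>z\<^sub>2\<^sub>2 (s z\<^sub>1\<^sub>1 + z\<^sub>2\<^sub>1) = s N Z + z\<^sub>2\<^sub>1 (s z\<^sub>1\<^sub>2 + z\<^sub>2\<^sub>2)\<close>, the binomial theorem writes the integrand
  through powers of \<open>s\<close> and of that form.\<close>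
lemma t_integrand_has_contour_integral:
  assumes nz: "norm (Z $ 1 $ 2) < norm (Z $ 2 $ 2)"
  shows "((\<lambda>s. (s * Z $ 1 $ 1 + Z $ 2 $ 1) ^ p * inverse ((s * Z $ 1 $ 2 + Z $ 2 $ 2) ^ (\<kappa> + 1 + p)) / s ^ Suc r)
    has_contour_integral (2 * pi * \<i>) * t_coeff \<kappa> p r Z) (circlepath 0 1)"
proof -
  let ?a = "Z $ 1 $ 2" and ?b = "Z $ 2 $ 2"
  let ?w = "\<lambda>s. ?a * s + ?b"
  have b: "?b \<noteq> 0" using nz by auto
  note w = linear_nonzero_on_disc[OF nz]
  define c where "c = (\<lambda>j. of_nat (p choose j) * N Z ^ j * (Z $ 2 $ 1) ^ (p - j) / ?b ^ p)"
  define I where "I = (\<lambda>j. if j \<le> r then (2 * pi * \<i>) * ((-1) ^ (r - j) * of_nat ((\<kappa> + j + (r - j)) choose (r - j)) *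
      ?a ^ (r - j) / ?b ^ (Suc (\<kappa> + j) + (r - j))) else 0)"
  have summand: "((\<lambda>s. inverse (?w s ^ Suc (\<kappa> + j)) * s ^ j / s ^ Suc r) has_contour_integral I j) (circlepath 0 1)" for j
  proof (cases "j \<le> r")
    case True
    have "((\<lambda>s. inverse (?w s ^ Suc (\<kappa> + j)) / s ^ Suc (r - j)) has_contour_integral I j) (circlepath 0 1)"
      using has_contour_integral_inverse_linear_power[OF nz, of "\<kappa> + j" "r - j"] True by (simp add: I_def)
    thus ?thesis
    proof (rule has_contour_integral_eq)
      fix s assume "s \<in> path_image (circlepath 0 1)"
      hence "s \<noteq> 0" by auto
      moreover have "s ^ Suc r = s ^ j * s ^ Suc (r - j)"
        using True by (simp flip: power_add)
      ultimately show "inverse (?w s ^ Suc (\<kappa> + j)) / s ^ Suc (r - j) = inverse (?w s ^ Suc (\<kappa> + j)) * s ^ j / s ^ Suc r"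
        by simp
    qed
  next
    case False
    \<comment> \<open>The integrand has no pole.  Cauchy's formula still applies, to a function vanishing at 0.\<close>
    let ?g = "\<lambda>s. inverse (?w s ^ Suc (\<kappa> + j)) * s ^ (j - r)"
    have "((\<lambda>s. ?g s / (s - 0)) has_contour_integral 2 * of_real pi * \<i> * ?g 0) (circlepath 0 1)"
    proof (rule Cauchy_integral_circlepath)
      show "continuous_on (cball 0 1) ?g"
        by (intro continuous_intros) (simp add: w)
      show "?g holomorphic_on ball 0 1"
        by (intro holomorphic_intros) (simp add: w)
    qed simp
    hence "((\<lambda>s. ?g s / s) has_contour_integral I j) (circlepath 0 1)"
      using False by (simp add: I_def power_0_left)
    thus ?thesis
    proof (rule has_contour_integral_eq)
      fix s assume "s \<in> path_image (circlepath 0 1)"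
      hence "s \<noteq> 0" by auto
      moreover have "s ^ j = s ^ (j - r) * s ^ r"
        using False by (simp flip: power_add)
      ultimately show "?g s / s = inverse (?w s ^ Suc (\<kappa> + j)) * s ^ j / s ^ Suc r"
        by simp
    qed
  qed
  have sum_int: "((\<lambda>s. \<Sum>j\<le>p. c j * (inverse (?w s ^ Suc (\<kappa> + j)) * s ^ j / s ^ Suc r)) has_contour_integral (\<Sum>j\<le>p. c j * I j)) (circlepath 0 1)"
    by (intro has_contour_integral_sum has_contour_integral_lmul summand) simp
  have val: "(\<Sum>j\<le>p. c j * I j) = (2 * pi * \<i>) * t_coeff \<kappa> p r Z"
  proof -
    have "(\<Sum>j\<le>p. c j * I j) = (\<Sum>j\<le>min p r. c j * I j)"
      by (rule sum.mono_neutral_right) (auto simp: I_def)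
    also have "\<dots> = (\<Sum>j\<le>min p r. (2 * pi * \<i>) * ((-1) ^ (r - j) * of_nat (p choose j) * of_nat ((\<kappa> + r) choose (r - j)) *
     N Z ^ j * (Z $ 2 $ 1) ^ (p - j) * (Z $ 1 $ 2) ^ (r - j)) / (Z $ 2 $ 2) ^ (\<kappa> + 1 + p + r))"
      by (intro sum.cong refl) (simp add: c_def I_def power_add b mult_ac)
    also have "\<dots> = (2 * pi * \<i>) * t_coeff \<kappa> p r Z"
      by (simp add: t_coeff_def sum_distrib_left sum_divide_distrib mult.assoc)
    finally show ?thesis .
  qed
  have pt: "(\<Sum>j\<le>p. c j * (inverse (?w s ^ Suc (\<kappa> + j)) * s ^ j / s ^ Suc r))
      = (s * Z $ 1 $ 1 + Z $ 2 $ 1) ^ p * inverse ((s * Z $ 1 $ 2 + Z $ 2 $ 2) ^ (\<kappa> + 1 + p)) / s ^ Suc r"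
    if "norm s = 1" for s
  proof -
    have ws: "?w s \<noteq> 0" by (rule w) (simp add: that)
    have "s * Z $ 1 $ 1 + Z $ 2 $ 1 = (N Z * s + Z $ 2 $ 1 * ?w s) / ?b"
      using b by (simp add: N_def det_2 field_simps)
    hence "(s * Z $ 1 $ 1 + Z $ 2 $ 1) ^ p = (\<Sum>j\<le>p. of_nat (p choose j) * (N Z * s) ^ j * (Z $ 2 $ 1 * ?w s) ^ (p - j)) / ?b ^ p"
      by (simp add: power_divide binomial_ring)
    also have "\<dots> = (\<Sum>j\<le>p. c j * s ^ j * ?w s ^ (p - j))"
      by (simp add: c_def sum_divide_distrib power_mult_distrib mult_ac)
    finally have "(s * Z $ 1 $ 1 + Z $ 2 $ 1) ^ p * inverse (?w s ^ (\<kappa> + 1 + p)) / s ^ Suc r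
        = (\<Sum>j\<le>p. c j * s ^ j * ?w s ^ (p - j) * inverse (?w s ^ (\<kappa> + 1 + p)) / s ^ Suc r)"
      by (simp only: sum_distrib_right sum_divide_distrib)
    also have "\<dots> = (\<Sum>j\<le>p. c j * (inverse (?w s ^ Suc (\<kappa> + j)) * s ^ j / s ^ Suc r))"
    proof (intro sum.cong refl)
      fix j assume "j \<in> {..p}"
      hence "?w s ^ (\<kappa> + 1 + p) = ?w s ^ Suc (\<kappa> + j) * ?w s ^ (p - j)"
        by (simp flip: power_add power_Suc)
      moreover have "c j * s ^ j * B * inverse (A * B) / x = c j * (inverse A * s ^ j / x)" if "B \<noteq> 0" for A B x
        using that by simp
      ultimately show "c j * s ^ j * ?w s ^ (p - j) * inverse (?w s ^ (\<kappa> + 1 + p)) / s ^ Suc r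
          = c j * (inverse (?w s ^ Suc (\<kappa> + j)) * s ^ j / s ^ Suc r)"
        using ws by (simp only: power_eq_0_iff simp_thms)
    qed
    finally show ?thesis
      by (simp add: mult.commute)
  qed
  show ?thesis
    unfolding val[symmetric] by (rule has_contour_integral_eq[OF sum_int], rule pt) simp
qed

text \<open>The measure \<open>ds / s\<close> on the unit circle is invariant under \<open>s \<mapsto> 1 / s\<close>.\<close>
lemma has_contour_integral_circle_reflect:
  assumes "((\<lambda>s. f s / s) has_contour_integral I) (circlepath 0 1)"
  shows "((\<lambda>s. f (1 / s) / s) has_contour_integral I) (circlepath 0 1)"
proof -
  let ?e = "\<lambda>x :: real. exp (2 * of_real pi * \<i> * of_real x)"
  have vd: "g (circlepath 0 1 x) / circlepath 0 1 x * vector_derivative (circlepath 0 1) (at x within {0..1})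
      = g (?e x) * (2 * of_real pi * \<i>)" if "x \<in> {0..1}" for x :: real and g :: "complex \<Rightarrow> complex"
    using that by (subst vector_derivative_circlepath01) (auto simp: circlepath)
  have "((\<lambda>x. f (?e x) * (2 * of_real pi * \<i>)) has_integral I) {0..1}"
    using assms unfolding has_contour_integral_def by (rule has_integral_eq[rotated]) (rule vd)
  from has_integral_affinity01[OF this, of "- 1" 1]
  have "((\<lambda>x. f (?e (- x + 1)) * (2 * of_real pi * \<i>)) has_integral I) ((\<lambda>x. - x + 1) ` {0..1})"
    by simp
  moreover have "(\<lambda>x :: real. - x + 1) ` {0..1} = {0..1}"
    by (auto simp: image_iff intro!: bexI[of _ "1 - _"])
  moreover have "?e (- x + 1) = 1 / ?e x" for x
    by (simp add: algebra_simps exp_diff)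
  ultimately have "((\<lambda>x. f (1 / ?e x) * (2 * of_real pi * \<i>)) has_integral I) {0..1}"
    by simp
  thus ?thesis
    unfolding has_contour_integral_def
    by (rule has_integral_eq[rotated]) (rule vd[symmetric])
qed

text \<open>Conjugation by the permutation matrix of order two: rows and columns are both reversed.\<close>
definition flip :: "HC \<Rightarrow> HC" where
  "flip Z = (\<chi> i j. Z $ (if i = 1 then 2 else 1) $ (if j = 1 then 2 else 1))"

lemma flip_nth [simp]:
  "flip Z $ 1 $ 1 = Z $ 2 $ 2" "flip Z $ 1 $ 2 = Z $ 2 $ 1" "flip Z $ 2 $ 1 = Z $ 1 $ 2" "flip Z $ 2 $ 2 = Z $ 1 $ 1"
  by (simp_all add: flip_def)

lemma flip_flip [simp]: "flip (flip Z) = Z"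
  by (simp add: vec_eq_iff forall_2)

lemma N_flip [simp]: "N (flip Z) = N Z"
  by (simp add: N_def det_2 mult.commute)

lemma flip_regular [simp]: "flip Z \<in> regular_set \<longleftrightarrow> Z \<in> regular_set"
  by (auto simp: regular_set_def)

lemma real_cone_norm: "Z \<in> real_cone \<Longrightarrow> norm (Z $ 1 $ 2) < norm (Z $ 2 $ 2)"
proof -
  assume "Z \<in> real_cone"
  hence "Re (Z $ 1 $ 1 * cnj (Z $ 1 $ 1)) > Re (Z $ 1 $ 2 * cnj (Z $ 1 $ 2))" and eq: "Z $ 2 $ 2 = cnj (Z $ 1 $ 1)"
    by (auto simp: real_cone_def det_2)
  hence "(norm (Z $ 1 $ 2))\<^sup>2 < (norm (Z $ 1 $ 1))\<^sup>2"
    unfolding complex_norm_square[symmetric] by simp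
  thus ?thesis
    using eq by (simp add: power2_less_imp_less)
qed

lemma flip_real_cone: "Z \<in> real_cone \<Longrightarrow> flip Z \<in> real_cone"
  using N_flip[of Z] by (simp add: real_cone_def N_def)

lemma floor_of_int_real: "x = of_int i \<Longrightarrow> \<lfloor>x :: real\<rfloor> = i"
  by simp

lemma t_integral_plus:
  assumes Z: "Z \<in> real_cone" and l: "l = - real (Suc \<kappa>) / 2" and m: "m = l - real p" and n: "n = l - real r"
  shows "t_integral l n m Z = t_coeff \<kappa> p r Z"
proof -
  have fl: "\<lfloor>l - m\<rfloor> = int p" "\<lfloor>l + m\<rfloor> = - int (\<kappa> + 1 + p)" "\<lfloor>- l + n\<rfloor> = - int r"
    by (rule floor_of_int_real, simp add: l m n field_simps)+
  have "((\<lambda>s. (s * Z $ 1 $ 1 + Z $ 2 $ 1) powi \<lfloor>l - m\<rfloor> * (s * Z $ 1 $ 2 + Z $ 2 $ 2) powi \<lfloor>l + m\<rfloor> *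
            s powi \<lfloor>- l + n\<rfloor> / s) has_contour_integral (2 * pi * \<i>) * t_coeff \<kappa> p r Z) (circlepath 0 1)"
    using t_integrand_has_contour_integral[OF real_cone_norm[OF Z], of p \<kappa> r]
    unfolding fl power_int_minus power_int_of_nat
    by (rule has_contour_integral_eq) (simp only: power_Suc divide_inverse inverse_mult_distrib mult_ac)
  thus ?thesis
    by (simp add: t_integral_def contour_integral_unique)
qed

text \<open>In this case the zero of the first linear form lies inside the circle.  The substitution
  \<open>s \<mapsto> 1 / s\<close> exchanges the two forms and leads back to the other case for \<^term>\<open>flip Z\<close>.\<close>
lemma t_integral_minus:
  assumes Z: "Z \<in> real_cone" and l: "l = - real (Suc \<kappa>) / 2" and m: "m = - l + real p" and n: "n = - l + real r"
  shows "t_integral l n m Z = t_coeff \<kappa> p r (flip Z)"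
proof -
  have fl: "\<lfloor>l - m\<rfloor> = - int (\<kappa> + 1 + p)" "\<lfloor>l + m\<rfloor> = int p" "\<lfloor>- l + n\<rfloor> = int (\<kappa> + 1 + r)"
    by (rule floor_of_int_real, simp add: l m n field_simps)+
  let ?f = "\<lambda>s. (s * Z $ 2 $ 2 + Z $ 1 $ 2) ^ p * inverse ((s * Z $ 2 $ 1 + Z $ 1 $ 1) ^ (\<kappa> + 1 + p)) / s ^ r"
  have "((\<lambda>s. ?f s / s) has_contour_integral (2 * pi * \<i>) * t_coeff \<kappa> p r (flip Z)) (circlepath 0 1)"
    using t_integrand_has_contour_integral[OF real_cone_norm[OF flip_real_cone[OF Z]], of p \<kappa> r] by (simp add: mult.commute)
  from has_contour_integral_circle_reflect[OF this]
  have "((\<lambda>s. (s * Z $ 1 $ 1 + Z $ 2 $ 1) powi \<lfloor>l - m\<rfloor> * (s * Z $ 1 $ 2 + Z $ 2 $ 2) powi \<lfloor>l + m\<rfloor> *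
            s powi \<lfloor>- l + n\<rfloor> / s) has_contour_integral (2 * pi * \<i>) * t_coeff \<kappa> p r (flip Z)) (circlepath 0 1)"
  proof (rule has_contour_integral_eq)
    fix s :: complex assume "s \<in> path_image (circlepath 0 1)"
    hence s: "s \<noteq> 0" by auto
    have "1 / s * Z $ 2 $ 2 + Z $ 1 $ 2 = (s * Z $ 1 $ 2 + Z $ 2 $ 2) / s"
      "1 / s * Z $ 2 $ 1 + Z $ 1 $ 1 = (s * Z $ 1 $ 1 + Z $ 2 $ 1) / s"
      using s by (simp_all add: field_simps)
    hence "?f (1 / s) = ((s * Z $ 1 $ 2 + Z $ 2 $ 2) / s) ^ p * inverse (((s * Z $ 1 $ 1 + Z $ 2 $ 1) / s) ^ (\<kappa> + 1 + p)) / (1 / s) ^ r"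
      by (simp only:)
    also have "\<dots> = (s * Z $ 1 $ 2 + Z $ 2 $ 2) ^ p * inverse ((s * Z $ 1 $ 1 + Z $ 2 $ 1) ^ (\<kappa> + 1 + p)) * s ^ (\<kappa> + 1 + r)"
      using s by (simp add: power_divide power_add inverse_eq_divide)
    finally show "?f (1 / s) / s = (s * Z $ 1 $ 1 + Z $ 2 $ 1) powi \<lfloor>l - m\<rfloor> * (s * Z $ 1 $ 2 + Z $ 2 $ 2) powi \<lfloor>l + m\<rfloor> *
            s powi \<lfloor>- l + n\<rfloor> / s"
      unfolding fl power_int_minus power_int_of_nat by (simp only: mult_ac)
  qed
  thus ?thesis
    by (simp add: t_integral_def contour_integral_unique)
qed

text \<open>Clearing denominators reduces this to polynomials.  It gives the uniqueness on which the
  definition of \<^const>\<open>t\<close> rests.\<close>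
lemma rationals_eqI:
  assumes f: "f \<in> rationals" and g: "g \<in> rationals" and eq: "\<And>Z. Z \<in> real_cone \<Longrightarrow> f Z = g Z"
  shows "f = g"
proof -
  obtain p q where p: "f = mero (\<lambda>Z. p Z / q Z)" "p \<in> polynomials" "q \<in> polynomials" "\<And>Z. Z \<in> regular_set \<Longrightarrow> q Z \<noteq> 0"
    using f by (auto simp: rationals_def)
  obtain p' q' where p': "g = mero (\<lambda>Z. p' Z / q' Z)" "p' \<in> polynomials" "q' \<in> polynomials" "\<And>Z. Z \<in> regular_set \<Longrightarrow> q' Z \<noteq> 0"
    using g by (auto simp: rationals_def)
  have "p Z * q' Z - p' Z * q Z = 0" for Z
  proof (rule polynomial_zero_on_real_cone[of "\<lambda>Z. p Z * q' Z - p' Z * q Z"])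
    fix Z assume Z: "Z \<in> real_cone"
    hence reg: "Z \<in> regular_set"
      using real_cone_subset_regular by auto
    show "p Z * q' Z - p' Z * q Z = 0"
      using eq[OF Z] p(4)[OF reg] p'(4)[OF reg] reg by (simp add: p(1) p'(1) field_simps)
  qed (use p p' in simp)
  hence "p Z / q Z = p' Z / q' Z" if "Z \<in> regular_set" for Z
    using p(4)[OF that] p'(4)[OF that] by (simp add: field_simps)
  thus ?thesis
    unfolding p(1) p'(1) by (rule mero_cong)
qed

lemma t_eqI:
  assumes "f \<in> rationals" "\<And>Z. Z \<in> real_cone \<Longrightarrow> f Z = t_integral l n m Z"
  shows "t l n m = f"
  unfolding t_def using assms by (intro the_equality) (auto intro: rationals_eqI)

lemma polynomials_N [simp]: "N \<in> polynomials"
  by (simp add: N_def[abs_def] det_2)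

lemma t_plus:
  assumes "l = - real (Suc \<kappa>) / 2" "m = l - real p" "n = l - real r"
  shows "t l n m = mero (t_coeff \<kappa> p r)"
proof (rule t_eqI)
  have "t_coeff \<kappa> p r = (\<lambda>Z. (\<Sum>j\<le>min p r. (-1) ^ (r - j) * of_nat (p choose j) * of_nat ((\<kappa> + r) choose (r - j)) *
     N Z ^ j * (Z $ 2 $ 1) ^ (p - j) * (Z $ 1 $ 2) ^ (r - j)) / (Z $ 2 $ 2) ^ (\<kappa> + 1 + p + r))"
    by (simp add: fun_eq_iff t_coeff_def)
  thus "mero (t_coeff \<kappa> p r) \<in> rationals"
    unfolding rationals_def
    by (intro CollectI exI conjI) (auto simp: regular_set_def)
  show "mero (t_coeff \<kappa> p r) Z = t_integral l n m Z" if "Z \<in> real_cone" for Z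
    using t_integral_plus[OF that assms] real_cone_subset_regular that by auto
qed

lemma t_minus:
  assumes "l = - real (Suc \<kappa>) / 2" "m = - l + real p" "n = - l + real r"
  shows "t l n m = mero (\<lambda>Z. t_coeff \<kappa> p r (flip Z))"
proof (rule t_eqI)
  have "(\<lambda>Z. t_coeff \<kappa> p r (flip Z)) = (\<lambda>Z. (\<Sum>j\<le>min p r. (-1) ^ (r - j) * of_nat (p choose j) * of_nat ((\<kappa> + r) choose (r - j)) *
     N Z ^ j * (Z $ 1 $ 2) ^ (p - j) * (Z $ 2 $ 1) ^ (r - j)) / (Z $ 1 $ 1) ^ (\<kappa> + 1 + p + r))"
    by (simp add: fun_eq_iff t_coeff_def)
  thus "mero (\<lambda>Z. t_coeff \<kappa> p r (flip Z)) \<in> rationals"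
    unfolding rationals_def
    by (intro CollectI exI conjI) (auto simp: regular_set_def)
  show "mero (\<lambda>Z. t_coeff \<kappa> p r (flip Z)) Z = t_integral l n m Z" if "Z \<in> real_cone" for Z
    using t_integral_minus[OF that assms] real_cone_subset_regular that by auto
qed

section \<open>Representations transported by involutions in the group\<close>

definition group_op :: "gl4 \<Rightarrow> (HC \<Rightarrow> complex) \<Rightarrow> (HC \<Rightarrow> complex)" where
  "group_op g f = mero (group_act g f)"

text \<open>Group elements of order two whose fractional linear action preserves \<^const>\<open>regular_set\<close>; for
  them \<^const>\<open>group_op\<close> is compatible with the cut-off \<^const>\<open>mero\<close>.\<close>
definition regular_involution :: "gl4 \<Rightarrow> bool" where
  "regular_involution g \<longleftrightarrow> g ** g = mat 1 \<and>
     (\<forall>Z\<in>regular_set. N (den g Z) \<noteq> 0 \<and> frac_lin g Z \<in> regular_set)"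

lemma regular_involutionD:
  assumes "regular_involution g"
  shows "g ** g = mat 1" "invertible g" "matrix_inv g = g"
    "Z \<in> regular_set \<Longrightarrow> N (den g Z) \<noteq> 0" "Z \<in> regular_set \<Longrightarrow> frac_lin g Z \<in> regular_set"
  using assms matrix_inv_eqI by (auto simp: regular_involution_def invertible_def)

lemma group_op_involution:
  assumes g: "regular_involution g" and f: "mero f = f"
  shows "group_op g (group_op g f) = f"
proof -
  note D = regular_involutionD[OF g]
  have "group_act g (group_op g f) Z = f Z" if Z: "Z \<in> regular_set" for Z
  proof -
    have "group_act g (group_op g f) Z = group_act g (group_act g f) Z"
      by (simp add: group_act_eq[of g _ Z] group_op_def D Z)
    also have "\<dots> = group_act (mat 1) f Z"
      using group_act_mult[OF D(2) D(2), of Z f] D Z by simp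
    also have "\<dots> = f Z"
      by (simp add: group_act_eq N_def)
    finally show ?thesis .
  qed
  hence "group_op g (group_op g f) = mero f"
    unfolding group_op_def[of g "group_op g f"] by (rule mero_cong)
  thus ?thesis by (simp add: f)
qed

lemma linear_between_group_op:
  "linear_between V (group_op g) (group_op g ` V)"
  by (auto simp: linear_between_def group_op_def group_act_eq mero_def cscale_def fun_eq_iff algebra_simps)

lemma matrix_inv_2:
  assumes "N W \<noteq> 0"
  shows "matrix_inv W $ 1 $ 1 = W $ 2 $ 2 / N W" "matrix_inv W $ 1 $ 2 = - W $ 1 $ 2 / N W"
    "matrix_inv W $ 2 $ 1 = - W $ 2 $ 1 / N W" "matrix_inv W $ 2 $ 2 = W $ 1 $ 1 / N W"
proof -
  define V :: HC where "V = (\<chi> i j. (if i = 1 then if j = 1 then W $ 2 $ 2 else - W $ 1 $ 2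
     else if j = 1 then - W $ 2 $ 1 else W $ 1 $ 1) / N W)"
  have "W ** V = mat 1"
    using assms by (simp add: vec_eq_iff forall_2 V_def matrix_matrix_mult_def sum_2 mat_def divide_simps)
      (simp add: N_def det_2 algebra_simps)
  hence "matrix_inv W = V"
    by (rule matrix_inv_eqI)
  thus "matrix_inv W $ 1 $ 1 = W $ 2 $ 2 / N W" "matrix_inv W $ 1 $ 2 = - W $ 1 $ 2 / N W"
    "matrix_inv W $ 2 $ 1 = - W $ 2 $ 1 / N W" "matrix_inv W $ 2 $ 2 = W $ 1 $ 1 / N W"
    by (simp_all add: V_def)
qed

lemma differentiable_vecI:
  fixes f :: "'a::real_normed_vector \<Rightarrow> 'b::real_normed_vector^'n"
  assumes "\<And>i. (\<lambda>x. f x $ i) differentiable (at x)"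
  shows "f differentiable (at x)"
proof -
  obtain D where D: "\<And>i. ((\<lambda>x. f x $ i) has_derivative D i) (at x)"
    using assms unfolding differentiable_def by metis
  have "(f has_derivative (\<lambda>h. \<chi> i. D i h)) (at x)"
    by (rule has_derivative_vecI) (simp add: D)
  thus ?thesis unfolding differentiable_def by blast
qed

lemma matrix_inv_differentiable:
  assumes "N W \<noteq> 0"
  shows "(matrix_inv :: HC \<Rightarrow> HC) differentiable (at W)"
proof -
  have coord: "(\<lambda>A :: HC. A $ i $ j) differentiable (at W)" for i j
    unfolding differentiable_def by (auto intro!: exI derivative_eq_intros)
  have dN: "N differentiable (at W)"
    unfolding N_def[abs_def] det_2 by (intro differentiable_diff differentiable_mult coord)
  have "open (N -` (- {0}))"
    unfolding N_def[abs_def] det_2 by (intro open_vimage continuous_intros open_Compl)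
  hence ev: "\<forall>\<^sub>F A in at W. N A \<noteq> 0"
    using eventually_at_in_open'[of "N -` (- {0})" W] assms by simp
  have entry: "(\<lambda>A. matrix_inv A $ i $ j) differentiable (at W)"
    if eq: "\<And>A. N A \<noteq> 0 \<Longrightarrow> matrix_inv A $ i $ j = h A / N A" and h: "h differentiable (at W)" for i j h
  proof -
    obtain D where D: "((\<lambda>A. h A / N A) has_derivative D) (at W)"
      using differentiable_divide[OF h dN] assms unfolding differentiable_def by blast
    have "((\<lambda>A. matrix_inv A $ i $ j) has_derivative D) (at W)"
      by (rule has_derivative_transform_eventually[OF D])
         (use ev eq assms in \<open>auto elim!: eventually_mono\<close>)
    thus ?thesis unfolding differentiable_def by blast
  qed
  have neg: "(\<lambda>A :: HC. - A $ i $ j) differentiable (at W)" for i j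
    using coord by (rule differentiable_minus)
  have "(\<lambda>A. matrix_inv A $ i $ j) differentiable (at W)" for i j
    using exhaust_2[of i] exhaust_2[of j] entry[OF matrix_inv_2(1) coord] entry[OF matrix_inv_2(2) neg]
      entry[OF matrix_inv_2(3) neg] entry[OF matrix_inv_2(4) coord] by auto
  thus ?thesis
    by (intro differentiable_vecI)
qed

lemma differentiable_matrix_mult:
  fixes f :: "HC \<Rightarrow> HC"
  assumes "f differentiable (at x)" "g differentiable (at x)"
  shows "(\<lambda>x. f x ** (g x :: HC)) differentiable (at x)"
  using assms has_derivative_matrix_mult unfolding differentiable_def by blast

lemma group_op_differentiable:
  assumes g: "regular_involution g" and f: "\<And>Z. Z \<in> regular_set \<Longrightarrow> f differentiable (at Z)"
    and Z: "Z \<in> regular_set"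
  shows "group_op g f differentiable (at Z)"
proof -
  note D = regular_involutionD[OF g]
  have lin: "num g differentiable (at Z)" "den g differentiable (at Z)"
    unfolding num_def[abs_def] den_def[abs_def]
    by (intro differentiable_add differentiable_matrix_mult differentiable_const differentiable_ident)+
  have inv: "(\<lambda>Z. matrix_inv (den g Z)) differentiable (at Z)"
    using differentiable_chain_at[OF lin(2) matrix_inv_differentiable] D(4)[OF Z] by (simp add: o_def)
  have "frac_lin g differentiable (at Z)"
    unfolding frac_lin_def[abs_def] by (intro differentiable_matrix_mult lin inv)
  from differentiable_chain_at[OF this f[OF D(5)[OF Z]]]
  have "(\<lambda>Z. f (frac_lin g Z)) differentiable (at Z)"
    by (simp add: o_def)
  moreover have coord: "(\<lambda>Z. den g Z $ i $ j) differentiable (at Z)" for i j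
  proof -
    obtain D where "(den g has_derivative D) (at Z)"
      using lin(2) unfolding differentiable_def by blast
    from has_derivative_vec_nth[OF has_derivative_vec_nth[OF this]] show ?thesis
      unfolding differentiable_def by blast
  qed
  have "(\<lambda>Z. N (den g Z)) differentiable (at Z)"
    unfolding N_def by (rule differentiable_det[OF coord])
  ultimately have "group_act g f differentiable (at Z)"
    unfolding group_act_eq[abs_def] D(3)
    by (intro differentiable_mult differentiable_divide differentiable_const D(4)[OF Z])
  thus ?thesis
    using has_derivative_mero[OF Z] unfolding group_op_def differentiable_def by blast
qed

text \<open>The properties of a space of functions that are inherited by its images under regular
  involutions.\<close>
definition rep_space :: "(HC \<Rightarrow> complex) set \<Rightarrow> bool" where
  "rep_space V \<longleftrightarrow> sl4_irreducible lie_act V \<and>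
     (\<forall>f\<in>V. mero f = f \<and> (\<forall>Z\<in>regular_set. f differentiable (at Z)))"

text \<open>Equivariance makes \<open>group_op g\<close> an intertwining operator from \<open>V\<close> with the twisted action
  onto its image with the original action; being an involution it is also its own inverse.\<close>
lemma rep_space_group_op:
  assumes g: "regular_involution g" and V: "rep_space V"
  shows "rep_space (group_op g ` V)" "sl4_rep_iso lie_act (group_op g ` V) (twist g lie_act) V"
proof -
  note D = regular_involutionD[OF g]
  have irr: "sl4_irreducible lie_act V"
    and mero: "\<And>f. f \<in> V \<Longrightarrow> mero f = f"
    and diff: "\<And>f Z. f \<in> V \<Longrightarrow> Z \<in> regular_set \<Longrightarrow> f differentiable (at Z)"
    using V by (auto simp: rep_space_def)
  have inv: "group_op g (group_op g f) = f" if "f \<in> V" for f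
    using group_op_involution[OF g] mero that by simp
  have inj: "inj_on (group_op g) V"
    using inv by (metis inj_on_inverseI)
  have eq: "lie_act X (group_op g f) = group_op g (twist g lie_act X f)" if "f \<in> V" for X f
    unfolding group_op_def
    by (rule lie_act_group_act) (use D diff that in auto)
  have irr_tw: "sl4_irreducible (twist g lie_act) V"
    by (rule sl4_irreducible_twist[OF irr D(2)])
  have irr': "sl4_irreducible lie_act (group_op g ` V)"
    by (rule sl4_irreducible_transport[OF irr_tw linear_between_group_op inj eq])
  thus "rep_space (group_op g ` V)"
    unfolding rep_space_def using group_op_differentiable[OF g] diff by (auto simp: group_op_def)
  have image_twice: "group_op g ` group_op g ` V = V"
    using inv by (simp add: image_image cong: image_cong)
  show "sl4_rep_iso lie_act (group_op g ` V) (twist g lie_act) V"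
    unfolding sl4_rep_iso_def
  proof (intro conjI exI[of _ "group_op g"] ballI)
    show "sl4_rep lie_act (group_op g ` V)" "sl4_rep (twist g lie_act) V"
      using irr' irr_tw by (auto simp: sl4_irreducible_def)
    show "linear_between (group_op g ` V) (group_op g) V"
      using linear_between_group_op[of "group_op g ` V" g] by (simp add: image_twice)
    show "bij_betw (group_op g) (group_op g ` V) V"
      unfolding bij_betw_def using image_twice inv by (metis (no_types, lifting) inj_on_def imageE)
    fix X f assume X: "X \<in> sl4" and "f \<in> group_op g ` V"
    then obtain h where h: "f = group_op g h" "h \<in> V" by blast
    have "twist g lie_act X h \<in> V"
      using irr_tw X h(2) unfolding sl4_irreducible_def sl4_rep_def linear_between_def by blast
    thus "group_op g (lie_act X f) = twist g lie_act X (group_op g f)"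
      using h by (simp add: eq inv)
  qed
qed

lemma rep_space_H_plus: "rep_space H_plus"
proof -
  have "mero \<phi> differentiable (at Z)" if "\<phi> \<in> polynomials" "Z \<in> regular_set" for \<phi> Z
    using polynomial_has_derivative[OF that(1)] has_derivative_mero[OF that(2)]
    unfolding differentiable_def by blast
  thus ?thesis
    using sl4_irreducible_H_plus by (auto simp: rep_space_def H_plus_def harmonic_poly)
qed

section \<open>Inversion and a partial inversion\<close>

definition of_blocks :: "HC \<Rightarrow> HC \<Rightarrow> HC \<Rightarrow> HC \<Rightarrow> gl4" where
  "of_blocks a b c d = (\<chi> i j. case i of
      Inl k \<Rightarrow> (case j of Inl l \<Rightarrow> a $ k $ l | Inr l \<Rightarrow> b $ k $ l)
    | Inr k \<Rightarrow> (case j of Inl l \<Rightarrow> c $ k $ l | Inr l \<Rightarrow> d $ k $ l))"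

lemma block_of_blocks [simp]:
  "block_a (of_blocks a b c d) = a" "block_b (of_blocks a b c d) = b"
  "block_c (of_blocks a b c d) = c" "block_d (of_blocks a b c d) = d"
  by (simp_all add: of_blocks_def block_defs vec_eq_iff)

lemma block_eqI:
  assumes "block_a X = block_a Y" "block_b X = block_b Y" "block_c X = block_c Y" "block_d X = block_d Y"
  shows "X = Y"
proof -
  have "X $ i $ j = Y $ i $ j" for i j
    using assms by (cases i; cases j) (auto simp: block_defs vec_eq_iff)
  thus ?thesis by (simp add: vec_eq_iff)
qed

definition diag2 :: "complex \<Rightarrow> complex \<Rightarrow> HC" where
  "diag2 p q = (\<chi> i j. if i = 1 \<and> j = 1 then p else if i = 2 \<and> j = 2 then q else 0)"

lemma diag2_simps:
  "diag2 p q ** diag2 p' q' = diag2 (p * p') (q * q')" "diag2 p q + diag2 p' q' = diag2 (p + p') (q + q')"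
  "diag2 1 1 = mat 1" "diag2 0 0 = 0"
  by (simp_all add: vec_eq_iff forall_2 diag2_def matrix_matrix_mult_def sum_2 mat_def)

definition inversion :: gl4 where "inversion = of_blocks 0 (mat 1) (mat 1) 0"

definition half_inversion :: gl4 where
  "half_inversion = of_blocks (diag2 1 0) (diag2 0 1) (diag2 0 1) (diag2 1 0)"

lemma inversion_simps: "den inversion Z = Z" "frac_lin inversion Z = matrix_inv Z"
  by (simp_all add: den_def frac_lin_def num_def inversion_def)

lemma N_matrix_inv: "N Z \<noteq> 0 \<Longrightarrow> N (matrix_inv Z) = 1 / N Z"
  using N_mult[of Z "matrix_inv Z"] matrix_inv_mult(1)[of Z]
  by (simp add: N_def invertible_det_nz field_simps)

lemma regular_involution_inversion: "regular_involution inversion"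
proof -
  have "inversion ** inversion = mat 1"
    by (rule block_eqI) (simp_all add: block_mult inversion_def)
  thus ?thesis
    by (auto simp: regular_involution_def inversion_simps regular_set_def matrix_inv_2 N_matrix_inv)
qed

text \<open>In matrix form, \<^const>\<open>half_inversion\<close> exchanges the second row of \<open>Z\<close> with the second row of the
  identity in the column \<open>(Z, 1)\<close>.\<close>
lemma half_inversion_simps:
  "N (den half_inversion Z) = Z $ 2 $ 2"
  "Z $ 2 $ 2 \<noteq> 0 \<Longrightarrow> frac_lin half_inversion Z $ 1 $ 1 = N Z / Z $ 2 $ 2"
  "Z $ 2 $ 2 \<noteq> 0 \<Longrightarrow> frac_lin half_inversion Z $ 1 $ 2 = Z $ 1 $ 2 / Z $ 2 $ 2"
  "Z $ 2 $ 2 \<noteq> 0 \<Longrightarrow> frac_lin half_inversion Z $ 2 $ 1 = - (Z $ 2 $ 1 / Z $ 2 $ 2)"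
  "Z $ 2 $ 2 \<noteq> 0 \<Longrightarrow> frac_lin half_inversion Z $ 2 $ 2 = 1 / Z $ 2 $ 2"
proof -
  have den: "den half_inversion Z $ 1 $ 1 = 1" "den half_inversion Z $ 1 $ 2 = 0"
    "den half_inversion Z $ 2 $ 1 = Z $ 2 $ 1" "den half_inversion Z $ 2 $ 2 = Z $ 2 $ 2"
    and num: "num half_inversion Z $ 1 $ 1 = Z $ 1 $ 1" "num half_inversion Z $ 1 $ 2 = Z $ 1 $ 2"
    "num half_inversion Z $ 2 $ 1 = 0" "num half_inversion Z $ 2 $ 2 = 1"
    by (simp_all add: den_def num_def half_inversion_def diag2_def matrix_matrix_mult_def sum_2)
  show N: "N (den half_inversion Z) = Z $ 2 $ 2"
    by (simp add: N_def det_2 den)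
  assume nz: "Z $ 2 $ 2 \<noteq> 0"
  show "frac_lin half_inversion Z $ 1 $ 1 = N Z / Z $ 2 $ 2"
    "frac_lin half_inversion Z $ 1 $ 2 = Z $ 1 $ 2 / Z $ 2 $ 2"
    "frac_lin half_inversion Z $ 2 $ 1 = - (Z $ 2 $ 1 / Z $ 2 $ 2)"
    "frac_lin half_inversion Z $ 2 $ 2 = 1 / Z $ 2 $ 2"
    using nz by (simp_all add: frac_lin_def matrix_matrix_mult_def sum_2 matrix_inv_2 N den num)
      (simp add: N_def det_2 field_simps)
qed

lemma N_half_inversion:
  "Z $ 2 $ 2 \<noteq> 0 \<Longrightarrow> N (frac_lin half_inversion Z) = Z $ 1 $ 1 / Z $ 2 $ 2"
  by (simp add: N_def[of "frac_lin half_inversion Z"] det_2 half_inversion_simps)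
     (simp add: N_def det_2 field_simps)

lemma regular_involution_half_inversion: "regular_involution half_inversion"
proof -
  have "half_inversion ** half_inversion = mat 1"
    by (rule block_eqI) (simp_all add: block_mult half_inversion_def diag2_simps)
  thus ?thesis
    by (auto simp: regular_involution_def regular_set_def half_inversion_simps N_half_inversion)
qed

lemma group_op_apply:
  assumes "regular_involution g" "Z \<in> regular_set"
  shows "group_op g f Z = 1 / N (den g Z) * f (frac_lin g Z)"
  using regular_involutionD(3)[OF assms(1)] assms(2) by (simp add: group_op_def group_act_eq)

lemmas group_op_half = group_op_apply[OF regular_involution_half_inversion, unfolded half_inversion_simps(1)]
lemmas group_op_inv = group_op_apply[OF regular_involution_inversion, unfolded inversion_simps]

lemma frac_lin_half_regular: "Z \<in> regular_set \<Longrightarrow> frac_lin half_inversion Z \<in> regular_set"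
  using regular_involution_half_inversion by (simp add: regular_involution_def)

lemma matrix_inv_regular: "Z \<in> regular_set \<Longrightarrow> matrix_inv Z \<in> regular_set"
  using regular_involution_inversion by (simp add: regular_involution_def inversion_simps)

lemma H_minus_eq: "H_minus = group_op inversion ` H_plus"
proof -
  have "mero (\<lambda>Z. 1 / N Z * \<phi> (matrix_inv Z)) = group_op inversion (mero \<phi>)" for \<phi>
    unfolding group_op_def
    by (rule mero_cong)
       (use regular_involutionD(3)[OF regular_involution_inversion] in
         \<open>simp add: group_act_eq inversion_simps matrix_inv_regular\<close>)
  thus ?thesis
    by (auto simp: H_minus_def H_plus_def)
qed

section \<open>A weight basis of the harmonic polynomials\<close>

text \<open>The coefficient of \<open>y ^ C\<close> in \<open>(z\<^sub>1\<^sub>1 y + z\<^sub>1\<^sub>2) ^ R (z\<^sub>2\<^sub>1 y + z\<^sub>2\<^sub>2) ^ S\<close>, a weight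
  vector for the diagonal matrices.  These are, up to normalization, the matrix coefficients of the
  symmetric powers of the standard representation of \<open>GL(2)\<close>.\<close>
definition harm_basis :: "nat \<Rightarrow> nat \<Rightarrow> nat \<Rightarrow> HC \<Rightarrow> complex" where
  "harm_basis R S C Z = coeff ([:Z $ 1 $ 2, Z $ 1 $ 1:] ^ R * [:Z $ 2 $ 2, Z $ 2 $ 1:] ^ S) C"

lemma degree_harm_basis: "degree ([:a, b:] ^ R * [:c, d:] ^ S :: complex poly) \<le> R + S"
  using degree_mult_le[of "[:a, b:] ^ R" "[:c, d:] ^ S"] degree_linear_power_le[of a b R] degree_linear_power_le[of c d S]
  by linarith

lemma harm_basis_expand: "harm_basis R S C Z = (\<Sum>a\<le>C. of_nat (R choose a) * of_nat (S choose (C - a)) *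
    (Z $ 1 $ 1) ^ a * (Z $ 1 $ 2) ^ (R - a) * (Z $ 2 $ 1) ^ (C - a) * (Z $ 2 $ 2) ^ (S - (C - a)))"
  unfolding harm_basis_def coeff_mult coeff_linear_power_binomial by (intro sum.cong refl) (simp add: mult_ac)

text \<open>The generating polynomial is itself a coefficient, namely that of \<open>x ^ R\<close> in a power of
  \<open>(x, 1) Z (y, 1)\<^sup>T\<close>, up to a binomial factor.\<close>
lemma harm_basis_in_lpowers: "harm_basis R S C \<in> lpowers"
proof -
  let ?A = "\<lambda>y Z :: HC. Z $ 1 $ 2 + y * Z $ 1 $ 1" and ?B = "\<lambda>y Z :: HC. Z $ 2 $ 2 + y * Z $ 2 $ 1"
  have "(\<lambda>Z. ?A y Z ^ R * ?B y Z ^ S) \<in> lpowers" for y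
  proof -
    have "(\<lambda>Z. coeff ([:?B y Z, ?A y Z:] ^ (R + S)) R) \<in> lpowers"
    proof (rule coeff_in_subspace[OF subspace_lpowers _ degree_linear_power_le])
      fix x
      define u v :: "complex^2" where "u = (\<chi> i. if i = 1 then x else 1)" and "v = (\<chi> i. if i = 1 then y else 1)"
      have "(\<lambda>Z. poly ([:?B y Z, ?A y Z:] ^ (R + S)) x) = (\<lambda>Z. lform u v Z ^ (R + S))"
        by (simp add: lform_def sum_2 u_def v_def algebra_simps)
      thus "(\<lambda>Z. poly ([:?B y Z, ?A y Z:] ^ (R + S)) x) \<in> lpowers"
        by (simp only: lform_power_in_lpowers)
    qed
    hence "(\<lambda>Z. of_nat (R + S choose R) * ?A y Z ^ R * ?B y Z ^ S) \<in> lpowers"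
      by (simp add: coeff_linear_power_binomial)
    from subspace_fun_scale[OF subspace_lpowers this, of "1 / of_nat (R + S choose R)"]
    show ?thesis by (simp add: mult.assoc)
  qed
  hence "(\<lambda>Z. coeff ([:Z $ 1 $ 2, Z $ 1 $ 1:] ^ R * [:Z $ 2 $ 2, Z $ 2 $ 1:] ^ S) C) \<in> lpowers"
    by (intro coeff_in_subspace[OF subspace_lpowers _ degree_harm_basis]) simp
  thus ?thesis
    by (simp add: harm_basis_def[abs_def])
qed

lemma poly_sum_le: "degree p \<le> n \<Longrightarrow> poly p x = (\<Sum>i\<le>n. coeff p i * x ^ i)" for p :: "complex poly"
  unfolding poly_altdef by (intro sum.mono_neutral_cong_left) (auto intro: coeff_eq_0)

text \<open>Expand the powers of linear forms in the two coordinates of \<open>u\<close> and in those of \<open>v\<close>.\<close>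
lemma harmonic_subset_if_harm_basis:
  assumes W: "cfun.subspace W" and harm_basis: "\<And>R S C. C \<le> R + S \<Longrightarrow> harm_basis R S C \<in> W"
  shows "harmonic_polynomials \<subseteq> W"
proof -
  have prod: "(\<lambda>Z. (Z $ 1 $ 1 * y + Z $ 1 $ 2 * z) ^ R * (Z $ 2 $ 1 * y + Z $ 2 $ 2 * z) ^ S) \<in> W" for y z R S
  proof (cases "z = 0")
    case True
    \<comment> \<open>Only the top coefficient contributes; otherwise one can divide by \<open>z\<close>.\<close>
    have "harm_basis R S (R + S) Z = (Z $ 1 $ 1) ^ R * (Z $ 2 $ 1) ^ S" for Z
    proof -
      have "harm_basis R S (R + S) Z = (\<Sum>a\<in>{R}. of_nat (R choose a) * of_nat (S choose (R + S - a)) *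
          (Z $ 1 $ 1) ^ a * (Z $ 1 $ 2) ^ (R - a) * (Z $ 2 $ 1) ^ (R + S - a) * (Z $ 2 $ 2) ^ (S - (R + S - a)))"
        unfolding harm_basis_expand by (rule sum.mono_neutral_right) (auto simp: binomial_eq_0_iff)
      thus ?thesis by simp
    qed
    hence "(\<lambda>Z. (Z $ 1 $ 1 * y + Z $ 1 $ 2 * z) ^ R * (Z $ 2 $ 1 * y + Z $ 2 $ 2 * z) ^ S) = (\<lambda>Z. y ^ (R + S) * harm_basis R S (R + S) Z)"
      by (simp add: True power_mult_distrib power_add mult_ac)
    thus ?thesis
      using subspace_fun_scale[OF W harm_basis] by simp
  next
    case False
    have "(Z $ 1 $ 1 * y + Z $ 1 $ 2 * z) ^ R * (Z $ 2 $ 1 * y + Z $ 2 $ 2 * z) ^ S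
        = (\<Sum>C\<le>R + S. z ^ (R + S) * (y / z) ^ C * harm_basis R S C Z)" for Z
    proof -
      have "Z $ 1 $ 1 * y + Z $ 1 $ 2 * z = z * poly [:Z $ 1 $ 2, Z $ 1 $ 1:] (y / z)"
        "Z $ 2 $ 1 * y + Z $ 2 $ 2 * z = z * poly [:Z $ 2 $ 2, Z $ 2 $ 1:] (y / z)"
        using False by (simp_all add: field_simps)
      hence "(Z $ 1 $ 1 * y + Z $ 1 $ 2 * z) ^ R * (Z $ 2 $ 1 * y + Z $ 2 $ 2 * z) ^ S
          = z ^ (R + S) * poly ([:Z $ 1 $ 2, Z $ 1 $ 1:] ^ R * [:Z $ 2 $ 2, Z $ 2 $ 1:] ^ S) (y / z)"
        by (simp only: poly_mult poly_power power_mult_distrib power_add mult_ac)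
      also have "\<dots> = z ^ (R + S) * (\<Sum>C\<le>R + S. harm_basis R S C Z * (y / z) ^ C)"
        unfolding poly_sum_le[OF degree_harm_basis] harm_basis_def ..
      finally show ?thesis
        by (simp add: sum_distrib_left mult_ac)
    qed
    thus ?thesis
      using W by (simp only:) (intro subspace_fun_sum subspace_fun_scale harm_basis; simp)
  qed
  have "(\<lambda>Z. lform u v Z ^ n) \<in> W" for u v n
  proof -
    let ?A = "\<lambda>Z :: HC. Z $ 1 $ 1 * v $ 1 + Z $ 1 $ 2 * v $ 2" and ?B = "\<lambda>Z :: HC. Z $ 2 $ 1 * v $ 1 + Z $ 2 $ 2 * v $ 2"
    have "lform u v Z ^ n = (\<Sum>k\<le>n. (of_nat (n choose k) * (u $ 1) ^ k * (u $ 2) ^ (n - k)) * (?A Z ^ k * ?B Z ^ (n - k)))" for Z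
    proof -
      have "lform u v Z = u $ 1 * ?A Z + u $ 2 * ?B Z"
        by (simp add: lform_def sum_2 algebra_simps)
      hence "lform u v Z ^ n = (\<Sum>k\<le>n. of_nat (n choose k) * (u $ 1 * ?A Z) ^ k * (u $ 2 * ?B Z) ^ (n - k))"
        by (simp only: binomial_ring)
      thus ?thesis by (simp only: power_mult_distrib mult_ac)
    qed
    thus ?thesis
      using W by (simp only:) (intro subspace_fun_sum subspace_fun_scale prod)
  qed
  thus ?thesis
    unfolding harmonic_polynomials_eq_lpowers lpowers_def by (intro cfun.span_minimal W) auto
qed

section \<open>The matrix coefficients as transforms of the weight basis\<close>

lemma group_op_half_mero:
  "Z \<in> regular_set \<Longrightarrow> group_op half_inversion (mero f) Z = 1 / Z $ 2 $ 2 * f (frac_lin half_inversion Z)"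
  by (simp add: group_op_half frac_lin_half_regular)

lemma harm_basis_half_inversion:
  assumes nz: "Z $ 2 $ 2 \<noteq> 0"
  shows "1 / Z $ 2 $ 2 * harm_basis R S C (frac_lin half_inversion Z) = (\<Sum>a\<le>C. (-1) ^ (C - a) * of_nat (R choose a) * of_nat (S choose (C - a)) *
    N Z ^ a * (Z $ 1 $ 2) ^ (R - a) * (Z $ 2 $ 1) ^ (C - a)) / (Z $ 2 $ 2) ^ (R + S + 1)"
proof -
  have "1 / Z $ 2 $ 2 * (of_nat (R choose a) * of_nat (S choose (C - a)) *
      (N Z / Z $ 2 $ 2) ^ a * (Z $ 1 $ 2 / Z $ 2 $ 2) ^ (R - a) * (- (Z $ 2 $ 1 / Z $ 2 $ 2)) ^ (C - a) * (1 / Z $ 2 $ 2) ^ (S - (C - a)))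
    = (-1) ^ (C - a) * of_nat (R choose a) * of_nat (S choose (C - a)) *
      N Z ^ a * (Z $ 1 $ 2) ^ (R - a) * (Z $ 2 $ 1) ^ (C - a) / (Z $ 2 $ 2) ^ (R + S + 1)" for a
  proof (cases "a \<le> R \<and> C - a \<le> S")
    case True
    hence exponent: "(Z $ 2 $ 2) ^ (R + S + 1) = Z $ 2 $ 2 * ((Z $ 2 $ 2) ^ a * (Z $ 2 $ 2) ^ (R - a) * (Z $ 2 $ 2) ^ (C - a) * (Z $ 2 $ 2) ^ (S - (C - a)))"
      by (simp flip: power_add power_Suc)
    have sign: "(- (Z $ 2 $ 1 / Z $ 2 $ 2)) ^ (C - a) = (-1) ^ (C - a) * ((Z $ 2 $ 1) ^ (C - a) / (Z $ 2 $ 2) ^ (C - a))"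
      by (simp only: power_minus[of "_ / _"] power_divide)
    show ?thesis
      unfolding exponent sign by (simp add: power_divide mult_ac)
  next
    case False
    hence "R choose a = 0 \<or> S choose (C - a) = 0"
      by (metis binomial_eq_0 not_le)
    thus ?thesis
      by (elim disjE) (simp_all only: of_nat_0 mult_zero_left mult_zero_right div_0)
  qed
  thus ?thesis
    unfolding harm_basis_expand half_inversion_simps(2-5)[OF nz] sum_distrib_left sum_divide_distrib
    by (simp only:)
qed

text \<open>Both sides are the same quotient of factorials; the numbers \<open>p\<close> and \<open>r\<close> enter it symmetrically.\<close>
lemma binomial_exchange:
  assumes "a \<le> p" "a \<le> r"
  shows "fact r * fact (p + \<kappa>) * (of_nat (p choose a) * of_nat ((\<kappa> + r) choose (r - a)))
    = fact p * fact (\<kappa> + r) * (of_nat (r choose a) * of_nat ((p + \<kappa>) choose (p - a)) :: complex)"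
proof -
  have "\<kappa> + r - (r - a) = \<kappa> + a" "p + \<kappa> - (p - a) = \<kappa> + a"
    using assms by auto
  thus ?thesis
    using assms by (simp add: binomial_fact mult_ac)
qed

lemma sign_exchange:
  assumes "a \<le> p" "a \<le> r"
  shows "(-1) ^ (p + r) * (-1) ^ (p - a) = ((-1) ^ (r - a) :: complex)"
proof -
  have "p + r + (p - a) = (r - a) + 2 * p"
    using assms by auto
  thus ?thesis
    by (metis (no_types, lifting) mult.right_neutral power_add power_even_eq power_minus1_even power_mult power_one)
qed

text \<open>Both functions are sums over the same monomials, as they must be since both are weight vectors
  of the same weight; the coefficients agree up to the factor from \<open>binomial_exchange\<close>.\<close>
lemma t_coeff_eq_harm_basis:
  assumes nz: "Z $ 2 $ 2 \<noteq> 0"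
  shows "fact r * fact (p + \<kappa>) * t_coeff \<kappa> p r Z
    = (-1) ^ (p + r) * (fact p * fact (\<kappa> + r)) * (1 / Z $ 2 $ 2 * harm_basis r (p + \<kappa>) p (frac_lin half_inversion Z))"
proof -
  let ?M = "\<lambda>a. N Z ^ a * (Z $ 2 $ 1) ^ (p - a) * (Z $ 1 $ 2) ^ (r - a)"
  let ?L = "\<lambda>a. (-1) ^ (r - a) * of_nat (p choose a) * of_nat ((\<kappa> + r) choose (r - a)) *
      N Z ^ a * (Z $ 2 $ 1) ^ (p - a) * (Z $ 1 $ 2) ^ (r - a)"
  let ?R = "\<lambda>a. (-1) ^ (p - a) * of_nat (r choose a) * of_nat ((p + \<kappa>) choose (p - a)) *
      N Z ^ a * (Z $ 1 $ 2) ^ (r - a) * (Z $ 2 $ 1) ^ (p - a)"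
  have "fact r * fact (p + \<kappa>) * ?L a = (-1) ^ (p + r) * (fact p * fact (\<kappa> + r)) * ?R a" if "a \<in> {..min p r}" for a
  proof -
    have le: "a \<le> p" "a \<le> r" using that by auto
    have "fact r * fact (p + \<kappa>) * ?L a
        = (-1) ^ (r - a) * (fact r * fact (p + \<kappa>) * (of_nat (p choose a) * of_nat ((\<kappa> + r) choose (r - a)))) * ?M a"
      by (simp only: mult_ac)
    also have "\<dots> = (-1) ^ (p + r) * (-1) ^ (p - a) *
        (fact p * fact (\<kappa> + r) * (of_nat (r choose a) * of_nat ((p + \<kappa>) choose (p - a)))) * ?M a"
      by (simp only: sign_exchange[OF le] binomial_exchange[OF le])
    also have "\<dots> = (-1) ^ (p + r) * (fact p * fact (\<kappa> + r)) * ?R a"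
      by (simp only: mult_ac)
    finally show ?thesis .
  qed
  hence "fact r * fact (p + \<kappa>) * sum ?L {..min p r} = (-1) ^ (p + r) * (fact p * fact (\<kappa> + r)) * sum ?R {..min p r}"
    unfolding sum_distrib_left by (rule sum.cong[OF refl])
  also have "sum ?R {..min p r} = sum ?R {..p}"
    by (rule sum.mono_neutral_left) (auto simp: binomial_eq_0_iff)
  finally have main: "fact r * fact (p + \<kappa>) * sum ?L {..min p r} = (-1) ^ (p + r) * (fact p * fact (\<kappa> + r)) * sum ?R {..p}" .
  have "\<kappa> + 1 + p + r = r + (p + \<kappa>) + 1"
    by simp
  thus ?thesis
    unfolding harm_basis_half_inversion[OF nz] t_coeff_def times_divide_eq_right main by (simp only:)
qed

text \<open>Here the sum for \<^const>\<open>harm_basis\<close> starts at \<open>\<kappa>\<close>, and the shift of the index accounts for the factor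
  \<open>N Z ^ \<kappa>\<close>.\<close>
lemma N_power_t_coeff_eq_harm_basis:
  assumes nz: "Z $ 2 $ 2 \<noteq> 0"
  shows "N Z ^ \<kappa> * t_coeff \<kappa> p r Z
    = (-1) ^ (p + r) * (1 / Z $ 2 $ 2 * harm_basis (r + \<kappa>) p (p + \<kappa>) (frac_lin half_inversion Z))"
proof -
  let ?L = "\<lambda>a. (-1) ^ (r - a) * of_nat (p choose a) * of_nat ((\<kappa> + r) choose (r - a)) *
      N Z ^ a * (Z $ 2 $ 1) ^ (p - a) * (Z $ 1 $ 2) ^ (r - a)"
  let ?R = "\<lambda>a. (-1) ^ (p + \<kappa> - a) * of_nat ((r + \<kappa>) choose a) * of_nat (p choose (p + \<kappa> - a)) *
      N Z ^ a * (Z $ 1 $ 2) ^ (r + \<kappa> - a) * (Z $ 2 $ 1) ^ (p + \<kappa> - a)"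
  have "N Z ^ \<kappa> * ?L a = (-1) ^ (p + r) * ?R (a + \<kappa>)" if "a \<in> {..min p r}" for a
  proof -
    have le: "a \<le> p" "a \<le> r" using that by auto
    have bin: "(r + \<kappa>) choose (a + \<kappa>) = (\<kappa> + r) choose (r - a)" "p choose (p - a) = p choose a"
      using binomial_symmetric[of "a + \<kappa>" "r + \<kappa>"] binomial_symmetric[of a p] le by (simp_all add: add.commute)
    have sub: "p + \<kappa> - (a + \<kappa>) = p - a" "r + \<kappa> - (a + \<kappa>) = r - a"
      by simp_all
    show ?thesis
      unfolding sub bin sign_exchange[OF le, symmetric] power_add[of "N Z"] by (simp only: mult_ac)
  qed
  hence "N Z ^ \<kappa> * sum ?L {..min p r} = (-1) ^ (p + r) * (\<Sum>a\<le>min p r. ?R (a + \<kappa>))"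
    unfolding sum_distrib_left by (rule sum.cong[OF refl])
  also have "(\<Sum>a\<le>min p r. ?R (a + \<kappa>)) = sum ?R {\<kappa>..min p r + \<kappa>}"
    using sum.shift_bounds_cl_nat_ivl[of ?R 0 \<kappa> "min p r"] by (simp add: atMost_atLeast0)
  also have "\<dots> = sum ?R {..p + \<kappa>}"
    by (rule sum.mono_neutral_left) (auto simp: binomial_eq_0_iff)
  finally have main: "N Z ^ \<kappa> * sum ?L {..min p r} = (-1) ^ (p + r) * sum ?R {..p + \<kappa>}" .
  have "\<kappa> + 1 + p + r = r + \<kappa> + p + 1"
    by simp
  thus ?thesis
    unfolding harm_basis_half_inversion[OF nz] t_coeff_def times_divide_eq_right main by (simp only:)
qed

section \<open>Identification of the spaces spanned by the matrix coefficients\<close>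

definition t_generators :: "(HC \<Rightarrow> complex) set" where
  "t_generators = (\<Union>\<kappa> p r. {mero (t_coeff \<kappa> p r), mero (\<lambda>Z. N Z ^ \<kappa> * t_coeff \<kappa> p r Z)})"

definition reflect :: "(HC \<Rightarrow> complex) \<Rightarrow> HC \<Rightarrow> complex" where
  "reflect f = (\<lambda>Z. f (flip Z))"

lemma neg_half_integersE:
  assumes "l \<in> neg_half_integers"
  obtains \<kappa> where "l = - real (Suc \<kappa>) / 2" "\<lfloor>- 2 * l - 1\<rfloor> = int \<kappa>"
proof -
  obtain k where k: "l = - real k / 2" "k \<ge> 1"
    using assms by (auto simp: neg_half_integers_def)
  show ?thesis
    by (rule that[of "k - 1"]) (use k in \<open>simp_all add: of_nat_diff field_simps\<close>)
qed

lemma neg_half_integersI: "- real (Suc \<kappa>) / 2 \<in> neg_half_integers"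
  by (auto simp: neg_half_integers_def intro!: exI[of _ "Suc \<kappa>"])

lemma floor_kappa: "\<lfloor>- 2 * (- real (Suc \<kappa>) / 2) - 1\<rfloor> = int \<kappa>"
  by (rule floor_of_int_real) (simp add: field_simps)

lemma nat_differenceE:
  fixes x y :: real
  assumes "x - y \<in> \<int>" "x \<le> y"
  obtains p :: nat where "x = y - real p"
proof -
  obtain i where i: "x - y = of_int i"
    using assms(1) by (auto elim: Ints_cases)
  hence "i \<le> 0" using assms(2) by simp
  hence "x = y - real (nat (- i))"
    using i by simp
  thus ?thesis by (rule that)
qed

lemma N_power_mero: "(\<lambda>Z. N Z ^ \<kappa> * mero f Z) = mero (\<lambda>Z. N Z ^ \<kappa> * f Z)"
  by (auto simp: mero_def)

text \<open>The parameters are \<open>\<kappa> = - 2 l - 1\<close>, \<open>p = l - m\<close>, \<open>r = l - n\<close>, which run over all natural numbers.\<close>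
lemma D_plus_eq_span: "D_plus = cfun.span t_generators"
proof -
  let ?G = "\<Union>l\<in>neg_half_integers. \<Union>(m, n)\<in>{(m, n). m - l \<in> \<int> \<and> n - l \<in> \<int> \<and> m \<le> l \<and> n \<le> l}.
       {t l n m, \<lambda>Z. N Z powi \<lfloor>- 2 * l - 1\<rfloor> * t l n m Z}"
  have "?G \<subseteq> t_generators"
  proof
    fix f assume "f \<in> ?G"
    then obtain l m n where l: "l \<in> neg_half_integers" and m: "m - l \<in> \<int>" "m \<le> l" and n: "n - l \<in> \<int>" "n \<le> l"
      and f: "f = t l n m \<or> f = (\<lambda>Z. N Z powi \<lfloor>- 2 * l - 1\<rfloor> * t l n m Z)"
      by auto
    obtain \<kappa> where \<kappa>: "l = - real (Suc \<kappa>) / 2" "\<lfloor>- 2 * l - 1\<rfloor> = int \<kappa>"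
      using l by (rule neg_half_integersE)
    obtain p where p: "m = l - real p" using m by (rule nat_differenceE)
    obtain r where r: "n = l - real r" using n by (rule nat_differenceE)
    show "f \<in> t_generators"
      using f unfolding \<kappa>(2) t_plus[OF \<kappa>(1) p r] power_int_of_nat N_power_mero t_generators_def by blast
  qed
  moreover have "t_generators \<subseteq> ?G"
  proof
    fix f assume "f \<in> t_generators"
    then obtain \<kappa> p r where f: "f = mero (t_coeff \<kappa> p r) \<or> f = mero (\<lambda>Z. N Z ^ \<kappa> * t_coeff \<kappa> p r Z)"
      by (auto simp: t_generators_def)
    define l where "l = - real (Suc \<kappa>) / 2"
    have l: "l \<in> neg_half_integers" "\<lfloor>- 2 * l - 1\<rfloor> = int \<kappa>"
      unfolding l_def by (rule neg_half_integersI floor_kappa)+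
    have "f \<in> {t l (l - real r) (l - real p), \<lambda>Z. N Z powi \<lfloor>- 2 * l - 1\<rfloor> * t l (l - real r) (l - real p) Z}"
      using f unfolding l(2) t_plus[OF l_def refl refl] power_int_of_nat N_power_mero
      by (simp only: insert_iff empty_iff simp_thms)
    moreover have mem: "(l - real p, l - real r) \<in> {(m, n). m - l \<in> \<int> \<and> n - l \<in> \<int> \<and> m \<le> l \<and> n \<le> l}"
      by simp
    ultimately show "f \<in> ?G"
      by (intro UN_I[OF l(1)] UN_I[OF mem]) (simp only: prod.case)
  qed
  ultimately have "?G = t_generators"
    by (rule antisym)
  thus ?thesis
    by (simp only: D_plus_def)
qed

lemma D_minus_eq_span: "D_minus = cfun.span (reflect ` t_generators)"
proof -
  let ?G = "\<Union>l\<in>neg_half_integers. \<Union>(m, n)\<in>{(m, n). m - l \<in> \<int> \<and> n - l \<in> \<int> \<and> m \<ge> - l \<and> n \<ge> - l}.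
       {t l n m, \<lambda>Z. N Z powi \<lfloor>- 2 * l - 1\<rfloor> * t l n m Z}"
  have reflect_mero: "reflect (mero f) = mero (\<lambda>Z. f (flip Z))" for f
    by (auto simp: reflect_def mero_def)
  have reflect_gens: "reflect ` t_generators = (\<Union>\<kappa> p r. {mero (\<lambda>Z. t_coeff \<kappa> p r (flip Z)), mero (\<lambda>Z. N Z ^ \<kappa> * t_coeff \<kappa> p r (flip Z))})"
    by (simp add: t_generators_def image_UN reflect_mero)
  have "?G \<subseteq> reflect ` t_generators"
  proof
    fix f assume "f \<in> ?G"
    then obtain l m n where l: "l \<in> neg_half_integers" and m: "m - l \<in> \<int>" "- l \<le> m" and n: "n - l \<in> \<int>" "- l \<le> n"
      and f: "f = t l n m \<or> f = (\<lambda>Z. N Z powi \<lfloor>- 2 * l - 1\<rfloor> * t l n m Z)"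
      by auto
    obtain \<kappa> where \<kappa>: "l = - real (Suc \<kappa>) / 2" "\<lfloor>- 2 * l - 1\<rfloor> = int \<kappa>"
      using l by (rule neg_half_integersE)
    have "2 * l = - real (Suc \<kappa>)"
      using \<kappa>(1) by simp
    hence l2: "2 * l \<in> \<int>"
      by (metis Ints_minus Ints_of_nat)
    have "- l - x = - (x - l + 2 * l)" for x
      by simp
    hence "- l - m \<in> \<int>" "- l - n \<in> \<int>"
      using Ints_add[OF m(1) l2] Ints_add[OF n(1) l2] by (metis Ints_minus)+
    then obtain p r where "- l = m - real p" "- l = n - real r"
      using m(2) n(2) nat_differenceE by metis
    hence p: "m = - l + real p" and r: "n = - l + real r"
      by simp_all
    show "f \<in> reflect ` t_generators"
      using f unfolding \<kappa>(2) t_minus[OF \<kappa>(1) p r] power_int_of_nat N_power_mero reflect_gens by blast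
  qed
  moreover have "reflect ` t_generators \<subseteq> ?G"
  proof
    fix f assume "f \<in> reflect ` t_generators"
    then obtain \<kappa> p r where f: "f = mero (\<lambda>Z. t_coeff \<kappa> p r (flip Z)) \<or> f = mero (\<lambda>Z. N Z ^ \<kappa> * t_coeff \<kappa> p r (flip Z))"
      unfolding reflect_gens by blast
    define l where "l = - real (Suc \<kappa>) / 2"
    have l: "l \<in> neg_half_integers" "\<lfloor>- 2 * l - 1\<rfloor> = int \<kappa>"
      unfolding l_def by (rule neg_half_integersI floor_kappa)+
    have "- l + real x - l = real (Suc \<kappa> + x)" for x
      by (simp add: l_def field_simps)
    hence int: "- l + real x - l \<in> \<int>" for x
      by (metis Ints_of_nat)
    have "f \<in> {t l (- l + real r) (- l + real p), \<lambda>Z. N Z powi \<lfloor>- 2 * l - 1\<rfloor> * t l (- l + real r) (- l + real p) Z}"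
      using f unfolding l(2) t_minus[OF l_def refl refl] power_int_of_nat N_power_mero
      by (simp only: insert_iff empty_iff simp_thms)
    moreover have mem: "(- l + real p, - l + real r) \<in> {(m, n). m - l \<in> \<int> \<and> n - l \<in> \<int> \<and> m \<ge> - l \<and> n \<ge> - l}"
      using int by simp
    ultimately show "f \<in> ?G"
      by (intro UN_I[OF l(1)] UN_I[OF mem]) (simp only: prod.case)
  qed
  ultimately have "?G = reflect ` t_generators"
    by (rule antisym)
  thus ?thesis
    by (simp only: D_minus_def)
qed

lemma subspace_group_op_image: "cfun.subspace V \<Longrightarrow> cfun.subspace (group_op g ` V)"
  using linear_between_subspace_image[OF linear_between_group_op] by blast

lemma group_op_add: "group_op g (f + h) = group_op g f + group_op g h"
  and group_op_scale: "group_op g (cscale c f) = cscale c (group_op g f)"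
  using linear_between_group_op[of UNIV g] by (auto simp: linear_between_def)

lemma group_op_half_mero_eqI:
  assumes "\<And>Z. Z $ 2 $ 2 \<noteq> 0 \<Longrightarrow> f Z = c * (1 / Z $ 2 $ 2 * h (frac_lin half_inversion Z))"
  shows "mero f = cscale c (group_op half_inversion (mero h))"
proof
  fix Z
  show "mero f Z = cscale c (group_op half_inversion (mero h)) Z"
  proof (cases "Z \<in> regular_set")
    case True
    thus ?thesis
      using assms[of Z] by (simp add: cscale_def group_op_half_mero) (simp add: regular_set_def)
  next
    case False
    thus ?thesis by (simp add: cscale_def group_op_def mero_def)
  qed
qed

lemma mero_t_coeff:
  "mero (t_coeff \<kappa> p r) = cscale ((-1) ^ (p + r) * fact p * fact (\<kappa> + r) / (fact r * fact (p + \<kappa>)))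
     (group_op half_inversion (mero (harm_basis r (p + \<kappa>) p)))"
  by (rule group_op_half_mero_eqI) (use t_coeff_eq_harm_basis[of _ r p \<kappa>] in \<open>simp add: field_simps\<close>)

lemma mero_N_power_t_coeff:
  "mero (\<lambda>Z. N Z ^ \<kappa> * t_coeff \<kappa> p r Z) = cscale ((-1) ^ (p + r)) (group_op half_inversion (mero (harm_basis (r + \<kappa>) p (p + \<kappa>))))"
  by (rule group_op_half_mero_eqI) (rule N_power_t_coeff_eq_harm_basis)

text \<open>The two families of generators cover the weight basis: those elements \<^term>\<open>harm_basis R S C\<close>
  with \<open>C \<le> S\<close> come from the matrix coefficients themselves, those with \<open>S \<le> C\<close> from their
  multiples by powers of \<^const>\<open>N\<close>.\<close>
lemma D_plus_eq: "D_plus = group_op half_inversion ` H_plus"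
proof (rule antisym)
  have sub: "cfun.subspace (group_op half_inversion ` H_plus)"
    unfolding H_plus_def by (intro subspace_group_op_image subspace_mero_image subspace_harmonic)
  have "mero (harm_basis R S C) \<in> H_plus" for R S C
    using harm_basis_in_lpowers by (simp add: H_plus_def harmonic_polynomials_eq_lpowers)
  hence "t_generators \<subseteq> group_op half_inversion ` H_plus"
    unfolding t_generators_def mero_t_coeff mero_N_power_t_coeff
    using cfun.subspace_scale[OF sub] by blast
  thus "D_plus \<subseteq> group_op half_inversion ` H_plus"
    unfolding D_plus_eq_span by (intro cfun.span_minimal sub)
next
  let ?W = "{f. group_op half_inversion (mero f) \<in> D_plus}"
  have D: "cfun.subspace D_plus"
    by (simp add: D_plus_eq_span)
  have "group_op half_inversion 0 = 0"
    by (auto simp: group_op_def group_act_eq mero_def)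
  hence W: "cfun.subspace ?W"
    by (intro subspace_funI) (auto simp: mero_add mero_scale mero_zero group_op_add group_op_scale
        cfun.subspace_0[OF D] intro: cfun.subspace_add[OF D] cfun.subspace_scale[OF D])
  have unscale: "f \<in> D_plus" if "cscale c f \<in> t_generators" "c \<noteq> 0" for c f
  proof -
    have "cscale (1 / c) (cscale c f) \<in> D_plus"
      unfolding D_plus_eq_span by (intro cfun.span_scale cfun.span_base that)
    thus ?thesis using that(2) by simp
  qed
  have "harm_basis R S C \<in> ?W" if C: "C \<le> R + S" for R S C
  proof (cases "C \<le> S")
    case True
    then obtain \<kappa> where S: "S = C + \<kappa>" using le_Suc_ex by blast
    have "mero (t_coeff \<kappa> C R) \<in> t_generators"
      unfolding t_generators_def by blast
    thus ?thesis
      unfolding S mero_t_coeff by (simp add: unscale)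
  next
    case False
    then obtain \<kappa> where "C = S + \<kappa>" using le_Suc_ex nat_le_linear by blast
    moreover with C obtain r where "R = r + \<kappa>" by (metis add.commute add_le_cancel_left le_Suc_ex)
    moreover have "mero (\<lambda>Z. N Z ^ \<kappa> * t_coeff \<kappa> S r Z) \<in> t_generators"
      unfolding t_generators_def by blast
    hence "group_op half_inversion (mero (harm_basis (r + \<kappa>) S (S + \<kappa>))) \<in> D_plus"
      unfolding mero_N_power_t_coeff by (rule unscale) simp
    ultimately show ?thesis
      by simp
  qed
  from harmonic_subset_if_harm_basis[OF W this]
  show "group_op half_inversion ` H_plus \<subseteq> D_plus"
    by (auto simp: H_plus_def)
qed

lemma reflect_reflect [simp]: "reflect (reflect f) = f"
  by (simp add: reflect_def)

lemma reflect_lpowers: "f \<in> lpowers \<Longrightarrow> reflect f \<in> lpowers"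
proof (induction rule: lpowers_induct)
  case zero
  show ?case using subspace_fun_0[OF subspace_lpowers] by (simp add: reflect_def)
next
  case (power u v n)
  define s where "s = (\<lambda>w :: complex^2. (\<chi> i. w $ (if i = 1 then 2 else 1)) :: complex^2)"
  have "reflect (\<lambda>Z. lform u v Z ^ n) = (\<lambda>Z. lform (s u) (s v) Z ^ n)"
    by (simp add: reflect_def lform_def sum_2 s_def algebra_simps)
  thus ?case by (simp only: lform_power_in_lpowers)
qed (auto simp: reflect_def intro: subspace_fun_intros[OF subspace_lpowers])

lemma reflect_H_plus: "reflect ` H_plus = H_plus"
proof -
  have "reflect ` H_plus \<subseteq> H_plus"
  proof
    fix g assume "g \<in> reflect ` H_plus"
    then obtain f where f: "f \<in> lpowers" "g = reflect (mero f)"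
      by (auto simp: H_plus_def harmonic_polynomials_eq_lpowers)
    have "g = mero (reflect f)"
      by (auto simp: f(2) reflect_def mero_def)
    thus "g \<in> H_plus"
      using reflect_lpowers[OF f(1)] by (simp add: H_plus_def harmonic_polynomials_eq_lpowers)
  qed
  moreover from image_mono[OF this, of reflect] have "H_plus \<subseteq> reflect ` H_plus"
    by (simp add: image_image)
  ultimately show ?thesis
    by (rule antisym)
qed

lemma linear_between_reflect: "linear_between V reflect (reflect ` V)"
  by (auto simp: linear_between_def reflect_def cscale_def fun_eq_iff)

lemma D_minus_eq_reflect: "D_minus = reflect ` D_plus"
proof -
  have *: "cfun.span (reflect ` A) \<subseteq> reflect ` cfun.span A" for A
    by (intro cfun.span_minimal image_mono cfun.span_superset
        linear_between_subspace_image[OF linear_between_reflect cfun.subspace_span order_refl])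
  have "cfun.span t_generators = cfun.span (reflect ` reflect ` t_generators)"
    by (simp add: image_image)
  also have "\<dots> \<subseteq> reflect ` cfun.span (reflect ` t_generators)"
    by (rule *)
  finally have "reflect ` cfun.span t_generators \<subseteq> cfun.span (reflect ` t_generators)"
    by auto
  with *[of t_generators] show ?thesis
    unfolding D_plus_eq_span D_minus_eq_span by auto
qed

text \<open>The three operators come, up to sign, from permutations of the four basis vectors of \<open>\<complex>\<^sup>4\<close>, and
  this is the identity
  \<open>(1 2) (3 4) \<circ> (2 4) \<circ> (1 2) (3 4) = (1 3) = (2 4) \<circ> (1 3) (2 4)\<close>.\<close>
lemma half_inversion_reflect:
  "reflect (group_op half_inversion (reflect f)) = group_op half_inversion (group_op inversion f)"
proof
  fix Z
  show "reflect (group_op half_inversion (reflect f)) Z = group_op half_inversion (group_op inversion f) Z"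
  proof (cases "Z \<in> regular_set")
    case True
    hence nz: "Z $ 1 $ 1 \<noteq> 0" "Z $ 2 $ 2 \<noteq> 0" "N Z \<noteq> 0"
      by (auto simp: regular_set_def)
    let ?W = "frac_lin half_inversion Z"
    have NW: "N ?W = Z $ 1 $ 1 / Z $ 2 $ 2" "N ?W \<noteq> 0"
      using nz by (auto simp: N_half_inversion)
    have "flip (frac_lin half_inversion (flip Z)) = matrix_inv ?W"
      using nz by (simp add: vec_eq_iff forall_2 half_inversion_simps matrix_inv_2[OF NW(2)] NW(1))
    thus ?thesis
      using True nz by (simp add: reflect_def group_op_half group_op_inv frac_lin_half_regular NW(1))
  next
    case False
    thus ?thesis by (simp add: reflect_def group_op_def mero_def)
  qed
qed

lemma D_minus_eq: "D_minus = group_op half_inversion ` H_minus"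
proof -
  have "D_minus = reflect ` group_op half_inversion ` reflect ` H_plus"
    by (simp add: D_minus_eq_reflect D_plus_eq reflect_H_plus)
  thus ?thesis
    by (simp add: H_minus_eq image_image half_inversion_reflect)
qed

section \<open>Extremal weight vectors\<close>

lemma lie_act_inverse_coord:
  assumes "Z \<in> regular_set" "i \<in> {1, 2}"
  shows "lie_act X (mero (\<lambda>Z. 1 / Z $ i $ i)) Z = mult_factor X Z / Z $ i $ i + vfield X Z $ i $ i / (Z $ i $ i)\<^sup>2"
proof -
  have nz: "Z $ i $ i \<noteq> 0" using assms by (auto simp: regular_set_def)
  have "((\<lambda>Z. 1 / Z $ i $ i) has_derivative (\<lambda>H. - (H $ i $ i / (Z $ i $ i)\<^sup>2))) (at Z)"
    by (rule has_derivative_eq_rhs[OF has_derivative_divide[OF has_derivative_const has_derivative_vec_nth[OF has_derivative_vec_nth[OF has_derivative_ident]] nz]])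
       (simp add: fun_eq_iff power2_eq_square field_simps)
  hence "(mero (\<lambda>Z. 1 / Z $ i $ i) has_derivative (\<lambda>H. - (H $ i $ i / (Z $ i $ i)\<^sup>2))) (at Z)"
    using has_derivative_mero[OF assms(1)] by blast
  from lie_act_eq[OF this assms(1)] show ?thesis
    using assms(1) by simp
qed

text \<open>A constant is annihilated by all root vectors except those in the block \<open>c\<close>.  Hence its image
  \<open>1 / z\<^sub>2\<^sub>2\<close> under \<^const>\<open>half_inversion\<close> is annihilated by all \<^term>\<open>root_vector i j\<close> except those
  with \<open>i\<close> in \<open>{Inl 2, Inr 1}\<close> and \<open>j\<close> in \<open>{Inl 1, Inr 2}\<close>; for \<open>1 / z\<^sub>1\<^sub>1\<close> the two sets
  change places.  Any ordering that puts Inl 1 and Inr 2 before the other two indices serves.\<close>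
definition index_rank :: "2 + 2 \<Rightarrow> nat" where
  "index_rank i = (case i of Inl k \<Rightarrow> if k = 1 then 0 else 2 | Inr k \<Rightarrow> if k = 2 then 1 else 3)"

definition pos_roots :: "((2 + 2) \<times> (2 + 2)) set" where
  "pos_roots = {(i, j). index_rank i < index_rank j}"

lemma index_cases: "i = Inl 1 \<or> i = Inl 2 \<or> i = Inr 1 \<or> i = Inr 2" for i :: "2 + 2"
  by (cases i) (metis exhaust_2)+

lemma positive_pos_roots: "positive_roots pos_roots"
proof -
  have inj: "index_rank i = index_rank j \<longleftrightarrow> i = j" for i j
    using index_cases[of i] index_cases[of j] by (elim disjE) (simp_all add: index_rank_def)
  hence "index_rank i < index_rank j \<or> index_rank j < index_rank i \<longleftrightarrow> i \<noteq> j" for i j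
    using nat_neq_iff by metis
  hence "pos_roots \<union> pos_roots\<inverse> = {(i, j). i \<noteq> j}"
    unfolding pos_roots_def converse_unfold by blast
  moreover have "pos_roots \<inter> pos_roots\<inverse> = {}" "trans pos_roots"
    by (auto simp: pos_roots_def trans_def)
  ultimately show ?thesis
    by (simp add: positive_roots_def)
qed

lemma cartan_inverse_coord:
  assumes H: "X \<in> cartan" and i: "i \<in> {1, 2}"
  shows "\<exists>c. lie_act X (mero (\<lambda>Z. 1 / Z $ i $ i)) = cscale c (mero (\<lambda>Z. 1 / Z $ i $ i))"
proof -
  have off: "X $ a $ b = 0" if "a \<noteq> b" for a b
    using H that by (simp add: cartan_def)
  define c where "c = X $ Inr 1 $ Inr 1 + X $ Inr 2 $ Inr 2 + X $ Inl i $ Inl i - X $ Inr i $ Inr i"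
  have "lie_act X (mero (\<lambda>Z. 1 / Z $ i $ i)) Z = c * (1 / Z $ i $ i)" if Z: "Z \<in> regular_set" for Z
  proof -
    have "Z $ i $ i \<noteq> 0" using Z i by (auto simp: regular_set_def)
    moreover have "mult_factor X Z = X $ Inr 1 $ Inr 1 + X $ Inr 2 $ Inr 2"
      by (simp add: mult_factor_def trace_def sum_2 block_defs matrix_matrix_mult_def off)
    moreover have "vfield X Z $ i $ i = (X $ Inl i $ Inl i - X $ Inr i $ Inr i) * Z $ i $ i"
      using i by (auto simp: vfield_def sum_2 block_defs matrix_matrix_mult_def off algebra_simps)
    ultimately show ?thesis
      by (simp add: lie_act_inverse_coord[OF Z i] c_def add_divide_distrib diff_divide_distrib power2_eq_square)
  qed
  hence "lie_act X (mero (\<lambda>Z. 1 / Z $ i $ i)) = mero (\<lambda>Z. c * (1 / Z $ i $ i))"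
    by (auto simp: mero_def lie_act_def)
  thus ?thesis
    unfolding mero_scale by blast
qed

lemma root_vector_inverse_coord:
  assumes "index_rank a < index_rank b"
  shows "lie_act (root_vector a b) (mero (\<lambda>Z. 1 / Z $ 2 $ 2)) = 0"
    and "lie_act (root_vector b a) (mero (\<lambda>Z. 1 / Z $ 1 $ 1)) = 0"
proof -
  note defs = mult_factor_def vfield_def trace_def sum_2 block_defs matrix_matrix_mult_def root_vector_def index_rank_def
  have "lie_act (root_vector a b) (mero (\<lambda>Z. 1 / Z $ 2 $ 2)) Z = 0
      \<and> lie_act (root_vector b a) (mero (\<lambda>Z. 1 / Z $ 1 $ 1)) Z = 0" if Z: "Z \<in> regular_set" for Z
    using index_cases[of a] index_cases[of b] assms Z
    by (elim disjE) (simp_all add: lie_act_inverse_coord defs regular_set_def power2_eq_square)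
  thus "lie_act (root_vector a b) (mero (\<lambda>Z. 1 / Z $ 2 $ 2)) = 0"
    "lie_act (root_vector b a) (mero (\<lambda>Z. 1 / Z $ 1 $ 1)) = 0"
    by (auto simp: fun_eq_iff lie_act_def mero_def)
qed

lemma t_coeff_0: "t_coeff 0 0 0 = (\<lambda>Z. 1 / Z $ 2 $ 2)"
  by (simp add: fun_eq_iff t_coeff_def)

lemma t_plus_extremal: "t (-1/2) (-1/2) (-1/2) = mero (\<lambda>Z. 1 / Z $ 2 $ 2)"
proof -
  have "t (-1/2) (-1/2) (-1/2) = mero (t_coeff 0 0 0)"
    by (rule t_plus) simp_all
  thus ?thesis by (simp only: t_coeff_0)
qed

lemma t_minus_extremal: "t (-1/2) (1/2) (1/2) = mero (\<lambda>Z. 1 / Z $ 1 $ 1)"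
proof -
  have "t (-1/2) (1/2) (1/2) = mero (\<lambda>Z. t_coeff 0 0 0 (flip Z))"
    by (rule t_minus) simp_all
  thus ?thesis by (simp only: t_coeff_0 flip_nth)
qed

lemma extremal_in_D:
  "mero (\<lambda>Z. 1 / Z $ 2 $ 2) \<in> D_plus" "mero (\<lambda>Z. 1 / Z $ 1 $ 1) \<in> D_minus"
proof -
  have "mero (t_coeff 0 0 0) \<in> t_generators"
    unfolding t_generators_def by blast
  hence gen: "mero (\<lambda>Z. 1 / Z $ 2 $ 2) \<in> t_generators"
    by (simp only: t_coeff_0)
  have refl: "reflect (mero (\<lambda>Z. 1 / Z $ 2 $ 2)) = mero (\<lambda>Z. 1 / Z $ 1 $ 1)"
    by (auto simp: reflect_def mero_def)
  show "mero (\<lambda>Z. 1 / Z $ 2 $ 2) \<in> D_plus"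
    unfolding D_plus_eq_span by (rule cfun.span_base[OF gen])
  show "mero (\<lambda>Z. 1 / Z $ 1 $ 1) \<in> D_minus"
    unfolding D_minus_eq_span refl[symmetric] by (intro cfun.span_base imageI gen)
qed

lemma mero_inverse_coord_nonzero:
  assumes "i \<in> {1, 2}"
  shows "mero (\<lambda>Z. 1 / Z $ i $ i) \<noteq> 0"
proof -
  have "mat 1 \<in> regular_set"
    by (simp add: regular_set_def N_def mat_def) (simp add: det_2)
  hence "mero (\<lambda>Z. 1 / Z $ i $ i) (mat 1) = 1"
    by (simp add: mat_def)
  thus ?thesis
    by (metis zero_fun_apply zero_neq_one)
qed

lemma weight_vectors:
  "highest_weight_vector pos_roots lie_act D_plus (mero (\<lambda>Z. 1 / Z $ 2 $ 2))"
  "highest_weight_vector (pos_roots\<inverse>) lie_act D_minus (mero (\<lambda>Z. 1 / Z $ 1 $ 1))"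
proof -
  have "\<forall>(i, j)\<in>pos_roots. lie_act (root_vector i j) (mero (\<lambda>Z. 1 / Z $ 2 $ 2)) = 0"
    "\<forall>(i, j)\<in>pos_roots\<inverse>. lie_act (root_vector i j) (mero (\<lambda>Z. 1 / Z $ 1 $ 1)) = 0"
    by (auto simp only: pos_roots_def converse_iff mem_Collect_eq prod.case root_vector_inverse_coord)
  thus "highest_weight_vector pos_roots lie_act D_plus (mero (\<lambda>Z. 1 / Z $ 2 $ 2))"
    "highest_weight_vector (pos_roots\<inverse>) lie_act D_minus (mero (\<lambda>Z. 1 / Z $ 1 $ 1))"
    unfolding highest_weight_vector_def
    by (intro conjI ballI extremal_in_D mero_inverse_coord_nonzero cartan_inverse_coord; simp)+
qed

theorem theorem39:
  shows "(\<exists>\<gamma>. invertible \<gamma> \<and>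
            sl4_rep_iso lie_act D_minus (twist \<gamma> lie_act) H_minus \<and>
            sl4_rep_iso lie_act D_plus (twist \<gamma> lie_act) H_plus) \<and>
         sl4_irreducible lie_act D_minus \<and>
         sl4_irreducible lie_act D_plus \<and>
         (\<exists>P. positive_roots P \<and>
            lowest_weight_vector P lie_act D_minus (t (-1/2) (1/2) (1/2)) \<and>
            highest_weight_vector P lie_act D_plus (t (-1/2) (-1/2) (-1/2))) \<and>
         t (-1/2) (1/2) (1/2) = mero (\<lambda>Z. 1 / Z $ 1 $ 1) \<and>
         t (-1/2) (-1/2) (-1/2) = mero (\<lambda>Z. 1 / Z $ 2 $ 2)"
proof (intro conjI exI)
  note half = regular_involution_half_inversion
  have minus: "rep_space H_minus"
    unfolding H_minus_eq by (rule rep_space_group_op(1)[OF regular_involution_inversion rep_space_H_plus])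
  show "invertible half_inversion"
    by (rule regular_involutionD(2)[OF half])
  show "sl4_rep_iso lie_act D_minus (twist half_inversion lie_act) H_minus"
    unfolding D_minus_eq by (rule rep_space_group_op(2)[OF half minus])
  show "sl4_rep_iso lie_act D_plus (twist half_inversion lie_act) H_plus"
    unfolding D_plus_eq by (rule rep_space_group_op(2)[OF half rep_space_H_plus])
  show "sl4_irreducible lie_act D_minus"
    using rep_space_group_op(1)[OF half minus] by (simp add: D_minus_eq rep_space_def)
  show "sl4_irreducible lie_act D_plus"
    using rep_space_group_op(1)[OF half rep_space_H_plus] by (simp add: D_plus_eq rep_space_def)
  show "positive_roots pos_roots"
    by (rule positive_pos_roots)
  show "lowest_weight_vector pos_roots lie_act D_minus (t (-1/2) (1/2) (1/2))"
    unfolding lowest_weight_vector_def t_minus_extremal by (rule weight_vectors)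
  show "highest_weight_vector pos_roots lie_act D_plus (t (-1/2) (-1/2) (-1/2))"
    unfolding t_plus_extremal by (rule weight_vectors)
  show "t (-1/2) (1/2) (1/2) = mero (\<lambda>Z. 1 / Z $ 1 $ 1)"
    by (rule t_minus_extremal)
  show "t (-1/2) (-1/2) (-1/2) = mero (\<lambda>Z. 1 / Z $ 2 $ 2)"
    by (rule t_plus_extremal)
qed

end
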